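(* For every nonnegative integer $n$ and every integer $t$ with $1\leq t\leq 4$, we have $$DSOME(50n+10t+1)\equiv 0\pmod{8}.$$
   Context: $DSOME(n)$ denotes the sum of all the odd parts in all the partitions of $n$ into distinct parts minus the sum of all the even parts in all those same partitions, with $DSOME(0)=0$. Equivalently, $\sum_{n\ge 0}DSOME(n)q^n=\prod_{j\ge1}(1+q^j)\cdot\sum_{m\ge 1}\frac{(-1)^{m-1}q^m}{(1+q^m)^2}$. *)

theory Defs
  imports "HOL-Number_Theory.Cong"
begin

text \<open>
  A partition of \<open>n\<close> into distinct parts is determined by its set of parts, and is represented
  by that set: a finite set of positive integers with sum \<open>n\<close>.
\<close>

definition distinct_partitions :: "nat \<Rightarrow> nat set set" where
  "distinct_partitions n = {P. finite P \<and> 0 \<notin> P \<and> \<Sum>P = n}"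

definition DSOME :: "nat \<Rightarrow> int" where
  "DSOME n =
     (\<Sum>P\<in>distinct_partitions n. \<Sum>k\<in>{k\<in>P. odd k}. int k) -
     (\<Sum>P\<in>distinct_partitions n. \<Sum>k\<in>{k\<in>P. even k}. int k)"

text \<open>The sums in the definition above range over a finite set, so they are genuine sums.\<close>

lemma finite_distinct_partitions: "finite (distinct_partitions n)"
proof (rule finite_subset)
  show "distinct_partitions n \<subseteq> Pow {..n}"
    unfolding distinct_partitions_def using member_le_sum[of _ _ "\<lambda>k::nat. k"] by auto
qed simp

lemma DSOME_0: "DSOME 0 = 0"
proof -
  have "distinct_partitions 0 = {{}}"
    by (auto simp: distinct_partitions_def)
  then show ?thesis
    by (simp add: DSOME_def)
qed

end

theory Submission
  imports Defs "HOL-Computational_Algebra.Computational_Algebra" "HOL-Library.Z2"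
begin

text \<open>
  Write \<open>f(m)\<close> for \<open>f(q\<^sup>m)\<close>, and let \<open>E = \<Prod>(1 - q\<^sup>j)\<close>, \<open>F = \<Prod>(1 + q\<^sup>j)\<close> and
  \<open>P = \<Sum> (-1)\<^sup>k q^(k\<^sup>2)\<close>, summed over all integers \<open>k\<close>. Then \<open>F P = E\<close> and \<open>F E = E(2)\<close>. The
  generating function \<open>G\<close> of DSOME satisfies \<open>8 G = F - E P\<^sup>3\<close> (\<open>dsome_gf_formula\<close>): the weight
  "odd parts minus even parts" turns \<open>G\<close> into the Wronskian of two theta functions, and that
  Wronskian is the square of Jacobi's series for \<open>E\<^sup>3\<close>. This is the four-square theorem in disguise.
  So everything depends on \<open>F - E P\<^sup>3\<close> modulo 64.

  Dissect modulo 5. With \<open>e = E(5)\<close> and \<open>R = P(5)\<close> one has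
  \<open>E = a(5) - q e(5) - q\<^sup>2 b(5)\<close> and \<open>P = R(5) + 2 h\<close>, where \<open>h = q\<^sup>4 d(5) - q c(5)\<close>. Put \<open>x = q c d\<close>.
  Since \<open>E\<^sup>3\<close> has no exponents congruent to 2 modulo 5, \<open>a b = e\<^sup>2\<close>; and \<open>E\<^sup>2 = P E(2)\<close> gives, after
  elimination, two relations between \<open>a, \<dots>, e, R\<close> (\<open>dissection_relations\<close>). By these relations the
  part of \<open>E h\<^sup>i\<close> with exponents congruent to 1 modulo 5 is, up to a power of \<open>R\<close>, a polynomial in
  \<open>e\<close>, \<open>R\<close> and \<open>x\<close> for \<open>i \<le> 5\<close>. As \<open>F = E / (R(5) + 2 h)\<close>, and the geometric series in \<open>2 h\<close> may be
  cut off after \<open>i = 5\<close> modulo 64, the same holds for \<open>F\<close>. Finally \<open>4 x = R\<^sup>2 - P\<^sup>2\<close>, which is the splitting of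
  \<open>\<int>[i]\<close> into the residue classes modulo \<open>2 + i\<close>. With \<open>P\<^sup>2 = 1 + 4 u\<close>, the result is
  \<open>\<Sum> DSOME(5n+1) q\<^sup>n \<equiv> K(5) + 4 e (1 + u(5) - u) u\<close> modulo 8
  for some \<open>K\<close> (\<open>dsome_slice_mod_8\<close>). The indices in the theorem are \<open>5 m + 1\<close> with \<open>m\<close> even and not
  divisible by 5, so it remains to show that the coefficients of \<open>e (1 + u(5) - u) u\<close> with even index
  are even (\<open>parity_identity\<close>).

  Modulo 2, \<open>E\<^sup>3\<close> is \<open>\<psi> = \<Sum> q^(n(n+1)/2)\<close> over \<open>n \<ge> 0\<close>, and \<open>u\<^sup>2 + u = q \<psi>\<^sup>8\<close>. Hence a series that satisfies
  a quadratic equation derived from this one can be recognised from that equation and its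
  constant term: \<open>e (1 + u(5) - u)\<close> is \<open>E\<^sup>5\<close>, because of the identity for \<open>\<psi>\<^sup>2 - q \<psi>(5)\<^sup>2\<close>
  (\<open>psi_square_identity\<close>), and \<open>\<psi> u\<close> is the part of \<open>\<psi>\<close> with odd exponents, because of
  \<open>psi_even_mult_psi_odd\<close>. So the product is \<open>E\<^sup>2 (\<psi> u)\<close> with \<open>E\<^sup>2 = E(2)\<close>: only odd exponents occur.

  All product expansions come from Jacobi's triple product, proved through its finite form.
\<close>

section \<open>Limits and infinite products of power series\<close>

lemma tendsto_mult_fps:
  fixes f g :: "'b \<Rightarrow> 'a::ring fps"
  assumes "(f \<longlongrightarrow> a) G" "(g \<longlongrightarrow> b) G"
  shows "((\<lambda>x. f x * g x) \<longlongrightarrow> a * b) G"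
proof (rule tendsto_fpsI)
  fix n
  have "eventually (\<lambda>x. \<forall>i\<in>{0..n}. fps_nth (f x) i = fps_nth a i) G"
    using assms(1) by (subst eventually_ball_finite_distrib) (auto simp: tendsto_fps_iff)
  moreover have "eventually (\<lambda>x. \<forall>i\<in>{0..n}. fps_nth (g x) i = fps_nth b i) G"
    using assms(2) by (subst eventually_ball_finite_distrib) (auto simp: tendsto_fps_iff)
  ultimately show "eventually (\<lambda>x. fps_nth (f x * g x) n = fps_nth (a * b) n) G"
    by eventually_elim (auto simp: fps_mult_nth intro!: sum.cong)
qed

lemma fps_X_power_dvd_iff_nth:
  fixes f :: "int fps"
  shows "fps_X ^ M dvd f \<longleftrightarrow> (\<forall>i<M. fps_nth f i = 0)"
proof
  assume "fps_X ^ M dvd f"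
  then show "\<forall>i<M. fps_nth f i = 0"
    by (auto simp: dvd_def fps_X_power_mult_nth)
next
  assume *: "\<forall>i<M. fps_nth f i = 0"
  have "f = fps_X ^ M * fps_shift M f"
    by (rule fps_ext) (use * in \<open>auto simp: fps_X_power_mult_nth\<close>)
  then show "fps_X ^ M dvd f" by (rule dvdI)
qed

lemma fps_X_power_dvd_cancel:
  fixes f g :: "int fps"
  assumes "fps_X ^ M dvd f * g" "fps_nth f 0 = 1"
  shows "fps_X ^ M dvd g"
proof -
  have "fps_nth g i = 0" if "i < M" for i
    using that
  proof (induction i rule: less_induct)
    case (less i)
    have "0 = fps_nth (f * g) i"
      using assms(1) less.prems by (simp add: fps_X_power_dvd_iff_nth)
    also have "\<dots> = (\<Sum>k\<in>{0..i}. fps_nth f k * fps_nth g (i - k))"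
      by (simp add: fps_mult_nth)
    also have "\<dots> = (\<Sum>k\<in>{0..i}. if k = 0 then fps_nth g i else 0)"
      using less.IH less.prems assms(2) by (intro sum.cong) auto
    also have "\<dots> = fps_nth g i" by simp
    finally show ?case by simp
  qed
  then show ?thesis by (simp add: fps_X_power_dvd_iff_nth)
qed

text \<open>
  The factors are to satisfy \<open>a j \<equiv> 1\<close> modulo \<open>q^(j+1)\<close>. Then only the first \<open>n\<close> factors influence
  the coefficient of \<open>q\<^sup>n\<close>, which is what the definition reads off.
\<close>

definition infprod :: "(nat \<Rightarrow> int fps) \<Rightarrow> int fps" where
  "infprod a = Abs_fps (\<lambda>n. fps_nth (\<Prod>j<n. a j) n)"

lemma partial_prod_cong:
  fixes a :: "nat \<Rightarrow> int fps"
  assumes "\<And>j. fps_X ^ Suc j dvd a j - 1" "M \<le> N"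
  shows "fps_X ^ Suc M dvd (\<Prod>j<N. a j) - (\<Prod>j<M. a j)"
  using assms(2)
proof (induction N rule: dec_induct)
  case base
  then show ?case by simp
next
  case (step n)
  have "fps_X ^ Suc M dvd a n - 1"
    using assms(1)[of n] step.hyps by (meson dvd_trans le_imp_power_dvd Suc_le_mono)
  then have "fps_X ^ Suc M dvd (\<Prod>j<n. a j) * (a n - 1) + ((\<Prod>j<n. a j) - (\<Prod>j<M. a j))"
    using step.IH by (intro dvd_add dvd_mult) auto
  then show ?case by (simp add: algebra_simps)
qed

lemma infprod_cong:
  assumes "\<And>j. fps_X ^ Suc j dvd a j - 1"
  shows "fps_X ^ Suc N dvd infprod a - (\<Prod>j<N. a j)"
  unfolding fps_X_power_dvd_iff_nth
proof (intro allI impI)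
  fix i assume i: "i < Suc N"
  have "fps_X ^ Suc i dvd (\<Prod>j<N. a j) - (\<Prod>j<i. a j)"
    by (rule partial_prod_cong) (use assms i in auto)
  then have "fps_nth ((\<Prod>j<N. a j) - (\<Prod>j<i. a j)) i = 0"
    unfolding fps_X_power_dvd_iff_nth by blast
  then show "fps_nth (infprod a - (\<Prod>j<N. a j)) i = 0"
    by (simp add: infprod_def)
qed

lemma infprod_tendsto:
  assumes "\<And>j. fps_X ^ Suc j dvd a j - 1"
  shows "(\<lambda>N. \<Prod>j<N. a j) \<longlonglongrightarrow> infprod a"
proof (rule tendsto_fpsI)
  fix n
  show "eventually (\<lambda>N. fps_nth (\<Prod>j<N. a j) n = fps_nth (infprod a) n) sequentially"
    using eventually_ge_at_top[of n]
  proof eventually_elim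
    case (elim N)
    then show ?case
      using infprod_cong[OF assms, of N] unfolding fps_X_power_dvd_iff_nth
      by (metis diff_add_cancel add_0 fps_add_nth le_imp_less_Suc)
  qed
qed

text \<open>
  The series \<open>f(q\<^sup>m)\<close>.
\<close>

definition dilate :: "nat \<Rightarrow> 'a::comm_ring_1 fps \<Rightarrow> 'a fps" where
  "dilate m f = Abs_fps (\<lambda>n. if m dvd n then fps_nth f (n div m) else 0)"

lemma dilate_nth [simp]: "fps_nth (dilate m f) n = (if m dvd n then fps_nth f (n div m) else 0)"
  by (simp add: dilate_def)

lemma dilate_eq_compose: "m > 0 \<Longrightarrow> dilate m f = f oo fps_X ^ m"
  by (rule fps_ext) (simp add: fps_nth_compose_X_power)

lemma dilate_add: "dilate m (f + g) = dilate m f + dilate m g"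
  and dilate_diff: "dilate m (f - g) = dilate m f - dilate m g"
  and dilate_minus: "dilate m (- f) = - dilate m f"
  by (rule fps_ext, simp)+

lemma dilate_mult: "m > 0 \<Longrightarrow> dilate m (f * g :: 'a::idom fps) = dilate m f * dilate m g"
  by (simp add: dilate_eq_compose fps_compose_mult_distrib)

lemma dilate_1 [simp]: "m > 0 \<Longrightarrow> dilate m 1 = 1"
  by (simp add: dilate_eq_compose)

lemma dilate_0 [simp]: "dilate m 0 = 0"
  by (rule fps_ext) simp

lemma dilate_power: "m > 0 \<Longrightarrow> dilate m (f ^ n :: 'a::idom fps) = dilate m f ^ n"
  by (induction n) (simp_all add: dilate_mult)

lemma dilate_numeral [simp]: "m > 0 \<Longrightarrow> dilate m (numeral k :: 'a::comm_ring_1 fps) = numeral k"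
  by (simp add: dilate_eq_compose numeral_fps_const)

lemma dilate_X: "m > 0 \<Longrightarrow> dilate m fps_X = fps_X ^ m"
  by (rule fps_ext) (auto simp: dvd_div_eq_mult )

lemma dilate_dilate: "m > 0 \<Longrightarrow> k > 0 \<Longrightarrow> dilate m (dilate k f) = dilate (m * k) f"
  by (rule fps_ext) (auto simp: div_mult2_eq dvd_div_iff_mult mult.commute)

lemma dilate_prod: "m > 0 \<Longrightarrow> dilate m (\<Prod>j\<in>A. f j :: 'a::idom fps) = (\<Prod>j\<in>A. dilate m (f j))"
  by (induction A rule: infinite_finite_induct) (simp_all add: dilate_mult)

lemma tendsto_dilate:
  fixes f :: "'b \<Rightarrow> 'a::comm_ring_1 fps"
  assumes "(f \<longlongrightarrow> a) G"
  shows "((\<lambda>x. dilate m (f x)) \<longlongrightarrow> dilate m a) G"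
proof (rule tendsto_fpsI)
  fix n
  have "eventually (\<lambda>x. fps_nth (f x) (n div m) = fps_nth a (n div m)) G"
    using assms by (auto simp: tendsto_fps_iff)
  then show "eventually (\<lambda>x. fps_nth (dilate m (f x)) n = fps_nth (dilate m a) n) G"
    by eventually_elim simp
qed

text \<open>
  The product of \<open>1 + \<epsilon> q^(m j + r)\<close> over \<open>j \<ge> 0\<close>; in the usual notation \<open>(- \<epsilon> q\<^sup>r; q\<^sup>m)\<^sub>\<infinity>\<close>.
\<close>

definition qprod :: "int \<Rightarrow> nat \<Rightarrow> nat \<Rightarrow> int fps" where
  "qprod \<epsilon> m r = infprod (\<lambda>j. 1 + fps_const \<epsilon> * fps_X ^ (m * j + r))"

lemma qprod_factor_cong:
  assumes "m > 0" "r > 0"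
  shows "fps_X ^ Suc j dvd (1 + fps_const \<epsilon> * fps_X ^ (m * j + r)) - (1 :: int fps)"
proof -
  have "1 * j \<le> m * j" using assms by (intro mult_right_mono) auto
  then have "Suc j \<le> m * j + r" using assms by linarith
  then have "fps_X ^ Suc j dvd (fps_X ^ (m * j + r) :: int fps)" by (rule le_imp_power_dvd)
  then show ?thesis by (simp only: add_diff_cancel_left' dvd_mult)
qed

lemma qprod_tendsto:
  assumes "m > 0" "r > 0"
  shows "(\<lambda>N. \<Prod>j<N. 1 + fps_const \<epsilon> * fps_X ^ (m * j + r)) \<longlonglongrightarrow> qprod \<epsilon> m r"
  unfolding qprod_def by (rule infprod_tendsto) (rule qprod_factor_cong[OF assms])

lemma qprod_nth_0: "fps_nth (qprod \<epsilon> m r) 0 = 1"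
  by (simp add: qprod_def infprod_def)

lemma tendsto_prod_fps:
  fixes f :: "'c \<Rightarrow> 'b \<Rightarrow> 'a::comm_ring_1 fps"
  assumes "\<And>i. i \<in> A \<Longrightarrow> ((\<lambda>x. f i x) \<longlongrightarrow> a i) G"
  shows "((\<lambda>x. \<Prod>i\<in>A. f i x) \<longlongrightarrow> (\<Prod>i\<in>A. a i)) G"
  using assms by (induction A rule: infinite_finite_induct) (auto intro: tendsto_mult_fps)

lemma filterlim_mult_const_at_top: "0 < k \<Longrightarrow> filterlim (\<lambda>N::nat. N * k) at_top at_top"
  by (rule filterlim_at_top_mono[OF filterlim_ident]) (auto intro!: always_eventually)

text \<open>
  Sorting the factors by the residue of their exponent modulo \<open>k\<close>; the finite products up to \<open>N k\<close>
  agree exactly.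
\<close>

lemma qprod_split:
  assumes "k > 0"
  shows "(\<Prod>r\<in>{1..k}. qprod \<epsilon> k r) = qprod \<epsilon> 1 1"
proof -
  have eq: "(\<Prod>r\<in>{1..k}. \<Prod>j<N. 1 + fps_const \<epsilon> * fps_X ^ (k * j + r))
      = (\<Prod>j<N*k. 1 + fps_const \<epsilon> * fps_X ^ (1 * j + 1) :: int fps)" for N
  proof -
    have "(\<Prod>j<N*k. 1 + fps_const \<epsilon> * fps_X ^ (1 * j + 1) :: int fps)
        = (\<Prod>j<N. \<Prod>i\<in>{j*k..<j*k+k}. 1 + fps_const \<epsilon> * fps_X ^ (1 * i + 1))"
      by (rule prod.nat_group [symmetric])
    also have "\<dots> = (\<Prod>j<N. \<Prod>r\<in>{1..k}. 1 + fps_const \<epsilon> * fps_X ^ (k * j + r))"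
    proof (rule prod.cong[OF refl])
      fix j
      show "(\<Prod>i\<in>{j*k..<j*k+k}. 1 + fps_const \<epsilon> * fps_X ^ (1 * i + 1)) =
        (\<Prod>r\<in>{1..k}. 1 + fps_const \<epsilon> * fps_X ^ (k * j + r) :: int fps)"
        by (rule prod.reindex_bij_witness[where i="\<lambda>r. k*j+r-1" and j="\<lambda>i. i+1-k*j"])
           (auto simp: mult.commute)
    qed
    finally show ?thesis by (subst prod.swap) simp
  qed
  have "(\<lambda>N. \<Prod>r\<in>{1..k}. \<Prod>j<N. 1 + fps_const \<epsilon> * fps_X ^ (k * j + r)) \<longlonglongrightarrow> (\<Prod>r\<in>{1..k}. qprod \<epsilon> k r)"
    by (intro tendsto_prod_fps qprod_tendsto) (use assms in auto)
  moreover have "(\<lambda>N. \<Prod>j<N*k. 1 + fps_const \<epsilon> * fps_X ^ (1 * j + 1)) \<longlonglongrightarrow> qprod \<epsilon> 1 1"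
    using filterlim_compose[OF qprod_tendsto[of 1 1 \<epsilon>] filterlim_mult_const_at_top[OF assms]] by simp
  ultimately show ?thesis
    unfolding eq by (rule LIMSEQ_unique)
qed

lemma dilate_qprod:
  assumes "k > 0" "m > 0" "r > 0"
  shows "dilate k (qprod \<epsilon> m r) = qprod \<epsilon> (k * m) (k * r)"
proof -
  have "(\<lambda>N. dilate k (\<Prod>j<N. 1 + fps_const \<epsilon> * fps_X ^ (m * j + r))) \<longlonglongrightarrow> dilate k (qprod \<epsilon> m r)"
    by (intro tendsto_dilate qprod_tendsto assms)
  moreover have "dilate k (\<Prod>j<N. 1 + fps_const \<epsilon> * fps_X ^ (m * j + r)) =
     (\<Prod>j<N. 1 + fps_const \<epsilon> * fps_X ^ (k * m * j + k * r))" for N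
    using assms
    by (simp add: dilate_prod dilate_add dilate_mult dilate_power dilate_X dilate_eq_compose[of k "fps_const \<epsilon>"]
        algebra_simps flip: power_mult power_add)
  ultimately show ?thesis
    using LIMSEQ_unique[OF _ qprod_tendsto[of "k*m" "k*r" \<epsilon>]] assms by simp
qed

lemma qprod_mult_opposite:
  assumes "m > 0" "r > 0"
  shows "qprod 1 m r * qprod (- 1) m r = qprod (- 1) (2 * m) (2 * r)"
proof -
  have "(\<lambda>N. (\<Prod>j<N. 1 + fps_const 1 * fps_X ^ (m * j + r)) * (\<Prod>j<N. 1 + fps_const (-1) * fps_X ^ (m * j + r)))
     \<longlonglongrightarrow> qprod 1 m r * qprod (- 1) m r"
    by (intro tendsto_mult_fps qprod_tendsto assms)
  moreover have "(\<Prod>j<N. 1 + fps_const 1 * fps_X ^ (m * j + r)) * (\<Prod>j<N. 1 + fps_const (-1) * fps_X ^ (m * j + r))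
     = (\<Prod>j<N. 1 + fps_const (-1) * fps_X ^ (2 * m * j + 2 * r) :: int fps)" for N
    by (simp add: prod.distrib [symmetric] algebra_simps power_mult power_add power2_eq_square mult_2
       flip: fps_const_neg)
  ultimately show ?thesis
    using LIMSEQ_unique[OF _ qprod_tendsto[of "2*m" "2*r" "-1"]] assms by simp
qed

section \<open>Theta series and Gaussian binomial coefficients\<close>

text \<open>
  The series \<open>\<Sum> w(i) q^(e(i))\<close> over an arbitrary index type. Exponents are integers, so that quadratic
  polynomials can be used without coercions; terms with negative exponent are dropped and infinite
  fibres count as 0, which is why the product rules below ask for admissible exponents.
\<close>

definition theta :: "('i \<Rightarrow> int) \<Rightarrow> ('i \<Rightarrow> int) \<Rightarrow> int fps" where
  "theta e w = Abs_fps (\<lambda>n. \<Sum>i | e i = int n. w i)"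

lemma theta_nth: "fps_nth (theta e w) n = (\<Sum>i | e i = int n. w i)"
  by (simp add: theta_def)

definition alt :: "int \<Rightarrow> int" where
  "alt k = (if even k then 1 else - 1)"

text \<open>
  The triangular numbers, extended to all integers by the polynomial that defines them.
\<close>

definition tri :: "int \<Rightarrow> int" where
  "tri k = k * (k - 1) div 2"

lemma two_tri: "2 * tri k = k * (k - 1)"
  unfolding tri_def by (cases "even k") auto

lemma tri_nonneg: "0 \<le> tri k"
proof -
  have "0 \<le> k * (k - 1)" by (cases "k \<le> 0") (auto simp: mult_nonpos_nonpos)
  then show ?thesis by (simp add: tri_def)
qed

lemma tri_ge: "\<bar>k\<bar> - 1 \<le> tri k"
proof -
  have "2 * \<bar>k\<bar> - 2 \<le> k * (k - 1)"
  proof (cases "k \<le> 0")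
    case True
    have "0 \<le> (-k) * (-k-1) + 2"
    proof (cases "k = 0")
      case False
      then have "0 \<le> (-k) * (-k-1)" using True by (intro mult_nonneg_nonneg) auto
      then show ?thesis by simp
    qed simp
    then show ?thesis using True by (simp add: algebra_simps)
  next
    case False
    have "0 \<le> (k - 1) * (k - 2)"
      using False by (cases "k = 1") (auto intro!: mult_nonneg_nonneg)
    then show ?thesis using False by (simp add: algebra_simps)
  qed
  then show ?thesis using two_tri[of k] by linarith
qed

text \<open>
  The Gaussian binomial coefficients, defined by Pascal's recurrence in order to make sense over
  every commutative ring, including power series and polynomials over them.
\<close>

primrec qbin :: "'a::comm_ring_1 \<Rightarrow> nat \<Rightarrow> nat \<Rightarrow> 'a" where
  "qbin q 0 k = (if k = 0 then 1 else 0)"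
| "qbin q (Suc n) k = (case k of 0 \<Rightarrow> 1 | Suc l \<Rightarrow> qbin q n l + q ^ k * qbin q n k)"

lemma qbin_0_right [simp]: "qbin q n 0 = 1"
  by (cases n) auto

lemma qbin_Suc_Suc: "qbin q (Suc n) (Suc k) = qbin q n k + q ^ Suc k * qbin q n (Suc k)"
  by simp

lemma qbin_eq_0: "n < k \<Longrightarrow> qbin q n k = 0"
  by (induction n arbitrary: k) (auto split: nat.split)

lemma triangle_Suc: "Suc k * (Suc k - 1) div 2 = k * (k - 1) div 2 + k"
proof -
  have "Suc k * (Suc k - 1) = k * (k - 1) + k * 2" by (cases k) (auto simp: algebra_simps)
  then show ?thesis by (metis div_mult_self1 zero_neq_numeral add.commute)
qed

text \<open>
  The homogeneous form: with \<open>y\<close> a power of \<open>q\<close> it yields the symmetric finite triple product without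
  negative powers of \<open>q\<close>.
\<close>

lemma q_binomial_theorem:
  fixes q x y :: "'a::comm_ring_1"
  shows "(\<Prod>j<n. y + x * q ^ j) = (\<Sum>k\<le>n. qbin q n k * q ^ (k * (k - 1) div 2) * x ^ k * y ^ (n - k))"
proof (induction n arbitrary: x)
  case 0
  then show ?case by simp
next
  case (Suc n)
  define t where "t k = k * (k - 1) div 2" for k :: nat
  have tS: "t (Suc k) = t k + k" for k
    unfolding t_def by (rule triangle_Suc)
  \<comment> \<open>Splitting off the factor \<open>j = 0\<close> replaces \<open>x\<close> by \<open>x * q\<close> in the rest.\<close>
  have "(\<Prod>j<Suc n. y + x * q ^ j) = (y + x) * (\<Prod>j<n. y + (x * q) * q ^ j)"
    by (subst prod.lessThan_Suc_shift) (simp add: mult.assoc)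
  also have "\<dots> = (y + x) * (\<Sum>k\<le>n. qbin q n k * q ^ t k * (x * q) ^ k * y ^ (n - k))"
    unfolding Suc.IH t_def ..
  also have "\<dots> = (\<Sum>k\<le>n. qbin q n k * q ^ t k * (x * q) ^ k * y ^ (Suc n - k))
      + (\<Sum>k\<le>n. qbin q n k * q ^ t k * (x * q) ^ k * x * y ^ (n - k))"
    by (simp add: sum_distrib_left Suc_diff_le algebra_simps flip: sum.distrib)
  also have "(\<Sum>k\<le>n. qbin q n k * q ^ t k * (x * q) ^ k * y ^ (Suc n - k)) =
      y ^ Suc n + (\<Sum>k\<le>n. q ^ Suc k * qbin q n (Suc k) * q ^ t (Suc k) * x ^ Suc k * y ^ (n - k))"
  proof -
    have "(\<Sum>k\<le>n. qbin q n k * q ^ t k * (x * q) ^ k * y ^ (Suc n - k))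
        = (\<Sum>k\<le>Suc n. qbin q n k * q ^ t k * (x * q) ^ k * y ^ (Suc n - k))"
      by (simp add: qbin_eq_0)
    also have "\<dots> = y ^ Suc n + (\<Sum>k\<le>n. qbin q n (Suc k) * q ^ t (Suc k) * (x * q) ^ Suc k * y ^ (n - k))"
      by (subst sum.atMost_Suc_shift) (simp add: t_def)
    finally show ?thesis by (simp add: power_mult_distrib algebra_simps)
  qed
  also have "(\<Sum>k\<le>n. qbin q n k * q ^ t k * (x * q) ^ k * x * y ^ (n - k)) =
      (\<Sum>k\<le>n. qbin q n k * q ^ t (Suc k) * x ^ Suc k * y ^ (n - k))"
    by (simp add: tS power_add power_mult_distrib algebra_simps)
  also have "y ^ Suc n + (\<Sum>k\<le>n. q ^ Suc k * qbin q n (Suc k) * q ^ t (Suc k) * x ^ Suc k * y ^ (n - k)) +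
      (\<Sum>k\<le>n. qbin q n k * q ^ t (Suc k) * x ^ Suc k * y ^ (n - k)) =
      y ^ Suc n + (\<Sum>k\<le>n. qbin q (Suc n) (Suc k) * q ^ t (Suc k) * x ^ Suc k * y ^ (n - k))"
    by (simp add: sum.distrib [symmetric] distrib_right add_ac del: power_Suc)
  also have "\<dots> = (\<Sum>k\<le>Suc n. qbin q (Suc n) k * q ^ t k * x ^ k * y ^ (Suc n - k))"
    by (subst sum.atMost_Suc_shift) (simp add: t_def)
  finally show ?case unfolding t_def .
qed

text \<open>
  The quotient formula for Gaussian binomials, stated without division.
\<close>

lemma qbin_closed_form:
  fixes q :: "'a::comm_ring_1"
  shows "k \<le> n \<Longrightarrow> qbin q n k * (\<Prod>j<k. 1 - q ^ Suc j) * (\<Prod>j<n-k. 1 - q ^ Suc j) = (\<Prod>j<n. 1 - q ^ Suc j)"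
proof (induction n arbitrary: k)
  case 0
  then show ?case by simp
next
  case (Suc n)
  show ?case
  proof (cases k)
    case (Suc l)
    show ?thesis
    proof (cases "l = n")
      case True
      have "qbin q n n * (\<Prod>j<n. 1 - q ^ Suc j) = (\<Prod>j<n. 1 - q ^ Suc j)"
        using Suc.IH[of n] by simp
      then show ?thesis using True Suc by (simp add: qbin_eq_0) (metis mult.assoc)
    next
      case False
      then have l: "Suc l \<le> n" using Suc Suc.prems by simp
      define A where "A = (\<Prod>j<l. 1 - q ^ Suc j)"
      define B where "B = (\<Prod>j<n - Suc l. 1 - q ^ Suc j)"
      define C where "C = (\<Prod>j<n. 1 - q ^ Suc j)"
      have nl: "n - l = Suc (n - Suc l)" using l by simp
      have pn: "q ^ Suc l * q ^ (n - l) = q ^ Suc n"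
        using l by (simp flip: power_add del: power_Suc)
      have 1: "qbin q n l * A * (B * (1 - q ^ (n - l))) = C"
        using Suc.IH[of l] l unfolding A_def B_def C_def nl by simp
      have 2: "qbin q n (Suc l) * (A * (1 - q ^ Suc l)) * B = C"
        using Suc.IH[of "Suc l"] l unfolding A_def B_def C_def by simp
      have "(qbin q n l + q ^ Suc l * qbin q n (Suc l)) * (A * (1 - q ^ Suc l)) * (B * (1 - q ^ (n - l)))
        = (qbin q n l * A * (B * (1 - q ^ (n - l)))) * (1 - q ^ Suc l)
         + (qbin q n (Suc l) * (A * (1 - q ^ Suc l)) * B) * (q ^ Suc l * (1 - q ^ (n - l)))"
        by (simp add: algebra_simps)
      also have "\<dots> = C * (1 - q ^ Suc n)"
        unfolding 1 2 pn[symmetric] by (simp add: algebra_simps)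
      finally show ?thesis
        unfolding Suc qbin_Suc_Suc A_def B_def C_def by (simp add: nl)
    qed
  qed simp
qed

text \<open>
  A finite sum over \<open>|l| \<le> N\<close> whose coefficients \<open>g N l\<close> tend to 1, the slower the closer \<open>|l|\<close> is to \<open>N\<close>,
  converges to the theta series: terms with \<open>|l|\<close> near \<open>N\<close> have large exponents anyway.
\<close>

lemma tendsto_theta:
  fixes e :: "int \<Rightarrow> int"
  assumes e: "\<And>l. 0 \<le> e l" "\<And>l. \<bar>l\<bar> \<le> e l + 1"
    and g: "\<And>N l. l \<in> {-int N..int N} \<Longrightarrow> fps_X ^ nat (int N + 1 - \<bar>l\<bar>) dvd g N l - 1"
  shows "(\<lambda>N. \<Sum>l\<in>{-int N..int N}. g N l * (fps_const (w l) * fps_X ^ nat (e l))) \<longlonglongrightarrow> theta e w"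
proof (rule tendsto_fpsI)
  fix n
  show "eventually (\<lambda>N. fps_nth (\<Sum>l\<in>{-int N..int N}. g N l * (fps_const (w l) * fps_X ^ nat (e l))) n
      = fps_nth (theta e w) n) sequentially"
    using eventually_ge_at_top[of "2*n+2"]
  proof eventually_elim
    case (elim N)
    have term_eq: "fps_nth (g N l * (fps_const (w l) * fps_X ^ nat (e l))) n = (if e l = int n then w l else 0)"
      if l: "l \<in> {-int N..int N}" for l
    proof -
      have *: "fps_nth (g N l * (fps_const (w l) * fps_X ^ nat (e l))) n =
          (if e l \<le> int n then w l * fps_nth (g N l) (n - nat (e l)) else 0)"
        using e(1)[of l] by (auto simp: mult.left_commute[of _ "fps_const (w l)"] fps_X_power_mult_right_nth)
      have **: "fps_nth (g N l) (n - nat (e l)) = (if e l = int n then 1 else 0)" if en: "e l \<le> int n"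
      proof -
        have "n - nat (e l) < nat (int N + 1 - \<bar>l\<bar>)"
          using e(1)[of l] e(2)[of l] en elim l by auto
        then have "fps_nth (g N l - 1) (n - nat (e l)) = 0"
          using g[OF l] unfolding fps_X_power_dvd_iff_nth by blast
        then show ?thesis using en e(1)[of l] by (auto split: if_splits)
      qed
      show ?thesis unfolding * using ** by auto
    qed
    have "fps_nth (\<Sum>l\<in>{-int N..int N}. g N l * (fps_const (w l) * fps_X ^ nat (e l))) n
        = (\<Sum>l\<in>{-int N..int N}. if e l = int n then w l else 0)"
      by (simp only: fps_sum_nth term_eq cong: sum.cong)
    also have "\<dots> = (\<Sum>l\<in>{l\<in>{-int N..int N}. e l = int n}. w l)"
      by (simp add: sum.If_cases Int_def)
    also have "{l\<in>{-int N..int N}. e l = int n} = {l. e l = int n}"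
    proof -
      have "l \<in> {-int N..int N}" if "e l = int n" for l
        using e(2)[of l] that elim by auto
      then show ?thesis by blast
    qed
    finally show ?case by (simp add: theta_nth)
  qed
qed

text \<open>
  By the quotient formula the coefficient is \<open>p(2N) / (p(N+l) p(N-l))\<close>, where \<open>p(n)\<close> is a partial
  product of the infinite product \<open>E\<close>. All three agree with \<open>E\<close> up to the exponent \<open>N - |l|\<close>, so the
  quotient agrees with \<open>1/E\<close> there.
\<close>

lemma qbin_near_central_cong:
  assumes "m > 0" "l \<in> {-int N..int N}"
  shows "fps_X ^ nat (int N + 1 - \<bar>l\<bar>) dvd qprod (-1) m m * qbin (fps_X ^ m) (2*N) (nat (int N + l)) - 1"
proof -
  define E where "E = qprod (-1) m m"
  define p where "p n = (\<Prod>j<n. 1 - (fps_X ^ m) ^ Suc j :: int fps)" for n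
  define k where "k = nat (int N + l)"
  define M where "M = nat (int N + 1 - \<bar>l\<bar>)"
  have k: "k \<le> 2*N" "M \<le> Suc k" "M \<le> Suc (2*N - k)" "M \<le> Suc (2*N)"
    using assms unfolding k_def M_def by auto
  have p_alt: "p n = (\<Prod>j<n. 1 + fps_const (-1) * fps_X ^ (m * j + m))" for n
    unfolding p_def by (simp add: add.commute flip: power_mult fps_const_neg del: power_Suc)
  have cong: "fps_X ^ M dvd E - p n" if "M \<le> Suc n" for n
    using infprod_cong[OF qprod_factor_cong[of m m _ "-1"], of n] assms that
    unfolding p_alt E_def qprod_def by (meson dvd_trans le_imp_power_dvd)
  define b where "b = qbin (fps_X ^ m :: int fps) (2*N) k"
  have closed: "b * p k * p (2*N - k) = p (2*N)"
    unfolding b_def p_def by (rule qbin_closed_form) (rule k)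
  have "E * (E * b - 1) = b * E * (E - p (2*N-k)) + b * p (2*N-k) * (E - p k) - (E - p (2*N))"
    using closed by (simp add: algebra_simps)
  also have "fps_X ^ M dvd \<dots>"
    by (rule dvd_diff[OF dvd_add[OF dvd_mult[OF cong[OF k(3)]] dvd_mult[OF cong[OF k(2)]]] cong[OF k(4)]])
  finally have "fps_X ^ M dvd E * b - 1"
    by (rule fps_X_power_dvd_cancel) (simp add: E_def qprod_nth_0)
  then show ?thesis unfolding E_def b_def k_def M_def .
qed

section \<open>The Jacobi triple product and the cube of Euler's product\<close>

lemma int_triangle: "int (n * (n - 1) div 2) = tri (int n)"
  by (cases n) (simp_all add: tri_def zdiv_int algebra_simps)

lemma tri_add: "tri (a + b) = tri a + tri b + a * b"
  using two_tri[of "a + b"] two_tri[of a] two_tri[of b] by (simp add: algebra_simps)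

lemma theta_exponent_bound:
  assumes "0 < s" "s < m"
  shows "\<bar>l\<bar> \<le> int m * tri l + int s * l"
proof (cases "l \<ge> 0")
  case True
  have "1 * l \<le> int s * l" using True assms by (intro mult_right_mono) auto
  moreover have "0 \<le> int m * tri l" using tri_nonneg by simp
  ultimately show ?thesis using True by linarith
next
  case False
  have "- l \<le> tri l"
    using False two_tri[of l] mult_nonneg_nonneg[of "-l" "-l-1"] by (simp add: algebra_simps)
  then have "int m * (- l) \<le> int m * tri l" by (intro mult_left_mono) auto
  moreover have "1 * (- l) \<le> (int m - int s) * (- l)"
    using False assms by (intro mult_right_mono) auto
  ultimately show ?thesis using False by (simp add: algebra_simps)
qed

lemma prod_lessThan_add:
  "(\<Prod>j<a+b. f j) = (\<Prod>j<a. f j) * (\<Prod>j<b. f (a + j) :: 'a::comm_monoid_mult)" for a b :: nat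
  by (induction b) (simp_all add: mult.assoc)

lemma prod_geometric:
  fixes x q :: "'a::comm_ring_1"
  shows "(\<Prod>j<n. x * q ^ j) = x ^ n * q ^ (n * (n - 1) div 2)"
proof (induction n)
  case (Suc n)
  then show ?case by (simp only: prod.lessThan_Suc triangle_Suc power_add power_Suc) (simp add: algebra_simps)
qed simp

lemma sum_centered:
  fixes f :: "nat \<Rightarrow> 'a::comm_monoid_add"
  shows "(\<Sum>k\<le>2*N. f k) = (\<Sum>l\<in>{-int N..int N}. f (nat (int N + l)))"
  by (rule sum.reindex_bij_witness[where i="\<lambda>l. nat (int N + l)" and j="\<lambda>k. int k - int N"]) auto

text \<open>
  The \<open>q\<close>-binomial theorem for \<open>\<Prod>(Q\<^sup>N + x Q\<^sup>j)\<close>, \<open>j < 2N\<close>, with \<open>Q = q\<^sup>m\<close> and \<open>x = \<epsilon> q\<^sup>s\<close>. The factors with \<open>j \<ge> N\<close>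
  give one of the two products after removal of \<open>Q\<^sup>N\<close>, those with \<open>j < N\<close> the other one after removal of
  \<open>x Q\<^sup>j\<close>. The removed monomials make up the constant \<open>C\<close>, which cancels.
\<close>

lemma finite_triple_product:
  fixes \<epsilon> :: int
  assumes s: "0 < s" "s < m" and \<epsilon>: "\<epsilon> = 1 \<or> \<epsilon> = - 1"
  shows "(\<Prod>j<N. 1 + fps_const \<epsilon> * fps_X ^ (m * j + s)) * (\<Prod>j<N. 1 + fps_const \<epsilon> * fps_X ^ (m * j + (m - s)))
    = (\<Sum>l\<in>{-int N..int N}. qbin (fps_X ^ m) (2 * N) (nat (int N + l))
         * (fps_const (if even l then 1 else \<epsilon>) * fps_X ^ nat (int m * tri l + int s * l)))"
    (is "?A * ?B = ?S")
proof -
  define Q :: "int fps" where "Q = fps_X ^ m"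
  define x where "x = fps_const \<epsilon> * fps_X ^ s"
  define C where "C = x ^ N * Q ^ (N * (N - 1) div 2) * Q ^ (N * N)"
  have \<epsilon>2: "fps_const \<epsilon> * (fps_const \<epsilon> * z) = z" for z :: "int fps"
    using \<epsilon> by auto
  have lower: "(\<Prod>j<N. Q ^ N + x * Q ^ j) = x ^ N * Q ^ (N * (N - 1) div 2) * ?B"
  proof -
    have "(\<Prod>j<N. Q ^ N + x * Q ^ j) = (\<Prod>i<N. Q ^ N + x * Q ^ (N - Suc i))"
      by (rule prod.nat_diff_reindex [symmetric])
    also have "\<dots> = (\<Prod>i<N. (x * Q ^ (N - Suc i)) * (1 + fps_const \<epsilon> * fps_X ^ (m * i + (m - s))))"
    proof (rule prod.cong[OF refl])
      fix i assume "i \<in> {..<N}"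
      then have N: "N = (N - Suc i) + Suc i" by simp
      have X: "fps_X ^ s * fps_X ^ (m * i + (m - s)) = Q ^ Suc i"
        using s unfolding Q_def by (simp flip: power_mult power_add del: power_Suc)
      have "Q ^ N = Q ^ (N - Suc i) * Q ^ Suc i" by (subst N) (rule power_add)
      then show "Q ^ N + x * Q ^ (N - Suc i) = (x * Q ^ (N - Suc i)) * (1 + fps_const \<epsilon> * fps_X ^ (m * i + (m - s)))"
        unfolding X[symmetric] x_def by (simp add: algebra_simps \<epsilon>2 del: power_Suc)
    qed
    also have "\<dots> = (\<Prod>i<N. x * Q ^ (N - Suc i)) * ?B" by (rule prod.distrib)
    also have "(\<Prod>i<N. x * Q ^ (N - Suc i)) = (\<Prod>i<N. x * Q ^ i)"
      by (rule prod.nat_diff_reindex)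
    finally show ?thesis unfolding prod_geometric .
  qed
  have upper: "(\<Prod>j<N. Q ^ N + x * Q ^ (N + j)) = Q ^ (N * N) * ?A"
  proof -
    have "(\<Prod>j<N. Q ^ N + x * Q ^ (N + j)) = (\<Prod>j<N. Q ^ N * (1 + fps_const \<epsilon> * fps_X ^ (m * j + s)))"
      unfolding x_def Q_def by (intro prod.cong refl) (simp add: algebra_simps power_add flip: power_mult)
    then show ?thesis by (simp add: prod.distrib power_mult)
  qed
  have term_eq: "Q ^ (k * (k - 1) div 2) * x ^ k * (Q ^ N) ^ (2 * N - k)
      = C * (fps_const (if even l then 1 else \<epsilon>) * fps_X ^ nat (int m * tri l + int s * l))"
    if l: "l \<in> {-int N..int N}" and k: "k = nat (int N + l)" for k l
  proof -
    have expo: "m * (k * (k - 1) div 2) + s * k + m * (N * (2 * N - k))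
        = s * N + m * (N * (N - 1) div 2) + m * (N * N) + nat (int m * tri l + int s * l)"
    proof -
      have "int k = int N + l" "k \<le> 2 * N" using l k by auto
      then have "int (m * (k * (k - 1) div 2) + s * k + m * (N * (2 * N - k)))
          = int m * tri (int N + l) + int s * (int N + l) + int m * (int N * (int N - l))"
        by (simp only: of_nat_add of_nat_mult int_triangle of_nat_diff) simp
      also have "\<dots> = int s * int N + int m * tri (int N) + int m * (int N * int N) + (int m * tri l + int s * l)"
        by (simp add: tri_add algebra_simps)
      also have "\<dots> = int (s * N + m * (N * (N - 1) div 2) + m * (N * N) + nat (int m * tri l + int s * l))"
        using theta_exponent_bound[OF s, of l] by (simp only: of_nat_add of_nat_mult int_triangle)
      finally show ?thesis by linarith
    qed
    have sign: "\<epsilon> ^ k = \<epsilon> ^ N * (if even l then 1 else \<epsilon>)"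
    proof -
      have "even (int k) \<longleftrightarrow> even (int N + l)" using l k by simp
      then have "even k \<longleftrightarrow> (even N \<longleftrightarrow> even l)" by simp
      then show ?thesis using \<epsilon> by (cases "even N"; cases "even l") (auto simp: minus_one_power_iff)
    qed
    have x_pow: "x ^ i = fps_const (\<epsilon> ^ i) * fps_X ^ (s * i)" for i
      unfolding x_def by (simp add: power_mult_distrib fps_const_power power_mult)
    have "Q ^ (k * (k - 1) div 2) * x ^ k * (Q ^ N) ^ (2 * N - k)
       = fps_const (\<epsilon> ^ k) * fps_X ^ (m * (k * (k - 1) div 2) + s * k + m * (N * (2 * N - k)))"
      unfolding x_pow Q_def by (simp add: power_add power_mult [symmetric] mult_ac)
    also have "\<dots> = C * (fps_const (if even l then 1 else \<epsilon>) * fps_X ^ nat (int m * tri l + int s * l))"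
      unfolding expo sign C_def x_pow Q_def
      by (simp add: power_add power_mult [symmetric] mult_ac flip: fps_const_mult)
    finally show ?thesis .
  qed
  have "C * (?A * ?B) = (\<Prod>j<N+N. Q ^ N + x * Q ^ j)"
    unfolding prod_lessThan_add lower upper C_def by (simp add: mult_ac)
  also have "\<dots> = (\<Sum>k\<le>2*N. qbin Q (2*N) k * Q ^ (k * (k - 1) div 2) * x ^ k * (Q ^ N) ^ (2 * N - k))"
    using q_binomial_theorem[of "Q ^ N" x Q "2*N"] by (simp add: mult_2)
  also have "\<dots> = (\<Sum>k\<le>2*N. qbin Q (2*N) k * (Q ^ (k * (k - 1) div 2) * x ^ k * (Q ^ N) ^ (2 * N - k)))"
    by (simp add: mult_ac)
  also have "\<dots> = C * ?S"
    unfolding sum_centered sum_distrib_left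
    by (intro sum.cong refl, subst term_eq[OF _ refl]) (simp_all add: mult_ac Q_def)
  finally have "C * (?A * ?B) = C * ?S" .
  moreover have "C \<noteq> 0"
    using \<epsilon> unfolding C_def x_def Q_def by auto
  ultimately show ?thesis by simp
qed

theorem jacobi_triple_product:
  assumes s: "0 < s" "s < m" and \<epsilon>: "\<epsilon> = 1 \<or> \<epsilon> = - 1"
  shows "qprod (- 1) m m * (qprod \<epsilon> m s * qprod \<epsilon> m (m - s))
    = theta (\<lambda>l. int m * tri l + int s * l) (\<lambda>l. if even l then 1 else \<epsilon>)"
proof (rule LIMSEQ_unique)
  show "(\<lambda>N. qprod (- 1) m m * ((\<Prod>j<N. 1 + fps_const \<epsilon> * fps_X ^ (m * j + s)) * (\<Prod>j<N. 1 + fps_const \<epsilon> * fps_X ^ (m * j + (m - s)))))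
     \<longlonglongrightarrow> qprod (- 1) m m * (qprod \<epsilon> m s * qprod \<epsilon> m (m - s))"
    using s by (intro tendsto_mult_fps qprod_tendsto tendsto_const) auto
  have "(\<lambda>N. \<Sum>l\<in>{-int N..int N}. (qprod (-1) m m * qbin (fps_X ^ m) (2*N) (nat (int N + l)))
      * (fps_const (if even l then 1 else \<epsilon>) * fps_X ^ nat (int m * tri l + int s * l)))
    \<longlonglongrightarrow> theta (\<lambda>l. int m * tri l + int s * l) (\<lambda>l. if even l then 1 else \<epsilon>)"
  proof (rule tendsto_theta)
    show "0 \<le> int m * tri l + int s * l" "\<bar>l\<bar> \<le> int m * tri l + int s * l + 1" for l
      using theta_exponent_bound[OF s, of l] by linarith+
  qed (use qbin_near_central_cong s in auto)
  then show "(\<lambda>N. qprod (- 1) m m * ((\<Prod>j<N. 1 + fps_const \<epsilon> * fps_X ^ (m * j + s)) * (\<Prod>j<N. 1 + fps_const \<epsilon> * fps_X ^ (m * j + (m - s)))))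
     \<longlonglongrightarrow> theta (\<lambda>l. int m * tri l + int s * l) (\<lambda>l. if even l then 1 else \<epsilon>)"
    unfolding finite_triple_product[OF s \<epsilon>] sum_distrib_left by (simp only: mult.assoc)
qed

lemma qbin_pCons: "qbin [:q:] n k = [:qbin q n k:]"
  by (induction n arbitrary: k) (auto split: nat.split simp: poly_const_pow one_pCons)

lemma pderiv_sum: "pderiv (\<Sum>i\<in>A. f i) = (\<Sum>i\<in>A. pderiv (f i))"
  using higher_pderiv_sum[of 1 f A] by simp

text \<open>
  Differentiating the \<open>q\<close>-binomial theorem for \<open>\<Prod>(q\<^sup>N + t q\<^sup>j)\<close> with respect to \<open>t\<close> at \<open>t = -1\<close>. The factor
  with \<open>j = N\<close> vanishes there, so that only the product of the others survives on the left.
\<close>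

lemma finite_jacobi_cube:
  assumes "N > 0"
  shows "(\<Prod>j<N. 1 - fps_X ^ Suc j) * (\<Prod>j<N-1. 1 - fps_X ^ Suc j)
    = (\<Sum>l\<in>{-int N..int N}. qbin fps_X (2 * N) (nat (int N + l)) * (fps_const (- (alt l * l)) * fps_X ^ nat (tri l)))"
    (is "_ = ?S")
proof -
  define X :: "int fps" where "X = fps_X"
  define c where "c k = qbin X (2*N) k * X ^ (k * (k - 1) div 2) * (X ^ N) ^ (2 * N - k)" for k
  define p :: "int fps poly" where "p = (\<Prod>j\<in>{..<2*N}-{N}. [:X ^ N, X ^ j:])"
  have eq: "p * [:X ^ N, X ^ N:] = (\<Sum>k\<le>2*N. monom (c k) k)"
  proof -
    have "p * [:X ^ N, X ^ N:] = (\<Prod>j<2*N. [:X ^ N, X ^ j:])"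
      unfolding p_def using assms by (subst (2) prod.remove[of _ N]) (auto simp: mult.commute)
    also have "\<dots> = (\<Prod>j<2*N. [:X ^ N:] + [:0, 1:] * [:X:] ^ j)"
      by (simp add: poly_const_pow)
    also have "\<dots> = (\<Sum>k\<le>2*N. monom (c k) k)"
      unfolding q_binomial_theorem qbin_pCons c_def
      by (simp add: poly_const_pow monom_altdef mult_ac)
    finally show ?thesis .
  qed
  \<comment> \<open>Adding \<open>N\<close> times the value at \<open>-1\<close>, which is 0, centres the weights \<open>k\<close> at \<open>k = N\<close>.\<close>
  have at_0: "0 = (\<Sum>k\<le>2*N. c k * (-1) ^ k)"
    using arg_cong[OF eq, of "\<lambda>p. poly p (-1)"] by (simp add: poly_sum poly_monom)
  have at_1: "poly p (-1) * X ^ N = (\<Sum>k\<le>2*N. of_nat k * c k * (-1) ^ (k - 1))"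
  proof -
    have "poly (pderiv (p * [:X ^ N, X ^ N:])) (-1) = poly p (-1) * X ^ N"
      unfolding pderiv_mult poly_add poly_mult by (simp add: pderiv_pCons)
    then show ?thesis
      unfolding eq by (simp add: pderiv_sum pderiv_monom poly_sum poly_monom)
  qed
  have "poly p (-1) * X ^ N = (\<Sum>k\<le>2*N. of_nat k * c k * (-1) ^ (k - 1)) + of_nat N * (\<Sum>k\<le>2*N. c k * (-1) ^ k)"
    using at_0 at_1 by simp
  also have "\<dots> = (\<Sum>k\<le>2*N. - ((-1) ^ k * (of_nat k - of_nat N) * c k))"
    unfolding sum_distrib_left sum.distrib[symmetric]
  proof (rule sum.cong[OF refl])
    fix k
    show "of_nat k * c k * (- 1) ^ (k - 1) + of_nat N * (c k * (- 1) ^ k) = - ((-1) ^ k * (of_nat k - of_nat N) * c k)"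
      by (cases k) (auto simp: algebra_simps)
  qed
  also have "\<dots> = (-1) ^ N * X ^ (N * (N - 1) div 2 + N * N) * ?S"
    unfolding sum_centered sum_distrib_left
  proof (rule sum.cong[OF refl])
    fix l assume l: "l \<in> {-int N..int N}"
    define k where "k = nat (int N + l)"
    have k: "int k = int N + l" "k \<le> 2 * N" using l unfolding k_def by auto
    have "int (k * (k - 1) div 2 + N * (2 * N - k)) = tri (int N + l) + int N * (int N - l)"
      using k by (simp only: of_nat_add of_nat_mult int_triangle of_nat_diff) simp
    also have "\<dots> = int (N * (N - 1) div 2 + N * N + nat (tri l))"
      using tri_nonneg[of l] by (simp only: of_nat_add of_nat_mult int_triangle) (simp add: tri_add algebra_simps)
    finally have expo: "k * (k - 1) div 2 + N * (2 * N - k) = N * (N - 1) div 2 + N * N + nat (tri l)"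
      by linarith
    have "even (int k) \<longleftrightarrow> even (int N + l)" using k by simp
    then have sign: "(-1 :: int fps) ^ k = (-1) ^ N * fps_const (alt l)"
      by (auto simp: alt_def minus_one_power_iff)
    have diff: "of_nat k - of_nat N = (fps_const l :: int fps)"
    proof -
      have "(of_nat k - of_nat N :: int fps) = fps_const (int k - int N)"
        by (simp add: fps_of_nat [symmetric])
      then show ?thesis using k by simp
    qed
    have "c k = qbin X (2*N) k * X ^ (k * (k - 1) div 2 + N * (2 * N - k))"
      unfolding c_def by (simp add: power_add power_mult mult.assoc)
    then have "- ((-1) ^ k * (of_nat k - of_nat N) * c k) = (-1) ^ N * X ^ (N * (N - 1) div 2 + N * N) *
        (qbin X (2 * N) k * (fps_const (- (alt l * l)) * X ^ nat (tri l)))"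
      unfolding expo sign diff by (simp add: power_add mult_ac flip: fps_const_mult fps_const_neg)
    then show "- ((-1) ^ nat (int N + l) * (of_nat (nat (int N + l)) - of_nat N) * c (nat (int N + l))) =
        (-1) ^ N * X ^ (N * (N - 1) div 2 + N * N) *
        (qbin fps_X (2 * N) (nat (int N + l)) * (fps_const (- (alt l * l)) * fps_X ^ nat (tri l)))"
      unfolding k_def X_def .
  qed
  finally have 1: "poly p (-1) * X ^ N = (-1) ^ N * X ^ (N * (N - 1) div 2 + N * N) * ?S" .
  have "poly p (-1) = (\<Prod>j\<in>{..<2*N}-{N}. X ^ N - X ^ j)"
    unfolding p_def by (simp add: poly_prod)
  also have "{..<2*N}-{N} = {..<N} \<union> {N<..<2*N}" using assms by auto
  also have "(\<Prod>j\<in>\<dots>. X ^ N - X ^ j) = (\<Prod>j<N. X ^ N - X ^ j) * (\<Prod>j\<in>{N<..<2*N}. X ^ N - X ^ j)"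
    by (rule prod.union_disjoint) auto
  also have "(\<Prod>j<N. X ^ N - X ^ j) = (\<Prod>i<N. X ^ N - X ^ (N - Suc i))"
    by (rule prod.nat_diff_reindex [symmetric])
  also have "\<dots> = (\<Prod>i<N. (-1 * X ^ (N - Suc i)) * (1 - X ^ Suc i))"
  proof (rule prod.cong[OF refl])
    fix i assume "i \<in> {..<N}"
    then have N: "N = (N - Suc i) + Suc i" by simp
    have "X ^ N = X ^ (N - Suc i) * X ^ Suc i" by (subst N) (rule power_add)
    then show "X ^ N - X ^ (N - Suc i) = (-1 * X ^ (N - Suc i)) * (1 - X ^ Suc i)"
      by (simp add: algebra_simps del: power_Suc)
  qed
  also have "\<dots> = (\<Prod>i<N. -1 * X ^ (N - Suc i)) * (\<Prod>i<N. 1 - X ^ Suc i)" by (rule prod.distrib)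
  also have "(\<Prod>i<N. -1 * X ^ (N - Suc i)) = (\<Prod>i<N. -1 * X ^ i)"
    by (rule prod.nat_diff_reindex)
  also have "(\<Prod>j\<in>{N<..<2*N}. X ^ N - X ^ j) = (\<Prod>i<N-1. X ^ N * (1 - X ^ Suc i))"
    by (rule prod.reindex_bij_witness[where i="\<lambda>i. N + Suc i" and j="\<lambda>j. j - N - 1"])
       (auto simp: power_add [symmetric] algebra_simps simp flip: power_Suc)
  also have "\<dots> = (X ^ N) ^ (N - 1) * (\<Prod>i<N-1. 1 - X ^ Suc i)"
    by (simp add: prod.distrib)
  finally have p: "poly p (-1) = (-1) ^ N * X ^ (N * (N - 1) div 2) * (\<Prod>i<N. 1 - X ^ Suc i) *
      ((X ^ N) ^ (N - 1) * (\<Prod>i<N-1. 1 - X ^ Suc i))"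
    unfolding prod_geometric .
  have "(X ^ N) ^ (N - 1) * X ^ N = X ^ (N * N)"
    using power_minus_mult[OF assms, of "X ^ N"] by (simp only: power_mult)
  then have 2: "poly p (-1) * X ^ N = (-1) ^ N * X ^ (N * (N - 1) div 2 + N * N) *
      ((\<Prod>i<N. 1 - X ^ Suc i) * (\<Prod>i<N-1. 1 - X ^ Suc i))"
    unfolding p power_add by (simp add: algebra_simps)
  have "(-1) ^ N * X ^ (N * (N - 1) div 2 + N * N) * ?S = (-1) ^ N * X ^ (N * (N - 1) div 2 + N * N) *
      ((\<Prod>i<N. 1 - X ^ Suc i) * (\<Prod>i<N-1. 1 - X ^ Suc i))"
    by (rule trans[OF 1[symmetric] 2])
  moreover have "(-1) ^ N * X ^ (N * (N - 1) div 2 + N * N) \<noteq> (0 :: int fps)"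
    unfolding X_def by simp
  ultimately show ?thesis unfolding X_def by simp
qed

theorem jacobi_cube:
  "qprod (- 1) 1 1 ^ 3 = theta tri (\<lambda>l. - (alt l * l))"
proof (rule LIMSEQ_unique)
  let ?E = "qprod (- 1) 1 1"
  have E: "(\<lambda>N. \<Prod>j<N. 1 - fps_X ^ Suc j) \<longlonglongrightarrow> ?E"
    using qprod_tendsto[of 1 1 "-1"] by (simp flip: fps_const_neg)
  have E': "(\<lambda>N. \<Prod>j<N-1. 1 - fps_X ^ Suc j) \<longlonglongrightarrow> ?E"
    by (rule filterlim_compose[OF E filterlim_minus_const_nat_at_top])
  show "(\<lambda>N. ?E * ((\<Prod>j<N. 1 - fps_X ^ Suc j) * (\<Prod>j<N-1. 1 - fps_X ^ Suc j))) \<longlonglongrightarrow> ?E ^ 3"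
    using tendsto_mult_fps[OF tendsto_const[of ?E] tendsto_mult_fps[OF E E']] by (simp add: power3_eq_cube mult.assoc)
  have "(\<lambda>N. \<Sum>l\<in>{-int N..int N}. (?E * qbin fps_X (2*N) (nat (int N + l)))
      * (fps_const (- (alt l * l)) * fps_X ^ nat (tri l)))
    \<longlonglongrightarrow> theta tri (\<lambda>l. - (alt l * l))"
  proof (rule tendsto_theta)
    show "0 \<le> tri l" "\<bar>l\<bar> \<le> tri l + 1" for l
      using tri_ge[of l] tri_nonneg[of l] by simp_all
  qed (use qbin_near_central_cong[of 1] in auto)
  then have "(\<lambda>N. ?E * (\<Sum>l\<in>{-int N..int N}. qbin fps_X (2*N) (nat (int N + l))
      * (fps_const (- (alt l * l)) * fps_X ^ nat (tri l))))
    \<longlonglongrightarrow> theta tri (\<lambda>l. - (alt l * l))"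
    unfolding sum_distrib_left by (simp only: mult.assoc)
  moreover have "eventually (\<lambda>N. ?E * (\<Sum>l\<in>{-int N..int N}. qbin fps_X (2*N) (nat (int N + l))
      * (fps_const (- (alt l * l)) * fps_X ^ nat (tri l))) = 
      ?E * ((\<Prod>j<N. 1 - fps_X ^ Suc j) * (\<Prod>j<N-1. 1 - fps_X ^ Suc j))) sequentially"
    using eventually_gt_at_top[of 0] by eventually_elim (simp only: finite_jacobi_cube)
  ultimately show "(\<lambda>N. ?E * ((\<Prod>j<N. 1 - fps_X ^ Suc j) * (\<Prod>j<N-1. 1 - fps_X ^ Suc j)))
    \<longlonglongrightarrow> theta tri (\<lambda>l. - (alt l * l))"
    by (rule Lim_transform_eventually)
qed

section \<open>Calculus with theta series\<close>

text \<open>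
  The condition under which \<open>theta e w\<close> is a convergent series, whatever the weights \<open>w\<close> are.
\<close>

definition admissible :: "('i \<Rightarrow> int) \<Rightarrow> bool" where
  "admissible e \<longleftrightarrow> (\<forall>i. 0 \<le> e i) \<and> (\<forall>n. finite {i. e i = int n})"

lemma admissibleI:
  fixes e :: "int \<Rightarrow> int"
  assumes "\<And>l. 0 \<le> e l" "\<And>l. \<bar>l\<bar> \<le> e l + 1"
  shows "admissible e"
proof -
  have "{l. e l = int n} \<subseteq> {-int n-1..int n+1}" for n
  proof
    fix l assume "l \<in> {l. e l = int n}"
    then show "l \<in> {-int n-1..int n+1}" using assms(2)[of l] by auto
  qed
  then show ?thesis
    unfolding admissible_def using assms(1) by (meson finite_subset finite_atLeastAtMost_int)
qed

lemma admissible_inj: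
  assumes "admissible e" "inj f"
  shows "admissible (\<lambda>i. e (f i))"
proof -
  have "finite {i. e (f i) = int n}" for n
    using finite_vimageI[of "{i. e i = int n}" f] assms by (simp add: admissible_def vimage_def)
  then show ?thesis using assms(1) unfolding admissible_def by blast
qed

lemma admissible_pair:
  assumes "admissible e" "admissible e'"
  shows "admissible (\<lambda>(i, j). e i + e' j)"
proof -
  have "{p. (case p of (i, j) \<Rightarrow> e i + e' j) = int n}
      \<subseteq> (\<Union>k\<in>{..n}. \<Union>l\<in>{..n}. {i. e i = int k} \<times> {j. e' j = int l})" for n
  proof
    fix p assume p: "p \<in> {p. (case p of (i, j) \<Rightarrow> e i + e' j) = int n}"
    obtain i j where ij: "p = (i, j)" by (cases p)
    have "0 \<le> e i" "0 \<le> e' j" using assms unfolding admissible_def by auto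
    then have "nat (e i) \<in> {..n}" "nat (e' j) \<in> {..n}" "e i = int (nat (e i))" "e' j = int (nat (e' j))"
      using p ij by auto
    then show "p \<in> (\<Union>k\<in>{..n}. \<Union>l\<in>{..n}. {i. e i = int k} \<times> {j. e' j = int l})"
      unfolding ij by blast
  qed
  moreover have "finite (\<Union>k\<in>{..n}. \<Union>l\<in>{..n}. {i. e i = int k} \<times> {j. e' j = int l})" for n
    using assms unfolding admissible_def by auto
  ultimately have "finite {p. (case p of (i, j) \<Rightarrow> e i + e' j) = int n}" for n
    by (rule finite_subset)
  moreover have "0 \<le> (case p of (i, j) \<Rightarrow> e i + e' j)" for p
    using assms unfolding admissible_def by (cases p) simp
  ultimately show ?thesis unfolding admissible_def by blast
qed

lemma theta_mult:
  assumes "admissible e" "admissible e'"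
  shows "theta e w * theta e' w' = theta (\<lambda>(i, j). e i + e' j) (\<lambda>(i, j). w i * w' j)"
proof (rule fps_ext)
  fix n
  define A where "A k = {i. e i = int k} \<times> {j. e' j = int (n - k)}" for k
  have fin: "finite {i. e i = int k}" "finite {i. e' i = int k}" for k
    using assms unfolding admissible_def by auto
  have fin_A: "finite (A k)" for k
    unfolding A_def by (rule finite_cartesian_product) (rule fin)+
  have "fps_nth (theta e w * theta e' w') n = (\<Sum>k\<in>{0..n}. \<Sum>p\<in>A k. case p of (i, j) \<Rightarrow> w i * w' j)"
    unfolding fps_mult_nth theta_nth sum_product A_def by (simp add: sum.cartesian_product)
  also have "\<dots> = (\<Sum>p\<in>(\<Union>k\<in>{0..n}. A k). case p of (i, j) \<Rightarrow> w i * w' j)"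
    by (rule sum.UNION_disjoint [symmetric]) (auto simp: fin_A, auto simp: A_def)
  also have "(\<Union>k\<in>{0..n}. A k) = {p. (case p of (i, j) \<Rightarrow> e i + e' j) = int n}"
  proof
    show "(\<Union>k\<in>{0..n}. A k) \<subseteq> {p. (case p of (i, j) \<Rightarrow> e i + e' j) = int n}"
      by (auto simp: A_def)
    show "{p. (case p of (i, j) \<Rightarrow> e i + e' j) = int n} \<subseteq> (\<Union>k\<in>{0..n}. A k)"
    proof
      fix p assume p: "p \<in> {p. (case p of (i, j) \<Rightarrow> e i + e' j) = int n}"
      obtain i j where ij: "p = (i, j)" by (cases p)
      have "0 \<le> e i" "0 \<le> e' j" using assms unfolding admissible_def by auto
      then have "nat (e i) \<in> {0..n}" "e i = int (nat (e i))" "e' j = int (n - nat (e i))"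
        using p ij by auto
      then show "p \<in> (\<Union>k\<in>{0..n}. A k)" unfolding ij A_def by blast
    qed
  qed
  finally show "fps_nth (theta e w * theta e' w') n = fps_nth (theta (\<lambda>(i, j). e i + e' j) (\<lambda>(i, j). w i * w' j)) n"
    by (simp add: theta_nth)
qed

lemma theta_reindex:
  assumes "bij f"
  shows "theta (\<lambda>i. e (f i)) (\<lambda>i. w (f i)) = theta e w"
proof (rule fps_ext)
  fix n
  have "f ` {i. e (f i) = int n} = {i. e i = int n}"
    using bij_is_surj[OF assms] by (auto simp: image_iff surj_def)
  then have "bij_betw f {i. e (f i) = int n} {i. e i = int n}"
    using bij_is_inj[OF assms] unfolding bij_betw_def by (blast intro: inj_on_subset)
  then show "fps_nth (theta (\<lambda>i. e (f i)) (\<lambda>i. w (f i))) n = fps_nth (theta e w) n"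
    unfolding theta_nth by (rule sum.reindex_bij_betw)
qed

lemma theta_cong:
  assumes "\<And>i. e i = e' i" "\<And>i. w i = w' i"
  shows "theta e w = theta e' w'"
  using assms by presburger

text \<open>
  Sums over a lattice are evaluated by cutting the lattice into finitely many images of maps \<open>f c\<close>.
\<close>

lemma theta_partition:
  assumes "admissible e" "finite C"
    and surj: "\<And>i. \<exists>c\<in>C. \<exists>j. i = f c j"
    and inj: "\<And>c c' j j'. c \<in> C \<Longrightarrow> c' \<in> C \<Longrightarrow> f c j = f c' j' \<Longrightarrow> c = c' \<and> j = j'"
  shows "theta e w = (\<Sum>c\<in>C. theta (\<lambda>j. e (f c j)) (\<lambda>j. w (f c j)))"
proof (rule fps_ext)
  fix n
  have inj_f: "inj_on (f c) A" if "c \<in> C" for c A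
    using inj[OF that that] by (auto intro: inj_onI)
  have "{i. e i = int n} = (\<Union>c\<in>C. f c ` {j. e (f c j) = int n})"
    using surj by (auto simp: image_iff) metis
  then have "fps_nth (theta e w) n = (\<Sum>i\<in>(\<Union>c\<in>C. f c ` {j. e (f c j) = int n}). w i)"
    by (simp add: theta_nth)
  also have "\<dots> = (\<Sum>c\<in>C. \<Sum>i\<in>f c ` {j. e (f c j) = int n}. w i)"
  proof (rule sum.UNION_disjoint)
    show "\<forall>c\<in>C. finite (f c ` {j. e (f c j) = int n})"
      using admissible_inj[OF assms(1) inj_f] unfolding admissible_def by blast
    show "\<forall>c\<in>C. \<forall>c'\<in>C. c \<noteq> c' \<longrightarrow> f c ` {j. e (f c j) = int n} \<inter> f c' ` {j. e (f c' j) = int n} = {}"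
      using inj by blast
  qed (fact assms(2))
  also have "\<dots> = (\<Sum>c\<in>C. \<Sum>j | e (f c j) = int n. w (f c j))"
    by (intro sum.cong refl) (simp add: sum.reindex[OF inj_f])
  finally show "fps_nth (theta e w) n = fps_nth (\<Sum>c\<in>C. theta (\<lambda>j. e (f c j)) (\<lambda>j. w (f c j))) n"
    by (simp add: theta_nth fps_sum_nth)
qed

lemma theta_scale_weight: "theta e (\<lambda>i. a * w i) = fps_const a * theta e w"
  by (rule fps_ext) (simp add: theta_nth sum_distrib_left)

lemma theta_minus_weight: "theta e (\<lambda>i. - w i) = - theta e w"
  by (rule fps_ext) (simp add: theta_nth sum_negf)

lemma theta_add_weight: "theta e (\<lambda>i. w i + w' i) = theta e w + theta e w'"
  by (rule fps_ext) (simp add: theta_nth sum.distrib)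

lemma theta_diff_weight: "theta e (\<lambda>i. w i - w' i) = theta e w - theta e w'"
  by (rule fps_ext) (simp add: theta_nth sum_subtractf)

lemma theta_shift:
  assumes "admissible e"
  shows "theta (\<lambda>i. e i + int r) w = fps_X ^ r * theta e w"
proof (rule fps_ext)
  fix n
  have "{i. e i + int r = int n} = (if n < r then {} else {i. e i = int (n - r)})"
  proof (cases "n < r")
    case True
    have "0 \<le> e i" for i using assms by (auto simp: admissible_def)
    then have "e i + int r \<noteq> int n" for i using True by (metis add_increasing of_nat_less_iff not_le order_refl)
    then show ?thesis using True by simp
  qed auto
  then show "fps_nth (theta (\<lambda>i. e i + int r) w) n = fps_nth (fps_X ^ r * theta e w) n"
    by (simp add: theta_nth fps_X_power_mult_nth)
qed

lemma theta_dilate: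
  assumes "k > 0"
  shows "theta (\<lambda>i. int k * e i) w = dilate k (theta e w)"
proof (rule fps_ext)
  fix n
  have "{i. int k * e i = int n} = (if k dvd n then {i. e i = int (n div k)} else {})"
    using assms by (auto simp: zdiv_int) (metis dvd_triv_left of_nat_dvd_iff)
  then show "fps_nth (theta (\<lambda>i. int k * e i) w) n = fps_nth (dilate k (theta e w)) n"
    by (simp add: theta_nth)
qed

text \<open>
  The operator \<open>q d/dq\<close>.
\<close>

definition q_deriv :: "int fps \<Rightarrow> int fps" where
  "q_deriv f = fps_X * fps_deriv f"

lemma q_deriv_nth: "fps_nth (q_deriv f) n = int n * fps_nth f n"
  by (cases n) (simp_all add: q_deriv_def)

lemma q_deriv_mult: "q_deriv (f * g) = q_deriv f * g + f * q_deriv g"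
  by (simp add: q_deriv_def algebra_simps)

lemma q_deriv_theta: "q_deriv (theta e w) = theta e (\<lambda>i. e i * w i)"
  by (rule fps_ext) (simp add: q_deriv_nth theta_nth sum_distrib_left)

section \<open>Euler products as theta series\<close>

definition euler :: "int fps" where "euler = qprod (-1) 1 1"
definition distinct_gf :: "int fps" where "distinct_gf = qprod 1 1 1"
definition theta4 :: "int fps" where "theta4 = theta (\<lambda>k. k * k) alt"
definition theta3 :: "int fps" where "theta3 = theta (\<lambda>k. k * k) (\<lambda>_. 1)"
definition psi :: "int fps" where "psi = theta (\<lambda>k. k * (2 * k + 1)) (\<lambda>_. 1)"

lemma qprod_nz: "qprod \<epsilon> m r \<noteq> 0"
  using qprod_nth_0[of \<epsilon> m r] by auto

lemma distinct_mult_euler: "distinct_gf * euler = dilate 2 euler"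
  unfolding distinct_gf_def euler_def using qprod_mult_opposite[of 1 1] by (simp add: dilate_qprod numeral_2_eq_2)

lemma if_alt: "(if even l then 1 else - 1) = alt l"
  by (simp add: alt_def)

lemma pentagonal_number_theorem: "euler = theta (\<lambda>k. 3 * tri k + k) alt"
proof -
  have "{1..3} = {1, 2, 3 :: nat}" by auto
  then have "euler = qprod (-1) 3 3 * (qprod (-1) 3 1 * qprod (-1) 3 2)"
    using qprod_split[of 3 "-1"] unfolding euler_def by (simp add: mult_ac)
  then show ?thesis
    using jacobi_triple_product[of 1 3 "-1"] by (simp add: if_alt)
qed

lemma qprod_split_2: "qprod \<epsilon> 2 1 * qprod \<epsilon> 2 2 = qprod \<epsilon> 1 1"
proof -
  have "{1..2} = {1, 2 :: nat}" by auto
  then show ?thesis using qprod_split[of 2 \<epsilon>] by simp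
qed

lemma theta4_product: "theta4 = dilate 2 euler * qprod (-1) 2 1 ^ 2"
  and theta3_product: "theta3 = dilate 2 euler * qprod 1 2 1 ^ 2"
proof -
  have sq: "2 * tri l + l = l * l" for l
    unfolding two_tri by (simp add: algebra_simps)
  show "theta4 = dilate 2 euler * qprod (-1) 2 1 ^ 2"
    using jacobi_triple_product[of 1 2 "-1"]
    by (simp add: sq if_alt theta4_def euler_def dilate_qprod power2_eq_square numeral_2_eq_2)
  show "theta3 = dilate 2 euler * qprod 1 2 1 ^ 2"
    using jacobi_triple_product[of 1 2 "1"]
    by (simp add: sq theta3_def euler_def dilate_qprod power2_eq_square numeral_2_eq_2)
qed

lemma distinct_split: "distinct_gf = qprod 1 2 1 * dilate 2 distinct_gf"
  using qprod_split_2[of 1] by (simp add: distinct_gf_def dilate_qprod)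

text \<open>
  Both sides are compared after Euler's theorem \<open>F \<Prod>(1 - q^(2j+1)) = 1\<close>, which in turn follows from
  \<open>F E = E(2)\<close>.
\<close>

lemma distinct_mult_theta4: "distinct_gf * theta4 = euler"
proof -
  have f1: "euler = qprod (-1) 2 1 * dilate 2 euler"
    using qprod_split_2[of "-1"] by (simp add: euler_def dilate_qprod)
  define O' where "O' = qprod (-1) 2 1"
  have "dilate 2 euler * (distinct_gf * O') = dilate 2 euler * 1"
    using distinct_mult_euler f1 unfolding O'_def by (metis mult.assoc mult.commute mult_1)
  then have 1: "distinct_gf * O' = 1"
    by (subst (asm) mult_left_cancel) (simp_all add: euler_def dilate_qprod qprod_nz)
  have "distinct_gf * theta4 = dilate 2 euler * O' * (distinct_gf * O')"
    unfolding theta4_product O'_def by (simp add: power2_eq_square mult_ac)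
  also have "\<dots> = euler" unfolding 1 using f1 by (simp add: O'_def mult.commute)
  finally show ?thesis .
qed

text \<open>
  The triple product with modulus 4 gives \<open>\<psi> = E(4) \<Prod>(1 + q^(2j+1))\<close>, and \<open>E(4) = F(2) E(2)\<close>.
\<close>

lemma psi_product: "psi = distinct_gf * dilate 2 euler"
proof -
  have expo: "4 * tri l + 3 * l = l * (2 * l + 1)" for l
    using two_tri[of l] by (simp add: algebra_simps)
  define Fo where "Fo = qprod 1 2 1"
  have Fe: "dilate 2 distinct_gf = qprod 1 4 2 * qprod 1 4 4"
  proof -
    have "dilate 2 distinct_gf = dilate 2 (qprod 1 2 1 * qprod 1 2 2)"
      using qprod_split_2[of 1] by (simp add: distinct_gf_def)
    then show ?thesis by (simp add: dilate_mult dilate_qprod)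
  qed
  have "{1..4} = {1, 2, 3, 4 :: nat}" by auto
  then have "distinct_gf = qprod 1 4 1 * qprod 1 4 2 * qprod 1 4 3 * qprod 1 4 4"
    using qprod_split[of 4 1] by (simp add: distinct_gf_def mult_ac)
  then have "(qprod 1 4 3 * qprod 1 4 1) * dilate 2 distinct_gf = Fo * dilate 2 distinct_gf"
    unfolding Fe Fo_def using distinct_split Fe by (simp add: mult_ac)
  then have "qprod 1 4 3 * qprod 1 4 1 = Fo"
    by (subst (asm) mult_right_cancel) (simp_all add: Fe qprod_nz)
  then have "psi = dilate 4 euler * Fo"
    using jacobi_triple_product[of 3 4 1]
    by (simp add: expo psi_def euler_def dilate_qprod)
  also have "dilate 4 euler = dilate 2 (distinct_gf * euler)"
    unfolding distinct_mult_euler by (simp add: dilate_dilate)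
  finally have "psi = (Fo * dilate 2 distinct_gf) * dilate 2 euler"
    by (simp add: dilate_mult mult_ac)
  then show ?thesis using distinct_split unfolding Fo_def by simp
qed

lemma euler_cube: "euler ^ 3 = theta tri (\<lambda>l. - (alt l * l))"
  unfolding euler_def by (rule jacobi_cube)

section \<open>The generating function of DSOME\<close>

text \<open>
  With \<open>F = F\<^sub>o F\<^sub>e\<close> the products over odd and even parts, \<open>q d/dq\<close> weights each partition by its sum. So
  differentiating only the odd (even) factor yields the sum of the odd (even) parts.
\<close>

definition dsome_gf :: "int fps" where
  "dsome_gf = q_deriv (qprod 1 2 1) * dilate 2 distinct_gf - qprod 1 2 1 * q_deriv (dilate 2 distinct_gf)"

definition dsome_weight :: "nat set \<Rightarrow> int" where
  "dsome_weight P = (\<Sum>k\<in>P. if odd k then int k else - int k)"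

lemma sum_Pow_insert:
  fixes f :: "'a set \<Rightarrow> 'b::comm_monoid_add"
  assumes "finite S" "j \<notin> S"
  shows "(\<Sum>P\<in>Pow (insert j S). f P) = (\<Sum>P\<in>Pow S. f P) + (\<Sum>P\<in>Pow S. f (insert j P))"
proof -
  have inj: "inj_on (insert j) (Pow S)" using assms(2) by (auto simp: inj_on_def)
  have disj: "Pow S \<inter> insert j ` Pow S = {}" using assms(2) by auto
  have "(\<Sum>P\<in>Pow (insert j S). f P) = (\<Sum>P\<in>Pow S. f P) + (\<Sum>P\<in>insert j ` Pow S. f P)"
    unfolding Pow_insert by (rule sum.union_disjoint) (use assms(1) disj in simp_all)
  then show ?thesis by (simp add: sum.reindex[OF inj] o_def)
qed

lemma q_deriv_one_add_X_power: "q_deriv (1 + fps_X ^ j) = fps_const (int j) * fps_X ^ j"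
  by (rule fps_ext) (auto simp: q_deriv_nth)

text \<open>
  The same two products over a finite set \<open>S\<close> of admitted parts; both formulas are proved together by
  adding one part at a time.
\<close>

lemma dsome_finite_gf:
  fixes S :: "nat set"
  assumes "finite S"
  defines "Fo \<equiv> \<lambda>S. \<Prod>j\<in>{j\<in>S. odd j}. 1 + fps_X ^ j :: int fps"
    and "Fe \<equiv> \<lambda>S. \<Prod>j\<in>{j\<in>S. even j}. 1 + fps_X ^ j :: int fps"
  shows "Fo S * Fe S = (\<Sum>P\<in>Pow S. fps_X ^ \<Sum>P)"
    and "q_deriv (Fo S) * Fe S - Fo S * q_deriv (Fe S) = (\<Sum>P\<in>Pow S. fps_const (dsome_weight P) * fps_X ^ \<Sum>P)"
proof -
  have "Fo S * Fe S = (\<Sum>P\<in>Pow S. fps_X ^ \<Sum>P) \<and>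
      q_deriv (Fo S) * Fe S - Fo S * q_deriv (Fe S) = (\<Sum>P\<in>Pow S. fps_const (dsome_weight P) * fps_X ^ \<Sum>P)"
    using assms(1)
  proof (induction S)
    case empty
    then show ?case by (simp add: Fo_def Fe_def dsome_weight_def q_deriv_def)
  next
    case (insert j S)
    define A where "A = (\<Sum>P\<in>Pow S. fps_X ^ \<Sum>P :: int fps)"
    define B where "B = (\<Sum>P\<in>Pow S. fps_const (dsome_weight P) * fps_X ^ \<Sum>P)"
    define c where "c = (if odd j then int j else - int j)"
    have IH: "Fo S * Fe S = A" "q_deriv (Fo S) * Fe S - Fo S * q_deriv (Fe S) = B"
      using insert.IH unfolding A_def B_def by auto
    have P: "finite P \<and> j \<notin> P" if "P \<in> Pow S" for P
      using that insert.hyps finite_subset by blast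
    have "(\<Sum>P\<in>Pow (insert j S). fps_X ^ \<Sum>P) = A + (\<Sum>P\<in>Pow S. fps_X ^ j * fps_X ^ \<Sum>P :: int fps)"
      unfolding sum_Pow_insert[OF insert.hyps] A_def
      by (intro arg_cong2[where f="(+)"] refl sum.cong) (use P in \<open>auto simp: power_add\<close>)
    then have rhs1: "(\<Sum>P\<in>Pow (insert j S). fps_X ^ \<Sum>P) = (1 + fps_X ^ j) * A"
      unfolding sum_distrib_left [symmetric] A_def by (simp add: algebra_simps)
    have "(\<Sum>P\<in>Pow (insert j S). fps_const (dsome_weight P) * fps_X ^ \<Sum>P) =
        B + (\<Sum>P\<in>Pow S. fps_const c * fps_X ^ j * fps_X ^ \<Sum>P + fps_X ^ j * (fps_const (dsome_weight P) * fps_X ^ \<Sum>P))"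
      unfolding sum_Pow_insert[OF insert.hyps] B_def
    proof (intro arg_cong2[where f="(+)"] refl sum.cong)
      fix P assume "P \<in> Pow S"
      then have 1: "dsome_weight (insert j P) = c + dsome_weight P" "\<Sum>(insert j P) = j + \<Sum>P"
        using P[of P] by (auto simp: dsome_weight_def c_def)
      show "fps_const (dsome_weight (insert j P)) * fps_X ^ \<Sum>(insert j P) =
        fps_const c * fps_X ^ j * fps_X ^ \<Sum>P + fps_X ^ j * (fps_const (dsome_weight P) * fps_X ^ \<Sum>P)"
        unfolding 1 by (simp add: power_add algebra_simps flip: fps_const_add)
    qed
    then have rhs2: "(\<Sum>P\<in>Pow (insert j S). fps_const (dsome_weight P) * fps_X ^ \<Sum>P) =
        (1 + fps_X ^ j) * B + fps_const c * fps_X ^ j * A"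
      unfolding sum.distrib sum_distrib_left [symmetric] A_def B_def by (simp add: algebra_simps)
    show ?case
    proof (cases "odd j")
      case True
      then have "{i\<in>insert j S. odd i} = insert j {i\<in>S. odd i}" "{i\<in>insert j S. even i} = {i\<in>S. even i}" by auto
      then have "Fo (insert j S) = (1 + fps_X ^ j) * Fo S" "Fe (insert j S) = Fe S"
        using insert.hyps unfolding Fo_def Fe_def by auto
      note eqs = this
      have "q_deriv (Fo (insert j S)) = fps_const (int j) * fps_X ^ j * Fo S + (1 + fps_X ^ j) * q_deriv (Fo S)"
        unfolding eqs q_deriv_mult q_deriv_one_add_X_power ..
      then show ?thesis
        unfolding rhs1 rhs2 IH [symmetric] using True eqs by (simp add: c_def algebra_simps)
    next
      case False
      then have "{i\<in>insert j S. odd i} = {i\<in>S. odd i}" "{i\<in>insert j S. even i} = insert j {i\<in>S. even i}" by auto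
      then have "Fo (insert j S) = Fo S" "Fe (insert j S) = (1 + fps_X ^ j) * Fe S"
        using insert.hyps unfolding Fo_def Fe_def by auto
      note eqs = this
      have "q_deriv (Fe (insert j S)) = fps_const (int j) * fps_X ^ j * Fe S + (1 + fps_X ^ j) * q_deriv (Fe S)"
        unfolding eqs q_deriv_mult q_deriv_one_add_X_power ..
      then show ?thesis
        unfolding rhs1 rhs2 IH [symmetric] using False eqs by (simp add: c_def algebra_simps flip: fps_const_neg)
    qed
  qed
  then show "Fo S * Fe S = (\<Sum>P\<in>Pow S. fps_X ^ \<Sum>P)"
    and "q_deriv (Fo S) * Fe S - Fo S * q_deriv (Fe S) = (\<Sum>P\<in>Pow S. fps_const (dsome_weight P) * fps_X ^ \<Sum>P)"
    by auto
qed

lemma tendsto_q_deriv: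
  assumes "(f \<longlongrightarrow> a) G"
  shows "((\<lambda>x. q_deriv (f x)) \<longlongrightarrow> q_deriv a) G"
proof (rule tendsto_fpsI)
  fix n
  have "eventually (\<lambda>x. fps_nth (f x) n = fps_nth a n) G"
    using assms by (auto simp: tendsto_fps_iff)
  then show "eventually (\<lambda>x. fps_nth (q_deriv (f x)) n = fps_nth (q_deriv a) n) G"
    by eventually_elim (simp add: q_deriv_nth)
qed

lemma tendsto_diff_fps:
  fixes f g :: "'b \<Rightarrow> 'a::ring fps"
  assumes "(f \<longlongrightarrow> a) G" "(g \<longlongrightarrow> b) G"
  shows "((\<lambda>x. f x - g x) \<longlongrightarrow> a - b) G"
proof (rule tendsto_fpsI)
  fix n
  show "eventually (\<lambda>x. fps_nth (f x - g x) n = fps_nth (a - b) n) G"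
    using assms[unfolded tendsto_fps_iff, rule_format, of n] by eventually_elim simp
qed

lemma DSOME_eq_weight: "DSOME n = (\<Sum>P\<in>distinct_partitions n. dsome_weight P)"
proof -
  have "(\<Sum>k\<in>{k\<in>P. odd k}. int k) - (\<Sum>k\<in>{k\<in>P. even k}. int k) = dsome_weight P"
    if "P \<in> distinct_partitions n" for P
  proof -
    have fin: "finite P" using that by (simp add: distinct_partitions_def)
    have "dsome_weight P = (\<Sum>k\<in>P. (if odd k then int k else 0) - (if even k then int k else 0))"
      unfolding dsome_weight_def by (intro sum.cong) auto
    also have "\<dots> = (\<Sum>k\<in>P. if odd k then int k else 0) - (\<Sum>k\<in>P. if even k then int k else 0)"
      by (rule sum_subtractf)
    finally show ?thesis
      by (simp only: sum.inter_filter[OF fin])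
  qed
  then show ?thesis unfolding DSOME_def sum_subtractf [symmetric] by (rule sum.cong[OF refl])
qed

lemma dsome_gf_nth: "fps_nth dsome_gf n = DSOME n"
proof -
  define Fo where "Fo S = (\<Prod>j\<in>{j\<in>S. odd j}. 1 + fps_X ^ j :: int fps)" for S :: "nat set"
  define Fe where "Fe S = (\<Prod>j\<in>{j\<in>S. even j}. 1 + fps_X ^ j :: int fps)" for S :: "nat set"
  define S where "S N = {1..2*N}" for N :: nat
  have Fo: "Fo (S N) = (\<Prod>j<N. 1 + fps_const 1 * fps_X ^ (2 * j + 1))" for N
    unfolding Fo_def S_def
    by (rule prod.reindex_bij_witness[where i="\<lambda>j. 2*j+1" and j="\<lambda>k. k div 2"]) (auto elim!: oddE)
  have Fe: "Fe (S N) = (\<Prod>j<N. 1 + fps_const 1 * fps_X ^ (2 * j + 2))" for N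
  proof -
    have eq: "2 * (k div 2 - 1) + 2 = k" if "k \<in> {k\<in>{1..2*N}. even k}" for k :: nat
      using that by (auto elim!: evenE)
    show ?thesis
      unfolding Fe_def S_def
    proof (rule prod.reindex_bij_witness[where i="\<lambda>j. 2*j+2" and j="\<lambda>k. k div 2 - 1"])
      show "1 + fps_const 1 * fps_X ^ (2 * (k div 2 - 1) + 2) = (1 + fps_X ^ k :: int fps)"
        if "k \<in> {k\<in>{1..2*N}. even k}" for k
        unfolding eq[OF that] by simp
    qed (use eq in auto)
  qed
  have limo: "(\<lambda>N. Fo (S N)) \<longlonglongrightarrow> qprod 1 2 1"
    unfolding Fo by (rule qprod_tendsto) auto
  have "dilate 2 distinct_gf = qprod 1 2 2" by (simp add: distinct_gf_def dilate_qprod)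
  then have lime: "(\<lambda>N. Fe (S N)) \<longlonglongrightarrow> dilate 2 distinct_gf"
    unfolding Fe by (metis qprod_tendsto zero_less_numeral)
  have "(\<lambda>N. q_deriv (Fo (S N)) * Fe (S N) - Fo (S N) * q_deriv (Fe (S N))) \<longlonglongrightarrow> dsome_gf"
    unfolding dsome_gf_def by (intro tendsto_diff_fps tendsto_mult_fps tendsto_q_deriv limo lime)
  then have "eventually (\<lambda>N. fps_nth (q_deriv (Fo (S N)) * Fe (S N) - Fo (S N) * q_deriv (Fe (S N))) n = fps_nth dsome_gf n) sequentially"
    unfolding tendsto_fps_iff by blast
  moreover have "eventually (\<lambda>N. fps_nth (q_deriv (Fo (S N)) * Fe (S N) - Fo (S N) * q_deriv (Fe (S N))) n = DSOME n) sequentially"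
    using eventually_ge_at_top[of n]
  proof eventually_elim
    case (elim N)
    have "q_deriv (Fo (S N)) * Fe (S N) - Fo (S N) * q_deriv (Fe (S N)) =
        (\<Sum>P\<in>Pow (S N). fps_const (dsome_weight P) * fps_X ^ \<Sum>P)"
      unfolding Fo_def Fe_def by (rule dsome_finite_gf(2)) (simp add: S_def)
    then have "fps_nth (q_deriv (Fo (S N)) * Fe (S N) - Fo (S N) * q_deriv (Fe (S N))) n =
       (\<Sum>P\<in>Pow (S N). if \<Sum>P = n then dsome_weight P else 0)"
      by (simp add: fps_sum_nth if_distrib cong: if_cong) (intro sum.cong, auto)
    also have "\<dots> = (\<Sum>P\<in>{P\<in>Pow (S N). \<Sum>P = n}. dsome_weight P)"
      by (rule sum.inter_filter [symmetric]) (simp add: S_def)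
    also have "{P\<in>Pow (S N). \<Sum>P = n} = distinct_partitions n"
    proof
      show "{P\<in>Pow (S N). \<Sum>P = n} \<subseteq> distinct_partitions n"
        unfolding distinct_partitions_def S_def by (auto intro: finite_subset)
      show "distinct_partitions n \<subseteq> {P\<in>Pow (S N). \<Sum>P = n}"
      proof
        fix P assume P: "P \<in> distinct_partitions n"
        then have "finite P" "0 \<notin> P" "\<Sum>P = n" by (auto simp: distinct_partitions_def)
        moreover have "k \<in> S N" if "k \<in> P" for k
        proof -
          have "k \<le> \<Sum>P" using that \<open>finite P\<close> by (intro member_le_sum) auto
          moreover have "k \<noteq> 0" using that \<open>0 \<notin> P\<close> by metis
          ultimately show ?thesis using elim \<open>\<Sum>P = n\<close> by (simp add: S_def)
        qed
        ultimately show "P \<in> {P\<in>Pow (S N). \<Sum>P = n}" by auto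
      qed
    qed
    finally show ?case by (simp add: DSOME_eq_weight)
  qed
  ultimately have "eventually (\<lambda>N::nat. fps_nth dsome_gf n = DSOME n) sequentially"
    by eventually_elim simp
  then show ?thesis by simp
qed

section \<open>A Wronskian of theta functions\<close>

lemma abs_le_square: "\<bar>l\<bar> \<le> l * l" for l :: int
proof (cases "l = 0")
  case False
  then have "\<bar>l\<bar> * 1 \<le> \<bar>l\<bar> * \<bar>l\<bar>" by (intro mult_left_mono) auto
  then show ?thesis by (simp only: abs_mult_self_eq mult_1_right)
qed simp

lemma admissible_square: "admissible (\<lambda>k::int. k * k)"
proof (rule admissibleI)
  fix l :: int
  show "0 \<le> l * l" by simp
  show "\<bar>l\<bar> \<le> l * l + 1"
    using abs_le_square[of l] by simp
qed

lemma admissible_tri: "admissible tri"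
proof (rule admissibleI)
  show "0 \<le> tri l" "\<bar>l\<bar> \<le> tri l + 1" for l
    using tri_nonneg[of l] tri_ge[of l] by simp_all
qed

lemma admissible_psi: "admissible (\<lambda>k::int. k * (2 * k + 1))"
proof (rule admissibleI)
  fix l :: int
  have eq: "l * (2 * l + 1) = 2 * (l * l) + l" by (simp add: algebra_simps)
  show "0 \<le> l * (2 * l + 1)" "\<bar>l\<bar> \<le> l * (2 * l + 1) + 1"
    unfolding eq using abs_le_square[of l] by linarith+
qed

lemma admissible_pronic: "admissible (\<lambda>n::int. n * n + n)"
proof (rule admissibleI)
  fix l :: int
  have "0 \<le> l * l + l" using two_tri[of "-l"] tri_nonneg[of "-l"] by (simp add: algebra_simps)
  moreover have "\<bar>l\<bar> - 1 \<le> l * l + l" using two_tri[of "-l"] tri_ge[of "-l"] tri_nonneg[of "-l"] by (simp add: algebra_simps)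
  ultimately show "0 \<le> l * l + l" "\<bar>l\<bar> \<le> l * l + l + 1" by auto
qed

text \<open>
  The exponents \<open>n(n+1)\<close> are attained twice, at \<open>n\<close> and at \<open>-1 - n\<close>.
\<close>

lemma dilate_2_psi: "theta (\<lambda>n. n * n + n) (\<lambda>_. 1) = fps_const 2 * dilate 2 psi"
proof -
  define f where "f c j = (if c = (0::nat) then 2 * j else - 2 * j - 1)" for c and j :: int
  have "theta (\<lambda>n. n * n + n) (\<lambda>_. 1) = (\<Sum>c\<in>{0,1}. theta (\<lambda>j. f c j * f c j + f c j) (\<lambda>_. 1))"
  proof (rule theta_partition[OF admissible_pronic])
    fix i :: int
    have "(\<exists>j. i = 2 * j) \<or> (\<exists>j. i = - 2 * j - 1)" by presburger
    then show "\<exists>c\<in>{0,1}. \<exists>j. i = f c j" unfolding f_def by auto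
  next
    fix c c' and j j' :: int
    assume "c \<in> {0,1}" "c' \<in> {0,1}" "f c j = f c' j'"
    then show "c = c' \<and> j = j'" unfolding f_def by - (cases "c = 0"; cases "c' = 0"; simp; presburger)
  qed simp
  also have "\<dots> = theta (\<lambda>j. int 2 * (j * (2 * j + 1))) (\<lambda>_. 1) + theta (\<lambda>j. int 2 * (j * (2 * j + 1))) (\<lambda>_. 1)"
  proof -
    have "theta (\<lambda>j. f c j * f c j + f c j) (\<lambda>_. 1) = theta (\<lambda>j. int 2 * (j * (2 * j + 1))) (\<lambda>_. 1)" for c
      by (rule theta_cong) (auto simp: f_def algebra_simps)
    then show ?thesis by simp
  qed
  also have "theta (\<lambda>j. int 2 * (j * (2 * j + 1))) (\<lambda>_. 1) = dilate 2 psi"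
    unfolding psi_def by (rule theta_dilate) simp
  finally show ?thesis by (simp add: numeral_fps_const mult_2 flip: fps_const_add)
qed

text \<open>
  The reflection \<open>l \<mapsto> 1 - l\<close> preserves the exponent and reverses the sign.
\<close>

lemma theta_tri_alt: "theta tri alt = 0"
proof -
  have "theta tri alt = theta (\<lambda>l. tri (1 - l)) (\<lambda>l. alt (1 - l))"
    by (rule theta_reindex[symmetric], rule bij_betw_byWitness[where f'="\<lambda>l. 1 - l"]) auto
  also have "\<dots> = theta tri (\<lambda>l. - alt l)"
  proof (rule theta_cong)
    show "tri (1 - l) = tri l" "alt (1 - l) = - alt l" for l
      using two_tri[of l] two_tri[of "1 - l"] by (simp_all add: algebra_simps alt_def)
  qed
  also have "\<dots> = - theta tri alt" by (rule theta_minus_weight)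
  finally have "theta tri alt + theta tri alt = 0" by (simp only: eq_neg_iff_add_eq_0)
  then show ?thesis by (simp flip: mult_2)
qed

text \<open>
  The Wronskian of \<open>\<Sum> q^(m\<^sup>2)\<close> and \<open>\<Sum> q^((n + 1/2)\<^sup>2)\<close> has the weights \<open>(n + 1/2)\<^sup>2 - m\<^sup>2\<close>. These factor as
  \<open>(n + 1/2 + m)(n + 1/2 - m)\<close>, and the rotation to the new coordinates turns the double sum into one half
  of the square of Jacobi's series for \<open>E\<^sup>3\<close>. The other half comes from the pairs of opposite parity,
  which contribute the same amount.
\<close>

lemma wronskian: 
  "euler ^ 6 = theta3 * dilate 2 psi + 4 * (theta3 * q_deriv (dilate 2 psi) - dilate 2 psi * q_deriv theta3)"
proof -
  define J where "J = theta tri (\<lambda>l. alt l * (2 * l - 1))"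
  \<comment> \<open>Jacobi's series in the symmetric form with weights \<open>2 l - 1\<close>, at the cost of a factor \<open>-2\<close>.\<close>
  define \<Psi> where "\<Psi> = theta (\<lambda>n::int. n * n + n) (\<lambda>_. 1)"
  define e where "e = (\<lambda>(m::int, n::int). m * m + (n * n + n))"
  have "J = theta tri (\<lambda>l. (-2) * (- (alt l * l)) - alt l)"
    unfolding J_def by (rule theta_cong) (auto simp: algebra_simps)
  also have "\<dots> = fps_const (- 2) * euler ^ 3"
    unfolding theta_diff_weight theta_tri_alt euler_cube theta_scale_weight by simp
  finally have J: "J = fps_const (- 2) * euler ^ 3" .
  define W where "W = theta e (\<lambda>(m, n). (2 * n + 1 + 2 * m) * (2 * n + 1 - 2 * m))"
  define f :: "nat \<Rightarrow> int \<times> int \<Rightarrow> int \<times> int"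
    where "f c = (\<lambda>(m, n). (n + m + 1, if c = 0 then n - m + 1 else m - n))" for c
  have tri_sum: "tri (n + m + 1) + tri (n - m + 1) = m * m + (n * n + n)" for m n
    using two_tri[of "n+m+1"] two_tri[of "n-m+1"] by (simp add: algebra_simps)
  have tri_sum': "tri (n + m + 1) + tri (m - n) = m * m + (n * n + n)" for m n
    using two_tri[of "n+m+1"] two_tri[of "m-n"] by (simp add: algebra_simps)
  have "J * J = theta (\<lambda>(k, l). tri k + tri l) (\<lambda>(k, l). alt k * (2 * k - 1) * (alt l * (2 * l - 1)))"
    unfolding J_def by (rule theta_mult) (rule admissible_tri)+
  also have "\<dots> = (\<Sum>c\<in>{0,1}. theta (\<lambda>p. case f c p of (k, l) \<Rightarrow> tri k + tri l)
      (\<lambda>p. case f c p of (k, l) \<Rightarrow> alt k * (2 * k - 1) * (alt l * (2 * l - 1))))"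
  proof (rule theta_partition[OF admissible_pair[OF admissible_tri admissible_tri]])
    fix i :: "int \<times> int"
    obtain k l where i: "i = (k, l)" by (cases i)
    have "(\<exists>m n. k = n + m + 1 \<and> l = n - m + 1) \<or> (\<exists>m n. k = n + m + 1 \<and> l = m - n)" by presburger
    then show "\<exists>c\<in>{0,1}. \<exists>j. i = f c j"
      unfolding f_def i by (auto simp: split_beta)
  next
    fix c c' and j j' :: "int \<times> int"
    assume "c \<in> {0,1}" "c' \<in> {0,1}" "f c j = f c' j'"
    then show "c = c' \<and> j = j'"
      unfolding f_def by - (cases j; cases j'; cases "c = 0"; cases "c' = 0"; simp; presburger)
  qed simp
  also have "\<dots> = W + W"
  proof -
    have "theta (\<lambda>p. case f 0 p of (k, l) \<Rightarrow> tri k + tri l)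
      (\<lambda>p. case f 0 p of (k, l) \<Rightarrow> alt k * (2 * k - 1) * (alt l * (2 * l - 1))) = W"
      unfolding W_def
      by (rule theta_cong; rename_tac p; case_tac p) (simp_all add: f_def e_def tri_sum, simp_all add: alt_def algebra_simps)
    moreover have "theta (\<lambda>p. case f 1 p of (k, l) \<Rightarrow> tri k + tri l)
      (\<lambda>p. case f 1 p of (k, l) \<Rightarrow> alt k * (2 * k - 1) * (alt l * (2 * l - 1))) = W"
      unfolding W_def
      by (rule theta_cong; rename_tac p; case_tac p) (simp_all add: f_def e_def tri_sum', simp_all add: alt_def algebra_simps)
    ultimately show ?thesis by simp
  qed
  finally have JJ: "J * J = W + W" .
  have "W = theta e (\<lambda>p. (case p of (m, n) \<Rightarrow> 1 * 1) + 4 * ((case p of (m, n) \<Rightarrow> 1 * ((n * n + n) * 1)) - (case p of (m, n) \<Rightarrow> (m * m * 1) * 1)))"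
    unfolding W_def by (rule theta_cong) (auto simp: algebra_simps)
  also have "\<dots> = theta3 * \<Psi> + fps_const 4 * (theta3 * q_deriv \<Psi> - q_deriv theta3 * \<Psi>)"
    unfolding theta_add_weight theta_scale_weight theta_diff_weight
    unfolding theta3_def \<Psi>_def q_deriv_theta e_def by (simp only: theta_mult[OF admissible_square admissible_pronic])
  finally have W: "W = theta3 * \<Psi> + fps_const 4 * (theta3 * q_deriv \<Psi> - q_deriv theta3 * \<Psi>)" .
  have \<Psi>: "\<Psi> = 2 * dilate 2 psi" unfolding \<Psi>_def dilate_2_psi by (simp add: numeral_fps_const)
  have \<Psi>': "q_deriv \<Psi> = 2 * q_deriv (dilate 2 psi)" unfolding \<Psi> q_deriv_mult by (simp add: q_deriv_def)
  have "4 * euler ^ 6 = J * J"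
    unfolding J by (simp add: power_mult [symmetric] power_add [symmetric] numeral_fps_const mult_ac flip: fps_const_mult)
  also have "\<dots> = 4 * (theta3 * dilate 2 psi + 4 * (theta3 * q_deriv (dilate 2 psi) - dilate 2 psi * q_deriv theta3))"
    unfolding JJ W \<Psi>' unfolding \<Psi> by (simp add: algebra_simps flip: numeral_fps_const)
  finally show ?thesis
    by (rule mult_left_cancel[THEN iffD1, rotated]) simp
qed

text \<open>
  In terms of products, \<open>\<Sum> q^(m\<^sup>2) = E(2) F\<^sub>o\<^sup>2\<close> and \<open>\<psi>(2) = E(2) F\<^sub>e\<^sup>2\<close>. The common factor \<open>E(2)\<close> drops out of their
  Wronskian, which thereby becomes a multiple of \<open>dsome_gf\<close>.
\<close>

theorem dsome_gf_formula: "8 * dsome_gf = distinct_gf - euler * theta4 ^ 3"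
proof -
  define F f2 Fo Fe where "F = distinct_gf" and "f2 = dilate 2 euler" and "Fo = qprod 1 2 1" and "Fe = dilate 2 distinct_gf"
  have F: "F = Fo * Fe" unfolding F_def Fo_def Fe_def by (rule distinct_split)
  have f2: "f2 = F * euler" unfolding F_def f2_def by (simp add: distinct_mult_euler)
  have P: "F * theta4 = euler" unfolding F_def by (rule distinct_mult_theta4)
  have t3: "theta3 = f2 * Fo ^ 2" unfolding f2_def Fo_def by (rule theta3_product)
  have psi: "psi = F * (F * euler)" unfolding psi_product F_def distinct_mult_euler ..
  have psi2: "dilate 2 psi = f2 * Fe ^ 2"
    unfolding psi by (simp add: F_def Fe_def f2_def dilate_mult power2_eq_square mult_ac)
  have sq: "q_deriv (g ^ 2) = 2 * (g * q_deriv g)" for g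
    by (simp add: power2_eq_square q_deriv_mult algebra_simps)
  have wr: "theta3 * q_deriv (dilate 2 psi) - dilate 2 psi * q_deriv theta3 = - (2 * (f2 ^ 2 * (F * dsome_gf)))"
    unfolding t3 psi2 q_deriv_mult sq dsome_gf_def F unfolding Fo_def[symmetric] Fe_def[symmetric]
    by (simp add: algebra_simps power2_eq_square)
  have "euler ^ 6 = theta3 * dilate 2 psi - 8 * (f2 ^ 2 * (F * dsome_gf))"
    using wronskian unfolding wr by (simp add: algebra_simps)
  also have "theta3 * dilate 2 psi = f2 ^ 2 * F ^ 2"
    unfolding t3 psi2 F by (simp add: algebra_simps power2_eq_square)
  also have "euler ^ 6 = f2 ^ 2 * (F * (euler * theta4 ^ 3))"
    unfolding f2 P[symmetric] by (simp add: algebra_simps power_mult_distrib eval_nat_numeral)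
  finally have "(f2 ^ 2 * F) * (8 * dsome_gf) = (f2 ^ 2 * F) * (F - euler * theta4 ^ 3)"
    by (simp add: algebra_simps power2_eq_square)
  moreover have "f2 ^ 2 * F \<noteq> 0"
    unfolding F_def f2_def by (simp add: euler_def distinct_gf_def dilate_qprod qprod_nz)
  ultimately show ?thesis unfolding F_def by (subst (asm) mult_left_cancel)
qed

section \<open>Dissections modulo 5\<close>

lemma linear_exponent_bound:
  fixes m r l :: int
  assumes "\<bar>r\<bar> < m"
  shows "\<bar>l\<bar> \<le> m * (l * l) + r * l"
proof -
  have "\<bar>r * l\<bar> \<le> (m - 1) * \<bar>l\<bar>"
    unfolding abs_mult using assms by (intro mult_right_mono) auto
  moreover have "m * \<bar>l\<bar> \<le> m * (l * l)"
    using assms abs_le_square[of l] by (intro mult_left_mono) auto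
  moreover have "(m - 1) * \<bar>l\<bar> = m * \<bar>l\<bar> - \<bar>l\<bar>" by (simp add: algebra_simps)
  ultimately show ?thesis using abs_ge_minus_self[of "r * l"] by linarith
qed

lemma admissible_quadratic:
  fixes m r :: int
  assumes "\<bar>r\<bar> < m"
  shows "admissible (\<lambda>l. m * (l * l) + r * l)"
proof (rule admissibleI)
  show "0 \<le> m * (l * l) + r * l" "\<bar>l\<bar> \<le> m * (l * l) + r * l + 1" for l
    using linear_exponent_bound[OF assms, of l] by linarith+
qed

text \<open>
  The two nontrivial components of \<open>theta4\<close> modulo 5, from \<open>k \<equiv> \<plusminus>1\<close> and \<open>k \<equiv> \<plusminus>2\<close>.
\<close>

definition theta4_1 :: "int fps" where "theta4_1 = theta (\<lambda>k. 5 * (k * k) + 2 * k) alt"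
definition theta4_2 :: "int fps" where "theta4_2 = theta (\<lambda>k. 5 * (k * k) + 4 * k) alt"

lemma theta4_dissection:
  "theta4 = dilate 5 (dilate 5 theta4) - 2 * fps_X * dilate 5 theta4_1 + 2 * fps_X ^ 4 * dilate 5 theta4_2"
proof -
  define f :: "nat \<Rightarrow> int \<Rightarrow> int" where
    "f c j = (if c = 0 then 5 * j else if c = 1 then 5 * j + 1 else if c = 2 then - 5 * j - 1
        else if c = 3 then 5 * j + 2 else - 5 * j - 2)" for c j
  have sum: "theta4 = (\<Sum>c\<in>{0,1,2,3,4}. theta (\<lambda>j. f c j * f c j) (\<lambda>j. alt (f c j)))"
    unfolding theta4_def
  proof (rule theta_partition[OF admissible_square])
    fix i :: int
    have "(\<exists>j. i = 5 * j) \<or> (\<exists>j. i = 5 * j + 1) \<or> (\<exists>j. i = - 5 * j - 1) \<or> (\<exists>j. i = 5 * j + 2) \<or> (\<exists>j. i = - 5 * j - 2)"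
      by presburger
    then show "\<exists>c\<in>{0,1,2,3,4}. \<exists>j. i = f c j"
      unfolding f_def by simp
  next
    fix c c' and j j'
    assume "c \<in> {0,1,2,3,4}" "c' \<in> {0,1,2,3,4}" "f c j = f c' j'"
    then show "c = c' \<and> j = j'"
      unfolding f_def by - (elim insertE emptyE; simp; presburger)
  qed simp
  have p0: "theta (\<lambda>j. f 0 j * f 0 j) (\<lambda>j. alt (f 0 j)) = dilate 5 (dilate 5 theta4)"
  proof -
    have "theta (\<lambda>j. f 0 j * f 0 j) (\<lambda>j. alt (f 0 j)) = theta (\<lambda>j. int 5 * (int 5 * (j * j))) alt"
      by (rule theta_cong) (auto simp: f_def alt_def algebra_simps)
    then show ?thesis unfolding theta4_def by (simp only: theta_dilate)
  qed
  have p1: "theta (\<lambda>j. f c j * f c j) (\<lambda>j. alt (f c j)) = - (fps_X * dilate 5 theta4_1)" if "c = 1 \<or> c = 2" for c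
  proof -
    have adm: "admissible (\<lambda>j::int. int 5 * (5 * (j * j) + 2 * j))"
      using admissible_quadratic[of 10 25] by (simp add: algebra_simps)
    have "theta (\<lambda>j. f c j * f c j) (\<lambda>j. alt (f c j)) = theta (\<lambda>j. int 5 * (5 * (j * j) + 2 * j) + int 1) (\<lambda>j. - alt j)"
      by (rule theta_cong) (use that in \<open>auto simp: f_def alt_def algebra_simps\<close>)
    also have "\<dots> = - (fps_X * dilate 5 theta4_1)"
      unfolding theta_minus_weight theta_shift[OF adm] theta4_1_def by (simp only: theta_dilate power_one_right)
    finally show ?thesis .
  qed
  have p2: "theta (\<lambda>j. f c j * f c j) (\<lambda>j. alt (f c j)) = fps_X ^ 4 * dilate 5 theta4_2" if "c = 3 \<or> c = 4" for c
  proof -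
    have adm: "admissible (\<lambda>j::int. int 5 * (5 * (j * j) + 4 * j))"
      using admissible_quadratic[of 20 25] by (simp add: algebra_simps)
    have "theta (\<lambda>j. f c j * f c j) (\<lambda>j. alt (f c j)) = theta (\<lambda>j. int 5 * (5 * (j * j) + 4 * j) + int 4) alt"
      by (rule theta_cong) (use that in \<open>auto simp: f_def alt_def algebra_simps\<close>)
    also have "\<dots> = fps_X ^ 4 * dilate 5 theta4_2"
      unfolding theta_shift[OF adm] theta4_2_def by (simp only: theta_dilate)
    finally show ?thesis .
  qed
  show ?thesis by (subst sum) (simp add: p0 p1 p2 algebra_simps)
qed

text \<open>
  The variant for maps whose image is the fibre of a class function, such as a residue.
\<close>

lemma theta_partition_classes:
  assumes "admissible e" "finite C"
    and cls: "\<And>i. cls i \<in> C" "\<And>i. \<exists>j. i = f (cls i) j"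
    and f: "\<And>c j. c \<in> C \<Longrightarrow> cls (f c j) = c" "\<And>c. c \<in> C \<Longrightarrow> inj (f c)"
  shows "theta e w = (\<Sum>c\<in>C. theta (\<lambda>j. e (f c j)) (\<lambda>j. w (f c j)))"
proof (rule theta_partition[OF assms(1,2)])
  show "\<exists>c\<in>C. \<exists>j. i = f c j" for i using cls by blast
  show "c = c' \<and> j = j'" if "c \<in> C" "c' \<in> C" "f c j = f c' j'" for c c' j j'
  proof -
    have "c = c'" using f(1)[OF that(1)] f(1)[OF that(2)] that(3) by metis
    then show ?thesis using f(2)[OF that(1)] that(3) by (auto dest: injD)
  qed
qed

text \<open>
  Both squares are sums over the Gaussian integers \<open>x + i y\<close>. The class of \<open>x - 2 y\<close> modulo 5 is the class
  modulo \<open>2 + i\<close>. The multiples of \<open>2 + i\<close> give \<open>theta4(5)\<^sup>2\<close>; the other four classes are permuted by the unit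
  \<open>i\<close> and give equal sums, each of which separates into a product.
\<close>

lemma theta4_square_identity:
  "theta4 ^ 2 = dilate 5 theta4 ^ 2 - 4 * fps_X * theta4_1 * theta4_2"
proof -
  define f :: "nat \<Rightarrow> int \<times> int \<Rightarrow> int \<times> int" where
    "f c = (\<lambda>(s, t). if c = 0 then (2 * s - t, s + 2 * t)
      else if c = 1 then (2 * s + t + 1, s - 2 * t)
      else if c = 2 then (s - 2 * t, - 2 * s - t - 1)
      else if c = 3 then (- s + 2 * t, 2 * s + t + 1)
      else (- 2 * s - t - 1, - s + 2 * t))" for c
  \<comment> \<open>\<open>f 0\<close> is \<open>(2 + i)(s + i t)\<close> and \<open>f 1\<close> is \<open>(2 + i)(s - i t) + 1\<close>; the other three are \<open>f 1\<close> times \<open>-i\<close>, \<open>i\<close>, \<open>-1\<close>.\<close>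
  define cls :: "int \<times> int \<Rightarrow> nat" where "cls = (\<lambda>(x, y). nat ((x - 2 * y) mod 5))"
  have sq: "theta4 ^ 2 = theta (\<lambda>(x, y). x * x + y * y) (\<lambda>(x, y). alt x * alt y)"
    unfolding theta4_def power2_eq_square by (rule theta_mult) (rule admissible_square)+
  also have "\<dots> = (\<Sum>c\<in>{0,1,2,3,4}. theta (\<lambda>p. case f c p of (x, y) \<Rightarrow> x * x + y * y) (\<lambda>p. case f c p of (x, y) \<Rightarrow> alt x * alt y))"
  proof (rule theta_partition_classes[OF admissible_pair[OF admissible_square admissible_square], where cls = cls])
    fix i :: "int \<times> int"
    obtain x y where i: "i = (x, y)" by (cases i)
    define k where "k = (x - 2 * y) div 5"
    have "(x - 2 * y) mod 5 \<in> {0..<5}" by simp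
    then have r: "(x - 2 * y) mod 5 \<in> {0,1,2,3,4}" by (simp; linarith)
    then show "cls i \<in> {0,1,2,3,4}" unfolding cls_def i by auto
    have x: "x = 2 * y + 5 * k + (x - 2 * y) mod 5" unfolding k_def by simp
    have "\<exists>j. i = f (cls i) j" if "(x - 2 * y) mod 5 = 0"
      using x that by (intro exI[of _ "(y + 2 * k, - k)"]) (simp add: f_def cls_def i)
    moreover have "\<exists>j. i = f (cls i) j" if "(x - 2 * y) mod 5 = 1"
      using x that by (intro exI[of _ "(y + 2 * k, k)"]) (simp add: f_def cls_def i)
    moreover have "\<exists>j. i = f (cls i) j" if "(x - 2 * y) mod 5 = 2"
      using x that by (intro exI[of _ "(k, - y - 2 * k - 1)"]) (simp add: f_def cls_def i)
    moreover have "\<exists>j. i = f (cls i) j" if "(x - 2 * y) mod 5 = 3"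
      using x that by (intro exI[of _ "(- k - 1, y + 2 * k + 1)"]) (simp add: f_def cls_def i)
    moreover have "\<exists>j. i = f (cls i) j" if "(x - 2 * y) mod 5 = 4"
      using x that by (intro exI[of _ "(- y - 2 * k - 2, - k - 1)"]) (simp add: f_def cls_def i)
    ultimately show "\<exists>j. i = f (cls i) j"
      using r by blast
  next
    fix c :: nat and j :: "int \<times> int"
    obtain s t where j: "j = (s, t)" by (cases j)
    assume "c \<in> {0,1,2,3,4}"
    moreover have "cls (x, y) = r" if "x - 2 * y = 5 * q + int r" "r < 5" for x y q r
      using that by (simp add: cls_def)
    note this[of _ _ "- t" 0] this[of _ _ t 1] this[of _ _ s 2] this[of _ _ "- s - 1" 3] this[of _ _ "- t - 1" 4]
    ultimately show "cls (f c j) = c"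
      unfolding f_def j by (elim insertE emptyE) simp_all
  next
    fix c :: nat
    assume "c \<in> {0,1,2,3,4}"
    then show "inj (f c)"
      unfolding f_def
      by - (elim insertE emptyE; rule injI; rename_tac p p'; case_tac p; case_tac p'; simp; presburger)
  qed simp
  also have "\<dots> = dilate 5 theta4 ^ 2 - 4 * fps_X * theta4_1 * theta4_2"
  proof -
    have "theta (\<lambda>p. case f 0 p of (x, y) \<Rightarrow> x * x + y * y) (\<lambda>p. case f 0 p of (x, y) \<Rightarrow> alt x * alt y)
       = theta (\<lambda>p. int 5 * (case p of (x, y) \<Rightarrow> x * x + y * y)) (\<lambda>(x, y). alt x * alt y)"
      by (rule theta_cong; rename_tac p; case_tac p) (auto simp: f_def algebra_simps alt_def)
    also have "\<dots> = dilate 5 theta4 ^ 2"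
      by (subst theta_dilate) (simp_all add: sq [symmetric] dilate_power)
    finally have 0: "theta (\<lambda>p. case f 0 p of (x, y) \<Rightarrow> x * x + y * y) (\<lambda>p. case f 0 p of (x, y) \<Rightarrow> alt x * alt y) = dilate 5 theta4 ^ 2" .
    have adm: "admissible (\<lambda>k::int. 5 * (k * k) + 4 * k)" "admissible (\<lambda>k::int. 5 * (k * k) + 2 * k)"
      using admissible_quadratic[of _ 5] by simp_all
    have 1: "theta (\<lambda>p. case f c p of (x, y) \<Rightarrow> x * x + y * y) (\<lambda>p. case f c p of (x, y) \<Rightarrow> alt x * alt y) = - (fps_X * (theta4_2 * theta4_1))"
      if "c \<in> {1,2,3,4}" for c
    proof -
      have "theta (\<lambda>p. case f c p of (x, y) \<Rightarrow> x * x + y * y) (\<lambda>p. case f c p of (x, y) \<Rightarrow> alt x * alt y)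
        = theta (\<lambda>p. (case p of (x, y) \<Rightarrow> (5 * (x * x) + 4 * x) + (5 * (y * y) + 2 * y)) + int 1) (\<lambda>p. - (case p of (x, y) \<Rightarrow> alt x * alt y))"
        by (rule theta_cong; rename_tac p; case_tac p) (use that in \<open>auto simp: f_def algebra_simps alt_def\<close>)
      also have "\<dots> = - (fps_X * (theta4_2 * theta4_1))"
        unfolding theta_minus_weight theta_shift[OF admissible_pair[OF adm]] theta4_1_def theta4_2_def
        by (simp only: theta_mult[OF adm] power_one_right)
      finally show ?thesis .
    qed
    show ?thesis using 0 1 by simp
  qed
  finally show ?thesis .
qed

text \<open>
  The generalised pentagonal numbers are congruent to 0, 1 or 2 modulo 5. The class 1 comes from
  \<open>k \<equiv> 1\<close> modulo 5 only, and there the exponent is \<open>1 + 25 (3 j\<^sup>2 - j)/2\<close> with \<open>k = 1 - 5 j\<close>.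
\<close>

lemma euler_dissection:
  obtains a b where "euler = dilate 5 a - fps_X * dilate 5 (dilate 5 euler) - fps_X ^ 2 * dilate 5 b"
proof -
  define f :: "nat \<Rightarrow> int \<Rightarrow> int" where
    "f c j = (if c = 0 then 5 * j else if c = 1 then 1 - 5 * j else 5 * j + int c)" for c j
  define e :: "int \<Rightarrow> int" where "e k = 3 * tri k + k" for k
  have two_e: "2 * e k = 3 * (k * k) - k" for k
    using two_tri[of k] by (simp add: e_def algebra_simps)
  have adm: "admissible e"
  proof (rule admissibleI)
    show "0 \<le> e l" "\<bar>l\<bar> \<le> e l + 1" for l
      using theta_exponent_bound[of 1 3 l] by (auto simp: e_def)
  qed
  have f1: "euler = theta e alt" unfolding e_def by (rule pentagonal_number_theorem)
  also have "\<dots> = (\<Sum>c\<in>{0,1,2,3,4}. theta (\<lambda>j. e (f c j)) (\<lambda>j. alt (f c j)))"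
  proof (rule theta_partition[OF adm])
    fix i :: int
    have "(\<exists>j. i = 5 * j) \<or> (\<exists>j. i = 1 - 5 * j) \<or> (\<exists>j. i = 5 * j + 2) \<or> (\<exists>j. i = 5 * j + 3) \<or> (\<exists>j. i = 5 * j + 4)"
      by presburger
    then show "\<exists>c\<in>{0,1,2,3,4}. \<exists>j. i = f c j"
      unfolding f_def by simp
  next
    fix c c' and j j'
    assume "c \<in> {0,1,2,3,4}" "c' \<in> {0,1,2,3,4}" "f c j = f c' j'"
    then show "c = c' \<and> j = j'"
      unfolding f_def by - (elim insertE emptyE; simp; presburger)
  qed simp
  finally have sum: "euler = (\<Sum>c\<in>{0,1,2,3,4}. theta (\<lambda>j. e (f c j)) (\<lambda>j. alt (f c j)))" .
  have inj: "inj (f c)" for c by (auto simp: f_def inj_def)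
  have piece: "theta (\<lambda>j. e (f c j)) (\<lambda>j. alt (f c j)) = fps_X ^ r * dilate 5 (theta g (\<lambda>j. alt (f c j)))"
    if "\<And>j. e (f c j) = 5 * g j + int r" "\<And>j. 0 \<le> g j" for c r g
  proof -
    have "admissible (\<lambda>j. e (f c j))" by (rule admissible_inj[OF adm inj])
    then have fin: "finite {i. 5 * g i + int r = int n}" for n
      unfolding admissible_def that(1) by blast
    have "{i. int 5 * g i = int n} = {i. 5 * g i + int r = int (n + r)}" for n by auto
    then have "finite {i. int 5 * g i = int n}" for n using fin[of "n + r"] by (simp only:)
    then have adm': "admissible (\<lambda>j. int 5 * g j)"
      unfolding admissible_def using that(2) by simp
    show ?thesis
      unfolding that(1) using theta_shift[OF adm', of r] theta_dilate[of 5 g] by simp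
  qed
  have p0: "theta (\<lambda>j. e (f 0 j)) (\<lambda>j. alt (f 0 j)) = fps_X ^ 0 * dilate 5 (theta (\<lambda>j. 15 * tri j + 7 * j) (\<lambda>j. alt (f 0 j)))"
  proof (rule piece)
    fix j
    show "e (f 0 j) = 5 * (15 * tri j + 7 * j) + int 0"
      using two_e[of "f 0 j"] two_tri[of j] by (simp add: f_def algebra_simps)
    show "0 \<le> 15 * tri j + 7 * j"
      using theta_exponent_bound[of 7 15 j] by simp
  qed
  have p1: "theta (\<lambda>j. e (f 1 j)) (\<lambda>j. alt (f 1 j)) = fps_X ^ 1 * dilate 5 (theta (\<lambda>j. int 5 * e j) (\<lambda>j. alt (f 1 j)))"
  proof (rule piece)
    fix j
    show "e (f 1 j) = 5 * (int 5 * e j) + int 1"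
      using two_e[of "f 1 j"] two_e[of j] by (simp add: f_def algebra_simps)
    show "0 \<le> int 5 * e j"
      using adm by (simp add: admissible_def)
  qed
  have p2: "theta (\<lambda>j. e (f 2 j)) (\<lambda>j. alt (f 2 j)) = fps_X ^ 0 * dilate 5 (theta (\<lambda>j. 15 * tri j + 13 * j + 1) (\<lambda>j. alt (f 2 j)))"
  proof (rule piece)
    fix j
    show "e (f 2 j) = 5 * (15 * tri j + 13 * j + 1) + int 0"
      using two_e[of "f 2 j"] two_tri[of j] by (simp add: f_def algebra_simps)
    show "0 \<le> 15 * tri j + 13 * j + 1"
      using theta_exponent_bound[of 13 15 j] by simp
  qed
  have p3: "theta (\<lambda>j. e (f 3 j)) (\<lambda>j. alt (f 3 j)) = fps_X ^ 2 * dilate 5 (theta (\<lambda>j. 15 * tri j + 16 * j + 2) (\<lambda>j. alt (f 3 j)))"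
  proof (rule piece)
    fix j
    show "e (f 3 j) = 5 * (15 * tri j + 16 * j + 2) + int 2"
      using two_e[of "f 3 j"] two_tri[of j] by (simp add: f_def algebra_simps)
    have "0 \<le> e (f 3 j)" using adm by (simp add: admissible_def)
    then show "0 \<le> 15 * tri j + 16 * j + 2"
      using two_e[of "f 3 j"] two_tri[of j] by (simp add: f_def algebra_simps)
  qed
  have p4: "theta (\<lambda>j. e (f 4 j)) (\<lambda>j. alt (f 4 j)) = fps_X ^ 2 * dilate 5 (theta (\<lambda>j. 15 * tri j + 19 * j + 4) (\<lambda>j. alt (f 4 j)))"
  proof (rule piece)
    fix j
    show "e (f 4 j) = 5 * (15 * tri j + 19 * j + 4) + int 2"
      using two_e[of "f 4 j"] two_tri[of j] by (simp add: f_def algebra_simps)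
    have "0 \<le> e (f 4 j)" using adm by (simp add: admissible_def)
    then show "0 \<le> 15 * tri j + 19 * j + 4"
      using two_e[of "f 4 j"] two_tri[of j] by (simp add: f_def algebra_simps)
  qed
  have "theta (\<lambda>j. int 5 * e j) (\<lambda>j. alt (f 1 j)) = theta (\<lambda>j. int 5 * e j) (\<lambda>j. - alt j)"
    by (rule theta_cong) (auto simp: f_def alt_def)
  also have "\<dots> = - dilate 5 euler"
    unfolding theta_minus_weight f1 by (simp only: theta_dilate)
  finally have middle: "theta (\<lambda>j. int 5 * e j) (\<lambda>j. alt (f 1 j)) = - dilate 5 euler" .
  show ?thesis
  proof (rule that)
    show "euler = dilate 5 (theta (\<lambda>j. 15 * tri j + 7 * j) (\<lambda>j. alt (f 0 j)) + theta (\<lambda>j. 15 * tri j + 13 * j + 1) (\<lambda>j. alt (f 2 j)))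
      - fps_X * dilate 5 (dilate 5 euler)
      - fps_X ^ 2 * dilate 5 (- theta (\<lambda>j. 15 * tri j + 16 * j + 2) (\<lambda>j. alt (f 3 j)) - theta (\<lambda>j. 15 * tri j + 19 * j + 4) (\<lambda>j. alt (f 4 j)))"
      by (subst sum) (simp add: p0 p1[unfolded middle] p2 p3 p4 dilate_add dilate_diff dilate_minus algebra_simps del: One_nat_def)
  qed
qed

text \<open>
  Triangular numbers are congruent to 0, 1 or 3 modulo 5.
\<close>

lemma euler_cube_slice: "fps_nth (euler ^ 3) (5 * n + 2) = 0"
proof -
  have "tri l \<noteq> int (5 * n + 2)" for l
  proof
    assume "tri l = int (5 * n + 2)"
    then have "l * (l - 1) = 10 * int n + 4" using two_tri[of l] by simp
    also have "\<dots> = 4 + (2 * int n) * 5" by simp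
    finally have "(l * (l - 1)) mod 5 = (4 + (2 * int n) * 5) mod 5" by (rule arg_cong)
    then have "((l mod 5) * ((l - 1) mod 5)) mod 5 = 4"
      by (simp only: mod_mult_eq mod_mult_self1) simp
    moreover have "l mod 5 = 0 \<and> (l - 1) mod 5 = 4 \<or> l mod 5 = 1 \<and> (l - 1) mod 5 = 0
        \<or> l mod 5 = 2 \<and> (l - 1) mod 5 = 1 \<or> l mod 5 = 3 \<and> (l - 1) mod 5 = 2 \<or> l mod 5 = 4 \<and> (l - 1) mod 5 = 3"
      by presburger
    ultimately show False by (elim disjE conjE) simp_all
  qed
  then have "{l. tri l = int (5 * n + 2)} = {}" by blast
  then show ?thesis by (simp only: euler_cube theta_nth sum.empty)
qed

section \<open>Quadratic identities for psi\<close>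

text \<open>
  For the weights \<open>1\<close>, \<open>psi_factor\<close> with \<open>s = 4\<close> and \<open>s = 3\<close> are Ramanujan's \<open>f(q, q\<^sup>4)\<close> and \<open>f(q\<^sup>2, q\<^sup>3)\<close>; for the
  weights \<open>alt\<close>, the signs of both arguments are reversed.
\<close>

definition psi_factor :: "(int \<Rightarrow> int) \<Rightarrow> int \<Rightarrow> int fps" where
  "psi_factor w s = theta (\<lambda>k. 5 * tri k + s * k) w"

lemma admissible_theta_exponent: "0 < s \<Longrightarrow> s < m \<Longrightarrow> admissible (\<lambda>k. int m * tri k + int s * k)"
proof (rule admissibleI)
  assume "0 < s" "s < m"
  from theta_exponent_bound[OF this]
  show "0 \<le> int m * tri l + int s * l" "\<bar>l\<bar> \<le> int m * tri l + int s * l + 1" for l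
    by (smt (verit))+
qed

lemma euler_mult_euler_5:
  "psi_factor alt 4 * psi_factor alt 3 = euler * dilate 5 euler"
proof -
  have "{1..5} = {1, 2, 3, 4, 5 :: nat}" by auto
  then have "euler = qprod (-1) 5 1 * qprod (-1) 5 2 * qprod (-1) 5 3 * qprod (-1) 5 4 * qprod (-1) 5 5"
    using qprod_split[of 5 "-1"] by (simp add: euler_def mult_ac)
  moreover have "dilate 5 euler = qprod (-1) 5 5" by (simp add: euler_def dilate_qprod)
  moreover have "psi_factor alt 4 = qprod (-1) 5 5 * (qprod (-1) 5 4 * qprod (-1) 5 1)"
    using jacobi_triple_product[of 4 5 "-1"] by (simp add: psi_factor_def if_alt)
  moreover have "psi_factor alt 3 = qprod (-1) 5 5 * (qprod (-1) 5 3 * qprod (-1) 5 2)"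
    using jacobi_triple_product[of 3 5 "-1"] by (simp add: psi_factor_def if_alt)
  ultimately show ?thesis by (simp add: mult_ac)
qed

text \<open>
  Write the exponents of \<open>\<psi>\<^sup>2\<close> as \<open>(X\<^sup>2 + Y\<^sup>2 - 2)/8\<close> with \<open>X = 4 s + 1\<close>, \<open>Y = 4 t + 1\<close>, and sort the Gaussian integers
  \<open>X + i Y\<close> modulo \<open>2 + i\<close>. The multiples of \<open>2 + i\<close> give \<open>q \<psi>(5)\<^sup>2\<close>. Each of the others is a unit times exactly one number
  of the form \<open>(4 k - 2 l + 1) + i (2 k + 4 l + 1)\<close>; the parities of \<open>k\<close> and \<open>l\<close> decide which unit makes both
  coordinates congruent to 1 modulo 4. In these coordinates the sum separates.
\<close>

lemma psi_square_identity:
  "psi ^ 2 = fps_X * dilate 5 psi ^ 2 + psi_factor (\<lambda>_. 1) 4 * psi_factor (\<lambda>_. 1) 3"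
proof -
  define e :: "int \<Rightarrow> int" where "e k = k * (2 * k + 1)" for k
  define ee where "ee = (\<lambda>(s, t). e s + e t)"
  define E where "E = (\<lambda>(k, l). (5 * tri k + 4 * k) + (5 * tri l + 3 * l))"
  define f :: "nat \<Rightarrow> int \<times> int \<Rightarrow> int \<times> int" where
    "f c = (\<lambda>(i, j). if c = 0 then (2 * i - j, i + 2 * j)
      else if c = 1 then (i + 2 * j + 1, j - 2 * i)
      else if c = 2 then (- i - 2 * j - 1, 2 * i - j + 1)
      else if c = 3 then (j - 2 * i - 1, - i - 2 * j - 2)
      else (- 2 * i - j - 1, 2 * j - i))" for c
  \<comment> \<open>The image of \<open>f 4\<close> consists of the multiples of \<open>2 + i\<close>. For \<open>c < 4\<close>, \<open>f c\<close> corresponds to the parities of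
    \<open>(k, l)\<close> in \<open>g c\<close>.\<close>
  define g :: "nat \<Rightarrow> int \<times> int \<Rightarrow> int \<times> int" where
    "g c = (\<lambda>(i, j). (2 * i + (if c < 2 then 0 else 1), 2 * j + (if even c then 0 else 1)))" for c
  define cls :: "int \<times> int \<Rightarrow> nat" where "cls = (\<lambda>(s, t). nat ((s - 2 * t) mod 5))"
  define cls' :: "int \<times> int \<Rightarrow> nat" where
    "cls' = (\<lambda>(k, l). if even k then (if even l then 0 else 1) else (if even l then 2 else 3))"
  have adm_e: "admissible e" unfolding e_def by (rule admissible_psi)
  have adm: "admissible ee" unfolding ee_def by (rule admissible_pair) (rule adm_e)+
  have adm4: "admissible (\<lambda>k. 5 * tri k + 4 * k)" and adm3: "admissible (\<lambda>k. 5 * tri k + 3 * k)"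
    using admissible_theta_exponent[of 4 5] admissible_theta_exponent[of 3 5] by simp_all
  have admE: "admissible E" unfolding E_def by (rule admissible_pair[OF adm4 adm3])
  have sq: "psi ^ 2 = theta ee (\<lambda>_. 1)"
  proof -
    have "psi ^ 2 = theta ee (\<lambda>(s, t). 1 * 1)"
      unfolding psi_def power2_eq_square ee_def e_def by (rule theta_mult) (rule admissible_psi)+
    then show ?thesis by (simp add: case_prod_unfold)
  qed
  have lhs: "theta ee (\<lambda>_. 1) = (\<Sum>c\<in>{0,1,2,3,4}. theta (\<lambda>p. ee (f c p)) (\<lambda>p. 1))"
  proof (rule theta_partition_classes[OF adm, where cls = cls])
    fix p :: "int \<times> int"
    obtain s t where p: "p = (s, t)" by (cases p)
    define k where "k = (s - 2 * t) div 5"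
    have "(s - 2 * t) mod 5 \<in> {0..<5}" by simp
    then have r: "(s - 2 * t) mod 5 \<in> {0,1,2,3,4}" by (simp; linarith)
    then show "cls p \<in> {0,1,2,3,4}" unfolding cls_def p by auto
    have s: "s = 2 * t + 5 * k + (s - 2 * t) mod 5" unfolding k_def by simp
    have "\<exists>j. p = f (cls p) j" if "(s - 2 * t) mod 5 = 0"
      using s that by (intro exI[of _ "(t + 2 * k, - k)"]) (simp add: f_def cls_def p)
    moreover have "\<exists>j. p = f (cls p) j" if "(s - 2 * t) mod 5 = 1"
      using s that by (intro exI[of _ "(k, t + 2 * k)"]) (simp add: f_def cls_def p)
    moreover have "\<exists>j. p = f (cls p) j" if "(s - 2 * t) mod 5 = 2"
      using s that by (intro exI[of _ "(- k - 1, - 2 * k - 1 - t)"]) (simp add: f_def cls_def p)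
    moreover have "\<exists>j. p = f (cls p) j" if "(s - 2 * t) mod 5 = 3"
      using s that by (intro exI[of _ "(- t - 2 * k - 2, k)"]) (simp add: f_def cls_def p)
    moreover have "\<exists>j. p = f (cls p) j" if "(s - 2 * t) mod 5 = 4"
      using s that by (intro exI[of _ "(- 2 * k - 2 - t, - k - 1)"]) (simp add: f_def cls_def p)
    ultimately show "\<exists>j. p = f (cls p) j"
      using r by blast
  next
    fix c :: nat and p :: "int \<times> int"
    obtain i j where p: "p = (i, j)" by (cases p)
    assume "c \<in> {0,1,2,3,4}"
    moreover have "cls (x, y) = r" if "x - 2 * y = 5 * q + int r" "r < 5" for x y q r
      using that by (simp add: cls_def)
    note this[of _ _ "- j" 0] this[of _ _ i 1] this[of _ _ "- i - 1" 2] this[of _ _ j 3] this[of _ _ "- j - 1" 4]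
    ultimately show "cls (f c p) = c"
      unfolding f_def p by (elim insertE emptyE) simp_all
  next
    fix c :: nat
    assume "c \<in> {0,1,2,3,4}"
    then show "inj (f c)"
      unfolding f_def
      by - (elim insertE emptyE; rule injI; rename_tac p p'; case_tac p; case_tac p'; simp; presburger)
  qed simp
  have rhs: "theta E (\<lambda>_. 1) = (\<Sum>c\<in>{0,1,2,3}. theta (\<lambda>p. E (g c p)) (\<lambda>p. 1))"
  proof (rule theta_partition_classes[OF admE, where cls = cls'])
    fix p :: "int \<times> int"
    obtain k l where p: "p = (k, l)" by (cases p)
    show "cls' p \<in> {0,1,2,3}" unfolding cls'_def p by simp
    show "\<exists>j. p = g (cls' p) j"
      by (rule exI[of _ "(k div 2, l div 2)"]) (auto simp: g_def cls'_def p)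
  next
    fix c :: nat and p :: "int \<times> int"
    assume "c \<in> {0,1,2,3}"
    then show "cls' (g c p) = c"
      unfolding g_def cls'_def by (cases p) auto
  next
    fix c :: nat
    show "inj (g c)" unfolding g_def by (auto intro!: injI)
  qed simp
  have two: "2 * E (k, l) = 5 * (k * k) + 3 * k + 5 * (l * l) + l" for k l
    using two_tri[of k] two_tri[of l] by (simp add: E_def algebra_simps)
  have match: "ee (f c p) = E (g c p)" if "c \<in> {0,1,2,3}" for c p
  proof -
    obtain i j where p: "p = (i, j)" by (cases p)
    have "2 * ee (f c p) = 2 * E (g c p)"
      using that unfolding g_def p prod.case two
      by (elim insertE emptyE) (simp_all add: f_def ee_def e_def algebra_simps)
    then show ?thesis by simp
  qed
  have four: "theta (\<lambda>p. ee (f 4 p)) (\<lambda>p. 1) = fps_X * dilate 5 psi ^ 2"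
  proof -
    have adm5: "admissible (\<lambda>p. int 5 * ee p)"
    proof -
      have "inj (f 4)"
        unfolding f_def by (rule injI; rename_tac p p'; case_tac p; case_tac p'; simp; presburger)
      then have "admissible (\<lambda>p. ee (f 4 p))" by (rule admissible_inj[OF adm])
      moreover have eq: "ee (f 4 p) = int 5 * ee p + 1" for p
        by (cases p) (simp add: f_def ee_def e_def algebra_simps)
      ultimately have *: "finite {p. int 5 * ee p + 1 = int n}" for n
        by (simp add: admissible_def)
      have "{p. int 5 * ee p = int n} = {p. int 5 * ee p + 1 = int (Suc n)}" for n by auto
      then have "finite {p. int 5 * ee p = int n}" for n using *[of "Suc n"] by (simp only:)
      moreover have "0 \<le> int 5 * ee p" for p
      proof -
        have "0 \<le> ee p" using adm unfolding admissible_def by blast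
        then show ?thesis by simp
      qed
      ultimately show ?thesis unfolding admissible_def by blast
    qed
    have "theta (\<lambda>p. ee (f 4 p)) (\<lambda>p. 1) = theta (\<lambda>p. int 5 * ee p + int 1) (\<lambda>p. 1)"
      by (rule theta_cong; rename_tac p; case_tac p) (simp_all add: f_def ee_def e_def algebra_simps)
    also have "\<dots> = fps_X * dilate 5 (theta ee (\<lambda>_. 1))"
      unfolding theta_shift[OF adm5] by (simp only: theta_dilate power_one_right)
    finally show ?thesis unfolding sq[symmetric] by (simp add: dilate_power)
  qed
  have "psi ^ 2 = theta (\<lambda>p. ee (f 4 p)) (\<lambda>p. 1) + (\<Sum>c\<in>{0,1,2,3}. theta (\<lambda>p. ee (f c p)) (\<lambda>p. 1))"
    unfolding sq lhs by simp
  also have "(\<Sum>c\<in>{0,1,2,3}. theta (\<lambda>p. ee (f c p)) (\<lambda>p. 1)) = theta E (\<lambda>_. 1)"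
    unfolding rhs by (rule sum.cong[OF refl]) (simp only: match)
  also have "theta E (\<lambda>_. 1) = theta E (\<lambda>(k, l). 1 * 1)"
    by (simp add: case_prod_unfold)
  also have "\<dots> = psi_factor (\<lambda>_. 1) 4 * psi_factor (\<lambda>_. 1) 3"
    unfolding psi_factor_def E_def by (rule theta_mult[OF adm4 adm3, symmetric])
  finally show ?thesis unfolding four .
qed

text \<open>
  Up to the substitution \<open>q\<^sup>2\<close> for \<open>q\<close>, the parts of \<open>psi\<close> with even and with odd exponents.
\<close>

definition psi_even :: "int fps" where "psi_even = theta (\<lambda>k. 4 * (k * k) + 1 * k) (\<lambda>_. 1)"
definition psi_odd :: "int fps" where "psi_odd = theta (\<lambda>k. 4 * (k * k) + 3 * k) (\<lambda>_. 1)"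

lemma psi_parity_split: "psi = dilate 2 psi_even + fps_X * dilate 2 psi_odd"
proof -
  define f :: "nat \<Rightarrow> int \<Rightarrow> int" where "f c j = (if c = 0 then 2 * j else - 2 * j - 1)" for c j
  have adm: "admissible (\<lambda>k::int. 4 * (k * k) + 1 * k)" "admissible (\<lambda>k::int. 8 * (k * k) + 6 * k)"
    using admissible_quadratic[of 1 4] admissible_quadratic[of 6 8] by simp_all
  have "psi = (\<Sum>c\<in>{0,1}. theta (\<lambda>j. f c j * (2 * f c j + 1)) (\<lambda>j. 1))"
    unfolding psi_def
  proof (rule theta_partition[OF admissible_psi])
    fix i :: int
    have "(\<exists>j. i = 2 * j) \<or> (\<exists>j. i = - 2 * j - 1)" by presburger
    then show "\<exists>c\<in>{0,1}. \<exists>j. i = f c j" unfolding f_def by auto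
  next
    fix c c' and j j' :: int
    assume "c \<in> {0,1}" "c' \<in> {0,1}" "f c j = f c' j'"
    then show "c = c' \<and> j = j'"
      unfolding f_def by - (cases "c = 0"; cases "c' = 0"; simp; presburger)
  qed simp
  also have "\<dots> = theta (\<lambda>j. int 2 * (4 * (j * j) + 1 * j)) (\<lambda>_. 1) + theta (\<lambda>j. int 2 * (4 * (j * j) + 3 * j) + int 1) (\<lambda>_. 1)"
  proof -
    have "theta (\<lambda>j. f 0 j * (2 * f 0 j + 1)) (\<lambda>j. 1) = theta (\<lambda>j. int 2 * (4 * (j * j) + 1 * j)) (\<lambda>_. 1)"
      "theta (\<lambda>j. f 1 j * (2 * f 1 j + 1)) (\<lambda>j. 1) = theta (\<lambda>j. int 2 * (4 * (j * j) + 3 * j) + int 1) (\<lambda>_. 1)"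
      by (rule theta_cong; simp add: f_def algebra_simps)+
    then show ?thesis by simp
  qed
  also have "\<dots> = dilate 2 psi_even + fps_X * dilate 2 psi_odd"
  proof -
    have "admissible (\<lambda>j::int. int 2 * (4 * (j * j) + 3 * j))"
      using adm(2) by (simp add: algebra_simps)
    from theta_shift[OF this, of 1] show ?thesis
      unfolding psi_even_def psi_odd_def by (simp only: theta_dilate power_one_right zero_less_numeral)
  qed
  finally show ?thesis .
qed

text \<open>
  In terms of odd squares, this is the substitution of \<open>((X + Y)/2, (X - Y)/2)\<close> for \<open>(X, Y)\<close> with \<open>X \<equiv> \<plusminus>1\<close> and \<open>Y \<equiv> \<plusminus>3\<close>
  modulo 8. On the parameters it is one of two affine maps, according to a parity.
\<close>

lemma psi_even_mult_psi_odd: "psi_even * psi_odd = psi * dilate 4 psi"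
proof -
  define E where "E = (\<lambda>(k::int, l::int). (4 * (k * k) + 1 * k) + (4 * (l * l) + 3 * l))"
  define H where "H = (\<lambda>(m::int, n::int). m * (2 * m + 1) + int 4 * (n * (2 * n + 1)))"
  define f :: "nat \<Rightarrow> int \<times> int \<Rightarrow> int \<times> int" where
    "f c = (\<lambda>(i, n). if c = 0 then (n - i, n + i) else (- n - i - 1, i - n))" for c
  define g :: "nat \<Rightarrow> int \<times> int \<Rightarrow> int \<times> int" where
    "g c = (\<lambda>(i, n). (if c = 0 then 2 * i else 2 * i + 1, n))" for c
  have adm: "admissible (\<lambda>k::int. 4 * (k * k) + 1 * k)" "admissible (\<lambda>k::int. 4 * (k * k) + 3 * k)"
    using admissible_quadratic[of 1 4] admissible_quadratic[of 3 4] by simp_all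
  have adm4: "admissible (\<lambda>n::int. int 4 * (n * (2 * n + 1)))"
    using admissible_quadratic[of 4 8] by (simp add: algebra_simps)
  have E: "admissible E" unfolding E_def by (rule admissible_pair[OF adm])
  have H: "admissible H" unfolding H_def by (rule admissible_pair[OF admissible_psi adm4])
  have "psi_even * psi_odd = theta E (\<lambda>(k, l). 1 * 1)"
    unfolding psi_even_def psi_odd_def E_def by (rule theta_mult[OF adm])
  then have 1: "psi_even * psi_odd = theta E (\<lambda>_. 1)" by (simp add: case_prod_unfold)
  have "psi * dilate 4 psi = theta (\<lambda>m. m * (2 * m + 1)) (\<lambda>_. 1) * theta (\<lambda>n. int 4 * (n * (2 * n + 1))) (\<lambda>_. 1)"
    unfolding psi_def by (simp only: theta_dilate zero_less_numeral)
  also have "\<dots> = theta H (\<lambda>(k, l). 1 * 1)"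
    unfolding H_def by (rule theta_mult[OF admissible_psi adm4])
  finally have 2: "psi * dilate 4 psi = theta H (\<lambda>_. 1)" by (simp add: case_prod_unfold)
  have 3: "theta E (\<lambda>_. 1) = (\<Sum>c\<in>{0,1}. theta (\<lambda>p. E (f c p)) (\<lambda>p. 1))"
  proof (rule theta_partition_classes[OF E, where cls = "\<lambda>(k, l). if even (k + l) then 0 else 1"])
    fix p :: "int \<times> int"
    obtain k l where p: "p = (k, l)" by (cases p)
    show "(case p of (k, l) \<Rightarrow> if even (k + l) then 0 else 1) \<in> {0, 1::nat}" by (simp add: p)
    show "\<exists>j. p = f (case p of (k, l) \<Rightarrow> if even (k + l) then 0 else 1) j"
    proof (cases "even (k + l)")
      case True
      then obtain n where "k + l = 2 * n" by (rule evenE)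
      then have k: "k = 2 * n - l" by simp
      show ?thesis
        unfolding p k by (rule exI[of _ "(l - n, n)"]) (simp add: f_def)
    next
      case False
      then obtain n where "k + l = 2 * n + 1" by (rule oddE)
      then have k: "k = 2 * n + 1 - l" by simp
      show ?thesis
        unfolding p k by (rule exI[of _ "(l - n - 1, - n - 1)"]) (simp add: f_def)
    qed
  next
    fix c :: nat and p :: "int \<times> int"
    obtain i n where p: "p = (i, n)" by (cases p)
    have sum: "n - i + (n + i) = 2 * n" "- n - i - 1 + (i - n) = 2 * (- n - 1) + 1" by simp_all
    assume "c \<in> {0,1}"
    then have "c = 0 \<or> c = 1" by simp
    then show "(case f c p of (k, l) \<Rightarrow> if even (k + l) then 0 else 1) = c"
      unfolding f_def p
      by (elim disjE; simp only: prod.case refl if_True if_False one_neq_zero sum) simp_all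
  next
    fix c :: nat
    show "inj (f c)" unfolding f_def
      by - (rule injI; rename_tac p p'; case_tac p; case_tac p'; cases "c = 0"; simp; presburger)
  qed simp
  have 4: "theta H (\<lambda>_. 1) = (\<Sum>c\<in>{0,1}. theta (\<lambda>p. H (g c p)) (\<lambda>p. 1))"
  proof (rule theta_partition_classes[OF H, where cls = "\<lambda>(m, n). if even m then 0 else 1"])
    fix p :: "int \<times> int"
    obtain m n where p: "p = (m, n)" by (cases p)
    show "(case p of (m, n) \<Rightarrow> if even m then 0 else 1) \<in> {0, 1::nat}" by (simp add: p)
    show "\<exists>j. p = g (case p of (m, n) \<Rightarrow> if even m then 0 else 1) j"
      by (rule exI[of _ "(m div 2, n)"]) (simp add: g_def p)
  next
    fix c :: nat and p :: "int \<times> int"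
    assume "c \<in> {0,1}"
    then show "(case g c p of (m, n) \<Rightarrow> if even m then 0 else 1) = c"
      unfolding g_def by (cases p) auto
  next
    fix c :: nat
    show "inj (g c)" unfolding g_def by (auto intro!: injI split: if_splits)
  qed simp
  have "E (f c p) = H (g c p)" if "c \<in> {0,1}" for c p
    using that unfolding E_def f_def H_def g_def by (cases p) (auto simp: algebra_simps)
  then have "(\<Sum>c\<in>{0,1}. theta (\<lambda>p. E (f c p)) (\<lambda>p. 1)) = (\<Sum>c\<in>{0,1}. theta (\<lambda>p. H (g c p)) (\<lambda>p. 1))"
    by (intro sum.cong refl) presburger
  then show ?thesis unfolding 1 2 3 4 .
qed

section \<open>Theta series modulo 2\<close>

definition squares :: "int fps" where
  "squares = theta (\<lambda>k. k * k) (\<lambda>k. if 0 < k then 1 else 0)"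

lemma theta4_as_squares:
  obtains A where "theta4 = 1 + 2 * A" "\<And>n. even (fps_nth A n - fps_nth squares n)" "fps_nth A 0 = 0"
proof -
  define wp where "wp k = (if 0 < k then alt k else 0)" for k
  define wn where "wn k = (if k < 0 then alt k else 0)" for k
  define A where "A = theta (\<lambda>k::int. k * k) wp"
  have w0: "theta (\<lambda>k::int. k * k) (\<lambda>k. if k = 0 then 1 else 0) = 1"
  proof (rule fps_ext)
    fix n
    define S where "S = {k::int. k * k = int n}"
    have "finite S"
      using admissible_square by (simp add: admissible_def S_def)
    then have "(\<Sum>k\<in>S. if k = 0 then 1 else 0) = (if 0 \<in> S then 1 else (0::int))"
      by (rule sum.delta)
    also have "0 \<in> S \<longleftrightarrow> n = 0" by (auto simp: S_def)
    finally show "fps_nth (theta (\<lambda>k::int. k * k) (\<lambda>k. if k = 0 then 1 else 0)) n = fps_nth 1 n"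
      by (simp only: theta_nth S_def fps_one_nth)
  qed
  have wn: "theta (\<lambda>k::int. k * k) wn = A"
  proof -
    have "A = theta (\<lambda>k::int. (- k) * (- k)) (\<lambda>k. wp (- k))"
      unfolding A_def by (rule theta_reindex[symmetric], rule bij_betw_byWitness[where f'=uminus]) auto
    also have "\<dots> = theta (\<lambda>k::int. k * k) wn"
      by (rule theta_cong) (auto simp: wp_def wn_def alt_def)
    finally show ?thesis ..
  qed
  have "theta4 = theta (\<lambda>k::int. k * k) (\<lambda>k. (if k = 0 then 1 else 0) + (wp k + wn k))"
    unfolding theta4_def by (rule theta_cong) (auto simp: wp_def wn_def alt_def)
  also have "\<dots> = 1 + theta (\<lambda>k::int. k * k) (\<lambda>k. wp k + wn k)"
    by (subst theta_add_weight) (simp only: w0)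
  also have "theta (\<lambda>k::int. k * k) (\<lambda>k. wp k + wn k) = A + A"
    by (subst theta_add_weight) (simp only: wn A_def)
  finally have 1: "theta4 = 1 + 2 * A" by (simp only: mult_2)
  have 2: "even (fps_nth A n - fps_nth squares n)" for n
    unfolding A_def squares_def theta_nth sum_subtractf[symmetric]
    by (rule dvd_sum) (auto simp: wp_def alt_def)
  have 3: "fps_nth A 0 = 0"
    unfolding A_def theta_nth by (rule sum.neutral) (auto simp: wp_def)
  show ?thesis by (rule that[OF 1 2 3])
qed

text \<open>
  Even squares are four times squares, and the odd squares are the numbers \<open>8 k (2 k + 1) + 1 = (4 k + 1)\<^sup>2\<close>.
\<close>

lemma squares_split: "squares = dilate 4 squares + fps_X * dilate 8 psi"
proof -
  define f :: "nat \<Rightarrow> int \<Rightarrow> int" where "f c j = (if c = 0 then 2 * j else if c = 1 then 4 * j + 1 else - 4 * j - 1)" for c j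
  have "squares = (\<Sum>c\<in>{0,1,2}. theta (\<lambda>j. f c j * f c j) (\<lambda>j. if 0 < f c j then 1 else 0))"
    unfolding squares_def
  proof (rule theta_partition[OF admissible_square])
    fix i :: int
    have "(\<exists>j. i = 2 * j) \<or> (\<exists>j. i = 4 * j + 1) \<or> (\<exists>j. i = - 4 * j - 1)" by presburger
    then show "\<exists>c\<in>{0,1,2}. \<exists>j. i = f c j" unfolding f_def by simp
  next
    fix c c' and j j' :: int
    assume "c \<in> {0,1,2}" "c' \<in> {0,1,2}" "f c j = f c' j'"
    then show "c = c' \<and> j = j'"
      unfolding f_def by - (elim insertE emptyE; simp; presburger)
  qed simp
  also have "\<dots> = theta (\<lambda>j. int 4 * (j * j)) (\<lambda>k. if 0 < k then 1 else 0)
      + theta (\<lambda>j. int 8 * (j * (2 * j + 1)) + int 1) (\<lambda>j. (if 0 \<le> j then 1 else 0) + (if j < 0 then 1 else 0))"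
  proof -
    have "theta (\<lambda>j. f 0 j * f 0 j) (\<lambda>j. if 0 < f 0 j then 1 else 0) = theta (\<lambda>j. int 4 * (j * j)) (\<lambda>k. if 0 < k then 1 else 0)"
      by (rule theta_cong) (auto simp: f_def algebra_simps)
    moreover have "theta (\<lambda>j. f 1 j * f 1 j) (\<lambda>j. if 0 < f 1 j then 1 else 0)
        = theta (\<lambda>j. int 8 * (j * (2 * j + 1)) + int 1) (\<lambda>j. if 0 \<le> j then 1 else 0)"
      by (rule theta_cong) (auto simp: f_def algebra_simps)
    moreover have "theta (\<lambda>j. f 2 j * f 2 j) (\<lambda>j. if 0 < f 2 j then 1 else 0)
        = theta (\<lambda>j. int 8 * (j * (2 * j + 1)) + int 1) (\<lambda>j. if j < 0 then 1 else 0)"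
      by (rule theta_cong) (auto simp: f_def algebra_simps)
    moreover have "theta (\<lambda>j. int 8 * (j * (2 * j + 1)) + int 1) (\<lambda>j. (if 0 \<le> j then 1 else 0) + (if j < 0 then 1 else 0)) =
        theta (\<lambda>j. int 8 * (j * (2 * j + 1)) + int 1) (\<lambda>j. if 0 \<le> j then 1 else 0)
        + theta (\<lambda>j. int 8 * (j * (2 * j + 1)) + int 1) (\<lambda>j. if j < 0 then 1 else 0)"
      by (rule theta_add_weight)
    ultimately show ?thesis by simp
  qed
  also have "(\<lambda>j::int. (if 0 \<le> j then 1 else 0) + (if j < 0 then 1 else 0)) = (\<lambda>_. 1::int)" by auto
  also have "theta (\<lambda>j. int 4 * (j * j)) (\<lambda>k. if 0 < k then 1 else 0) = dilate 4 squares"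
    unfolding squares_def by (rule theta_dilate) simp
  also have "theta (\<lambda>j. int 8 * (j * (2 * j + 1)) + int 1) (\<lambda>_. 1) = fps_X * dilate 8 psi"
  proof -
    have "admissible (\<lambda>j::int. int 8 * (j * (2 * j + 1)))"
      using admissible_quadratic[of 8 16] by (simp add: algebra_simps)
    from theta_shift[OF this, of 1] show ?thesis
      unfolding psi_def by (simp only: theta_dilate power_one_right zero_less_numeral)
  qed
  finally show ?thesis .
qed

text \<open>
  Modulo 2 only the terms with odd \<open>l\<close> survive in Jacobi's series, and they run through all triangular numbers.
\<close>

lemma psi_euler_cube_parity: "even (fps_nth psi n - fps_nth (euler ^ 3) n)"
proof -
  define w :: "int \<Rightarrow> int" where "w l = (if odd l then 1 else 0)" for l
  define f :: "nat \<Rightarrow> int \<Rightarrow> int" where "f c j = (if c = 0 then 2 * j else 2 * j + 1)" for c j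
  have "theta tri w = (\<Sum>c\<in>{0,1}. theta (\<lambda>j. tri (f c j)) (\<lambda>j. w (f c j)))"
  proof (rule theta_partition[OF admissible_tri])
    fix i :: int
    have "(\<exists>j. i = 2 * j) \<or> (\<exists>j. i = 2 * j + 1)" by presburger
    then show "\<exists>c\<in>{0,1}. \<exists>j. i = f c j" unfolding f_def by auto
  next
    fix c c' and j j' :: int
    assume "c \<in> {0,1}" "c' \<in> {0,1}" "f c j = f c' j'"
    then show "c = c' \<and> j = j'"
      unfolding f_def by - (cases "c = 0"; cases "c' = 0"; simp; presburger)
  qed simp
  also have "\<dots> = psi"
  proof -
    have "theta (\<lambda>j. tri (f 0 j)) (\<lambda>j. w (f 0 j)) = theta (\<lambda>j. tri (f 0 j)) (\<lambda>j. 0)"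
      by (rule theta_cong) (auto simp: f_def w_def)
    moreover have "theta (\<lambda>j. tri (f 1 j)) (\<lambda>j. w (f 1 j)) = psi"
      unfolding psi_def
    proof (rule theta_cong)
      show "tri (f 1 j) = j * (2 * j + 1)" "w (f 1 j) = 1" for j
        using two_tri[of "f 1 j"] by (auto simp: f_def w_def algebra_simps)
    qed
    moreover have "theta (\<lambda>j. tri (f 0 j)) (\<lambda>j. 0) = 0"
      by (rule fps_ext) (simp add: theta_nth)
    ultimately show ?thesis by simp
  qed
  finally have psi_eq: "psi = theta tri w" ..
  show ?thesis
    unfolding euler_cube psi_eq theta_nth sum_subtractf[symmetric]
    by (rule dvd_sum) (auto simp: w_def alt_def)
qed

lemma psi_factor_parity: "even (fps_nth (psi_factor (\<lambda>_. 1) s) n - fps_nth (psi_factor alt s) n)"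
  unfolding psi_factor_def theta_nth sum_subtractf[symmetric]
  by (rule dvd_sum) (auto simp: alt_def)

section \<open>Components modulo 5\<close>

text \<open>
  Extraction of the exponents congruent to \<open>r\<close> modulo 5; \<open>weave\<close> below is the inverse operation.
\<close>

definition slice :: "nat \<Rightarrow> int fps \<Rightarrow> int fps" where
  "slice r f = Abs_fps (\<lambda>n. fps_nth f (5 * n + r))"

lemma slice_nth [simp]: "fps_nth (slice r f) n = fps_nth f (5 * n + r)"
  by (simp add: slice_def)

lemma slice_add: "slice r (f + g) = slice r f + slice r g"
  and slice_diff: "slice r (f - g) = slice r f - slice r g"
  by (rule fps_ext, simp)+

definition weave :: "int fps \<Rightarrow> int fps \<Rightarrow> int fps \<Rightarrow> int fps \<Rightarrow> int fps \<Rightarrow> int fps" where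
  "weave g0 g1 g2 g3 g4 = dilate 5 g0 + fps_X * dilate 5 g1 + fps_X ^ 2 * dilate 5 g2
     + fps_X ^ 3 * dilate 5 g3 + fps_X ^ 4 * dilate 5 g4"

lemma slice_X_power_dilate:
  assumes "r < 5" "k < 5"
  shows "slice r (fps_X ^ k * dilate 5 g) = (if k = r then g else 0)"
proof (rule fps_ext)
  fix n
  have "5 dvd 5 * n + r - k \<longleftrightarrow> k = r" if "k \<le> 5 * n + r"
    using assms that by presburger
  moreover have "(5 * n + r - k) div 5 = n" if "k = r" using that by simp
  ultimately show "fps_nth (slice r (fps_X ^ k * dilate 5 g)) n = fps_nth (if k = r then g else 0) n"
    by (auto simp: fps_X_power_mult_nth)
qed

lemma slice_weave:
  "slice 0 (weave g0 g1 g2 g3 g4) = g0" "slice 1 (weave g0 g1 g2 g3 g4) = g1"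
  "slice 2 (weave g0 g1 g2 g3 g4) = g2" "slice 3 (weave g0 g1 g2 g3 g4) = g3"
  "slice 4 (weave g0 g1 g2 g3 g4) = g4"
proof -
  note S = slice_X_power_dilate[where k = 0, simplified] slice_X_power_dilate[where k = 1, unfolded power_one_right]
  show "slice 0 (weave g0 g1 g2 g3 g4) = g0" "slice 1 (weave g0 g1 g2 g3 g4) = g1"
    "slice 2 (weave g0 g1 g2 g3 g4) = g2" "slice 3 (weave g0 g1 g2 g3 g4) = g3"
    "slice 4 (weave g0 g1 g2 g3 g4) = g4"
    by (simp_all add: weave_def slice_add S slice_X_power_dilate del: One_nat_def)
qed

lemma weave_slice: "weave (slice 0 f) (slice 1 f) (slice 2 f) (slice 3 f) (slice 4 f) = f"
proof (rule fps_ext)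
  fix n
  define q r :: nat where "q = n div 5" and "r = n mod 5"
  have n: "n = 5 * q + r" and "r < 5" unfolding q_def r_def by simp_all
  then have "r = 0 \<or> r = 1 \<or> r = 2 \<or> r = 3 \<or> r = 4" by auto
  then have "fps_nth (slice r (weave (slice 0 f) (slice 1 f) (slice 2 f) (slice 3 f) (slice 4 f))) q = fps_nth (slice r f) q"
    by (elim disjE) (simp_all only: slice_weave)
  then show "fps_nth (weave (slice 0 f) (slice 1 f) (slice 2 f) (slice 3 f) (slice 4 f)) n = fps_nth f n"
    by (simp add: n)
qed

lemma dilate_mult_weave: "dilate 5 g * weave g0 g1 g2 g3 g4 = weave (g * g0) (g * g1) (g * g2) (g * g3) (g * g4)"
  by (simp add: weave_def dilate_mult algebra_simps)

lemma slice_dilate_mult: "slice 1 (dilate 5 g * f) = g * slice 1 f"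
  using dilate_mult_weave[of g "slice 0 f" "slice 1 f" "slice 2 f" "slice 3 f" "slice 4 f"]
  by (metis weave_slice slice_weave(2))

lemmas dilate_ring = dilate_add dilate_diff dilate_minus dilate_mult dilate_power dilate_X dilate_numeral

lemma weave_cube:
  "(dilate 5 a - fps_X * dilate 5 e - fps_X ^ 2 * dilate 5 b) ^ 3
   = weave (a ^ 3 - 3 * fps_X * e * b ^ 2) (- 3 * a ^ 2 * e - fps_X * b ^ 3) (3 * a * e ^ 2 - 3 * a ^ 2 * b)
       (6 * a * e * b - e ^ 3) (3 * a * b ^ 2 - 3 * e ^ 2 * b)"
  unfolding weave_def by (simp only: dilate_ring zero_less_numeral) algebra

lemma weave_square:
  "(dilate 5 a - fps_X * dilate 5 e - fps_X ^ 2 * dilate 5 b) ^ 2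
   = weave (a ^ 2) (- 2 * a * e) (e ^ 2 - 2 * a * b) (2 * e * b) (b ^ 2)"
  unfolding weave_def by (simp only: dilate_ring zero_less_numeral) algebra

lemma weave_product:
  "(dilate 5 R - 2 * fps_X * dilate 5 c + 2 * fps_X ^ 4 * dilate 5 d)
      * (dilate 5 a - fps_X ^ 2 * dilate 5 e - fps_X ^ 4 * dilate 5 b)
   = weave (R * a + 2 * fps_X * c * b) (- 2 * c * a - 2 * fps_X * d * e) (- R * e)
       (2 * c * e - 2 * fps_X * d * b) (2 * d * a - R * b)"
  unfolding weave_def by (simp only: dilate_ring zero_less_numeral) algebra

text \<open>
  Once all five components of the product are named, the claim is a polynomial identity in \<open>q\<close> and
  the dilated series.
\<close>

lemma slice_1_products:
  fixes a b c d e :: "int fps"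
  defines "f \<equiv> dilate 5 a - fps_X * dilate 5 e - fps_X ^ 2 * dilate 5 b"
    and "h \<equiv> fps_X ^ 4 * dilate 5 d - fps_X * dilate 5 c"
    and "q \<equiv> fps_X :: int fps"
  shows "slice 1 f = - e"
    and "slice 1 (f * h) = - (a * c + q * b * d)"
    and "slice 1 (f * h ^ 2) = 2 * q * e * c * d"
    and "slice 1 (f * h ^ 3) = 3 * q * c * d * (a * c + q * b * d)"
    and "slice 1 (f * h ^ 4) = q ^ 3 * a * d ^ 4 - q * b * c ^ 4 - 6 * q ^ 2 * e * c ^ 2 * d ^ 2"
    and "slice 1 (f * h ^ 5) = - 10 * q ^ 2 * c ^ 2 * d ^ 2 * (a * c + q * b * d) - e * (q ^ 4 * d ^ 5 - q * c ^ 5)"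
proof -
  have "f = weave a (- e) (- b) 0 0"
    unfolding f_def weave_def by (simp only: dilate_ring zero_less_numeral dilate_0) algebra
  then show "slice 1 f = - e" by (simp only: slice_weave)
  have "f * h = weave (- q * e * d) (- (a * c + q * b * d)) (e * c) (b * c) (a * d)"
    unfolding f_def h_def q_def weave_def by (simp only: dilate_ring zero_less_numeral) algebra
  then show "slice 1 (f * h) = - (a * c + q * b * d)" by (simp only: slice_weave)
  have "f * h ^ 2 = weave (- 2 * q * a * c * d - q ^ 2 * b * d ^ 2) (2 * q * e * c * d)
      (a * c ^ 2 + 2 * q * b * c * d) (q * a * d ^ 2 - e * c ^ 2) (- q * e * d ^ 2 - b * c ^ 2)"
    unfolding f_def h_def q_def weave_def by (simp only: dilate_ring zero_less_numeral) algebra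
  then show "slice 1 (f * h ^ 2) = 2 * q * e * c * d" by (simp only: slice_weave)
  have "f * h ^ 3 = weave (3 * q ^ 2 * e * c * d ^ 2 + q * b * c ^ 3) (3 * q * c * d * (a * c + q * b * d))
      (q ^ 2 * a * d ^ 3 - 3 * q * e * c ^ 2 * d) (- a * c ^ 3 - q ^ 2 * e * d ^ 3 - 3 * q * b * c ^ 2 * d)
      (- 3 * q * a * c * d ^ 2 + e * c ^ 3 - q ^ 2 * b * d ^ 3)"
    unfolding f_def h_def q_def weave_def by (simp only: dilate_ring zero_less_numeral) algebra
  then show "slice 1 (f * h ^ 3) = 3 * q * c * d * (a * c + q * b * d)" by (simp only: slice_weave)
  have "f * h ^ 4 = weave (6 * q ^ 2 * a * c ^ 2 * d ^ 2 - q * e * c ^ 4 + 4 * q ^ 3 * b * c * d ^ 3)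
      (q ^ 3 * a * d ^ 4 - q * b * c ^ 4 - 6 * q ^ 2 * e * c ^ 2 * d ^ 2)
      (- 4 * q * a * c ^ 3 * d - q ^ 3 * e * d ^ 4 - 6 * q ^ 2 * b * c ^ 2 * d ^ 2)
      (- 4 * q ^ 2 * a * c * d ^ 3 + 4 * q * e * c ^ 3 * d - q ^ 3 * b * d ^ 4)
      (a * c ^ 4 + 4 * q ^ 2 * e * c * d ^ 3 + 4 * q * b * c ^ 3 * d)"
    unfolding f_def h_def q_def weave_def by (simp only: dilate_ring zero_less_numeral) algebra
  then show "slice 1 (f * h ^ 4) = q ^ 3 * a * d ^ 4 - q * b * c ^ 4 - 6 * q ^ 2 * e * c ^ 2 * d ^ 2"
    by (simp only: slice_weave)
  have "f * h ^ 5 = weave (a * (q ^ 4 * d ^ 5 - q * c ^ 5) - 10 * q ^ 3 * e * c ^ 2 * d ^ 3 - 5 * q ^ 2 * b * c ^ 4 * d)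
      (- 10 * q ^ 2 * c ^ 2 * d ^ 2 * (a * c + q * b * d) - e * (q ^ 4 * d ^ 5 - q * c ^ 5))
      (- 5 * q ^ 3 * a * c * d ^ 4 + 10 * q ^ 2 * e * c ^ 3 * d ^ 2 - b * (q ^ 4 * d ^ 5 - q * c ^ 5))
      (5 * q * a * c ^ 4 * d + 5 * q ^ 3 * e * c * d ^ 4 + 10 * q ^ 2 * b * c ^ 3 * d ^ 2)
      (10 * q ^ 2 * a * c ^ 2 * d ^ 3 - 5 * q * e * c ^ 4 * d + 5 * q ^ 3 * b * c * d ^ 4)"
    unfolding f_def h_def q_def weave_def by (simp only: dilate_ring zero_less_numeral) algebra
  then show "slice 1 (f * h ^ 5) = - 10 * q ^ 2 * c ^ 2 * d ^ 2 * (a * c + q * b * d) - e * (q ^ 4 * d ^ 5 - q * c ^ 5)"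
    by (simp only: slice_weave)
qed

section \<open>Relations between the components\<close>

text \<open>
  The hypotheses are the components of \<open>E\<^sup>2 = P E(2)\<close>, with \<open>a2, b2, e2\<close> the components of \<open>E(2)\<close>. To
  eliminate the latter, the intermediate aims are \<open>c b2 R = a d e\<close> and \<open>d a2 R = b c e\<close>, after which \<open>h1\<close> and \<open>h3\<close>
  can be rewritten.
\<close>

lemma dissection_elimination:
  fixes a b c d e R q a2 b2 e2 :: "'a::idom"
  assumes ab: "a * b = e ^ 2" and ab2: "a2 * b2 = e2 ^ 2" and e: "e \<noteq> 0" and q2: "2 * q \<noteq> 0"
    and h0: "a ^ 2 = R * a2 + 2 * q * c * b2"
    and h1: "a * e = c * a2 + q * d * e2"
    and h2: "e ^ 2 = R * e2"
    and h3: "e * b = c * e2 - q * d * b2"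
  shows "a * d * R = b * c ^ 2 + q * e * d ^ 2" and "b * c * R = e * c ^ 2 - q * a * d ^ 2"
proof -
  define A B where "A = R * a2" and "B = R * b2"
  have b: "b \<noteq> 0" using ab e by auto
  have AB: "A * B = e ^ 4"
  proof -
    have "A * B = R ^ 2 * (a2 * b2)" unfolding A_def B_def by algebra
    also have "\<dots> = (R * e2) ^ 2" unfolding ab2 by algebra
    also have "\<dots> = e ^ 4" unfolding h2[symmetric] by algebra
    finally show ?thesis .
  qed
  have H1: "a * e * R = c * A + q * d * e ^ 2" unfolding h1 h2 A_def by algebra
  have H3: "e * b * R = c * e ^ 2 - q * d * B" unfolding h3 h2 B_def by algebra
  have H0: "R * a ^ 2 = R * A + 2 * q * c * B" unfolding h0 A_def B_def by algebra
  have "e * (b * R * A) = e * (c * e * A - q * d * e ^ 3)"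
    using H3 AB by algebra
  then have "b * R * A = c * e * A - q * d * e ^ 3" using e by simp
  then have "b * (R * A) = b * (a ^ 2 * R - 2 * q * d * e * a)"
    using H1 ab by algebra
  then have RA: "R * A = a ^ 2 * R - 2 * q * d * e * a" using b by simp
  have "(2 * q) * (c * B) = (2 * q) * (a * d * e)"
    using RA H0 by algebra
  then have cB: "c * B = a * d * e" using q2 by (metis mult_left_cancel)
  have "e * (c * e ^ 3) = e * (d * a * A)"
    using cB AB by algebra
  then have "c * e ^ 3 = d * a * A" using e by simp
  then have "e ^ 2 * (b * c * e) = e ^ 2 * (d * A)"
    using ab by algebra
  then have dA: "b * c * e = d * A" using e by simp
  have "e * (a * d * R) = e * (b * c ^ 2 + q * e * d ^ 2)"
    using H1 dA by algebra
  then show "a * d * R = b * c ^ 2 + q * e * d ^ 2" using e by simp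
  have "e * (b * c * R) = e * (e * c ^ 2 - q * a * d ^ 2)"
    using H3 cB by algebra
  then show "b * c * R = e * c ^ 2 - q * a * d ^ 2" using e by simp
qed

text \<open>
  These are the combinations of the components that occur in \<open>slice_1_products\<close>. Each is expressed in terms of
  \<open>e\<close>, \<open>R\<close> and \<open>x\<close>. The middle one is the product of the two relations.
\<close>

lemma dissection_consequences:
  fixes a b c d e R q :: "'a::idom"
  defines "x \<equiv> q * c * d" and "T \<equiv> a * c + q * b * d"
  assumes ab: "a * b = e ^ 2" and e: "e \<noteq> 0" and cd: "c * d \<noteq> 0"
    and \<gamma>: "a * d * R = b * c ^ 2 + q * e * d ^ 2"
    and \<delta>: "b * c * R = e * c ^ 2 - q * a * d ^ 2"
  shows "T * R = e * R ^ 2 + 2 * e * x"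
    and "q ^ 3 * a * d ^ 4 - q * b * c ^ 4 = - e * R ^ 2 * x"
    and "e * (q ^ 4 * d ^ 5 - q * c ^ 5) = - e * R ^ 3 * x - x ^ 2 * T"
proof -
  have "e * (e * c * d * R ^ 2) = e * (b * c ^ 4 - q ^ 2 * a * d ^ 4)"
    using ab \<gamma> \<delta> by algebra
  then have 1: "e * c * d * R ^ 2 = b * c ^ 4 - q ^ 2 * a * d ^ 4" using e by simp
  then show 2: "q ^ 3 * a * d ^ 4 - q * b * c ^ 4 = - e * R ^ 2 * x"
    unfolding x_def by algebra
  have "(c * d) * (T * R) = (c * d) * (e * R ^ 2 + 2 * e * x)"
    unfolding x_def T_def using 1 \<gamma> \<delta> by algebra
  then show "T * R = e * R ^ 2 + 2 * e * x" using cd by (metis mult_left_cancel)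
  have "e * (q ^ 4 * d ^ 5 - q * c ^ 5) = (q ^ 3 * a * d ^ 4 - q * b * c ^ 4) * R - x ^ 2 * T"
    unfolding x_def T_def using \<gamma> \<delta> by algebra
  then show "e * (q ^ 4 * d ^ 5 - q * c ^ 5) = - e * R ^ 3 * x - x ^ 2 * T"
    unfolding 2 by algebra
qed

lemma theta4_1_nth_0: "fps_nth theta4_1 0 = 1" and theta4_2_nth_0: "fps_nth theta4_2 0 = 1"
proof -
  have zero: "{k::int. m * (k * k) + r * k = int 0} = {0}" if "\<bar>r\<bar> < m" for m r
    using linear_exponent_bound[OF that] by auto (metis abs_le_zero_iff)
  show "fps_nth theta4_1 0 = 1" "fps_nth theta4_2 0 = 1"
    unfolding theta4_1_def theta4_2_def theta_nth using zero[of 2 5] zero[of 4 5]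
    by (simp_all only: ) (simp_all add: alt_def)
qed

lemma numeral_mult_cancel: "numeral k * f = numeral k * g \<Longrightarrow> f = (g :: int fps)"
  by simp

text \<open>
  The vanishing of the component of \<open>E\<^sup>3\<close> for the class 2 is \<open>3 a (e\<^sup>2 - a b) = 0\<close>. The components of \<open>E\<^sup>2 = P E(2)\<close> feed the
  elimination.
\<close>

lemma dissection_relations:
  fixes a b :: "int fps"
  defines "e \<equiv> dilate 5 euler" and "R \<equiv> dilate 5 theta4" and "c \<equiv> theta4_1" and "d \<equiv> theta4_2"
    and "q \<equiv> fps_X :: int fps"
  assumes f1: "euler = dilate 5 a - fps_X * dilate 5 (dilate 5 euler) - fps_X ^ 2 * dilate 5 b"
  shows "a * b = e ^ 2"
    and "a * d * R = b * c ^ 2 + q * e * d ^ 2"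
    and "b * c * R = e * c ^ 2 - q * a * d ^ 2"
proof -
  have e: "e \<noteq> 0" by (simp add: e_def euler_def dilate_qprod qprod_nz)
  have f1': "euler = dilate 5 a - fps_X * dilate 5 e - fps_X ^ 2 * dilate 5 b"
    unfolding e_def by (rule f1)
  have "a \<noteq> 0"
  proof
    assume "a = 0"
    then have "fps_nth euler 0 = 0" by (subst f1) simp
    then show False by (simp add: euler_def qprod_nth_0)
  qed
  have "slice 2 (euler ^ 3) = 0" by (rule fps_ext) (simp only: slice_nth euler_cube_slice fps_zero_nth)
  then have "3 * a * e ^ 2 - 3 * a ^ 2 * b = 0"
    by (subst (asm) f1') (simp only: weave_cube slice_weave)
  then have "(3 * a) * (a * b) = (3 * a) * e ^ 2" by algebra
  moreover have "3 * a \<noteq> 0" using \<open>a \<noteq> 0\<close> by simp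
  ultimately show ab: "a * b = e ^ 2" using mult_left_cancel by blast
  define a2 b2 e2 where "a2 = dilate 2 a" and "b2 = dilate 2 b" and "e2 = dilate 2 e"
  have ab2: "a2 * b2 = e2 ^ 2"
    unfolding a2_def b2_def e2_def using arg_cong[OF ab, of "dilate 2"] by (simp add: dilate_mult dilate_power)
  have f2: "dilate 2 euler = dilate 5 a2 - fps_X ^ 2 * dilate 5 e2 - fps_X ^ 4 * dilate 5 b2"
  proof -
    have swap: "dilate 2 (dilate 5 g) = dilate 5 (dilate 2 g)" for g :: "int fps"
      by (simp add: dilate_dilate)
    show ?thesis
      by (subst f1') (simp add: a2_def b2_def e2_def dilate_ring swap flip: power_mult)
  qed
  have P: "theta4 = dilate 5 R - 2 * fps_X * dilate 5 c + 2 * fps_X ^ 4 * dilate 5 d"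
    unfolding R_def c_def d_def by (rule theta4_dissection)
  have "euler ^ 2 = theta4 * dilate 2 euler"
    using distinct_mult_theta4 distinct_mult_euler by (metis mult.assoc mult.commute power2_eq_square)
  then have "weave (a ^ 2) (- 2 * a * e) (e ^ 2 - 2 * a * b) (2 * e * b) (b ^ 2)
     = weave (R * a2 + 2 * q * c * b2) (- 2 * c * a2 - 2 * q * d * e2) (- R * e2)
       (2 * c * e2 - 2 * q * d * b2) (2 * d * a2 - R * b2)" (is "?W = ?W'")
    unfolding q_def weave_square[symmetric] weave_product[symmetric] f1'[symmetric] f2[symmetric] P[symmetric] .
  then have eqs: "slice r ?W = slice r ?W'" for r by (rule arg_cong)
  have h0: "a ^ 2 = R * a2 + 2 * q * c * b2"
    using eqs[of 0] by (simp only: slice_weave)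
  have "2 * (a * e) = 2 * (c * a2 + q * d * e2)"
    using eqs[of 1] unfolding slice_weave by algebra
  then have h1: "a * e = c * a2 + q * d * e2" by (rule numeral_mult_cancel)
  have h2: "e ^ 2 = R * e2"
    using eqs[of 2] ab unfolding slice_weave by algebra
  have "2 * (e * b) = 2 * (c * e2 - q * d * b2)"
    using eqs[of 3] unfolding slice_weave by algebra
  then have h3: "e * b = c * e2 - q * d * b2" by (rule numeral_mult_cancel)
  have q2: "2 * q \<noteq> 0" by (simp add: q_def)
  show "a * d * R = b * c ^ 2 + q * e * d ^ 2" "b * c * R = e * c ^ 2 - q * a * d ^ 2"
    by (rule dissection_elimination[OF ab ab2 e q2 h0 h1 h2 h3])+
qed

section \<open>The component of the generating function modulo 8\<close>

lemma slice_numeral_mult: "slice r (numeral k * f) = numeral k * slice r f"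
  by (rule fps_ext) (simp add: numeral_fps_const)

text \<open>
  From \<open>F (S + 2 h) = E\<close>, where \<open>S = R(5)\<close>, one obtains \<open>S\<^sup>6 F = E (S\<^sup>5 - 2 S\<^sup>4 h + \<dots> - 32 h\<^sup>5) + 64 F h\<^sup>6\<close>. Series in \<open>q\<^sup>5\<close>
  commute with taking components, and one more factor \<open>R\<close> clears the denominator in \<open>a c + q b d = e R + 2 e x / R\<close>.
\<close>

lemma slices_mod_64:
  defines "e \<equiv> dilate 5 euler" and "R \<equiv> dilate 5 theta4" and "x \<equiv> fps_X * theta4_1 * theta4_2"
  shows "\<exists>w. R ^ 7 * slice 1 distinct_gf
      = e * R ^ 6 - 60 * e * R ^ 4 * x + 144 * e * R ^ 2 * x ^ 2 + 576 * e * x ^ 3 + 64 * w"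
    and "R * slice 1 (euler * theta4 ^ 3) = - 7 * e * R ^ 4 + 36 * e * R ^ 2 * x + 48 * e * x ^ 2"
proof -
  obtain a b where f1: "euler = dilate 5 a - fps_X * dilate 5 (dilate 5 euler) - fps_X ^ 2 * dilate 5 b"
    by (rule euler_dissection)
  define c d q where "c = theta4_1" and "d = theta4_2" and "q = (fps_X :: int fps)"
  define f where "f = dilate 5 a - fps_X * dilate 5 e - fps_X ^ 2 * dilate 5 b"
  define h where "h = fps_X ^ 4 * dilate 5 d - fps_X * dilate 5 c"
  define S where "S = dilate 5 R"
  define T where "T = a * c + q * b * d"
  have euler: "euler = f" unfolding f_def e_def by (rule f1)
  have P: "theta4 = S + 2 * h"
    unfolding S_def R_def h_def c_def d_def by (subst theta4_dissection) (simp add: algebra_simps)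
  note rel = dissection_relations[OF f1, folded e_def R_def c_def d_def q_def]
  have e: "e \<noteq> 0" by (simp add: e_def euler_def dilate_qprod qprod_nz)
  have "fps_nth (c * d) 0 = 1" by (simp add: c_def d_def theta4_1_nth_0 theta4_2_nth_0)
  then have cd: "c * d \<noteq> 0" by auto
  have x: "x = q * c * d" unfolding x_def q_def c_def d_def ..
  note cons = dissection_consequences[OF rel(1) e cd rel(2,3), folded x T_def]
  note H = slice_1_products(1)[of a e b, folded f_def] slice_1_products(2-6)[where a = a and b = b and c = c and d = d and e = e, folded f_def h_def, folded q_def]
  have H0: "slice 1 f = - e" by (rule H(1))
  have H1: "slice 1 (f * h) = - T" unfolding H(2) T_def ..
  have H2: "slice 1 (f * h ^ 2) = 2 * e * x" unfolding H(3) x by algebra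
  have H3: "slice 1 (f * h ^ 3) = 3 * x * T" unfolding H(4) T_def x by algebra
  have H4: "slice 1 (f * h ^ 4) = - e * R ^ 2 * x - 6 * e * x ^ 2" unfolding H(5) cons(2) x by algebra
  have H5: "slice 1 (f * h ^ 5) = e * R ^ 3 * x - 9 * x ^ 2 * T"
    unfolding H(6) cons(3) unfolding T_def[symmetric] x by algebra
  have S: "slice 1 (S ^ k * g) = R ^ k * slice 1 g" for k g
    unfolding S_def dilate_power[symmetric, OF zero_less_numeral] by (rule slice_dilate_mult)
  have S1: "slice 1 (S * g) = R * slice 1 g" for g using S[of 1] by simp
  note lin = slice_add slice_diff slice_numeral_mult S S1 H0 H1 H2 H3 H4 H5
  show "R * slice 1 (euler * theta4 ^ 3) = - 7 * e * R ^ 4 + 36 * e * R ^ 2 * x + 48 * e * x ^ 2"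
  proof -
    have "euler * theta4 ^ 3 = S ^ 3 * f + 6 * (S ^ 2 * (f * h)) + 12 * (S * (f * h ^ 2)) + 8 * (f * h ^ 3)"
      unfolding euler P by algebra
    then have "slice 1 (euler * theta4 ^ 3) = R ^ 3 * (- e) + 6 * (R ^ 2 * (- T)) + 12 * (R * (2 * e * x)) + 8 * (3 * x * T)"
      by (simp only: lin)
    then show ?thesis using cons(1) by algebra
  qed
  have f_eq: "f = distinct_gf * (S + 2 * h)"
    unfolding euler[symmetric] P[symmetric] by (rule distinct_mult_theta4[symmetric])
  have "S ^ 6 * distinct_gf = S ^ 5 * f - 2 * (S ^ 4 * (f * h)) + 4 * (S ^ 3 * (f * h ^ 2)) - 8 * (S ^ 2 * (f * h ^ 3))
      + 16 * (S * (f * h ^ 4)) - 32 * (f * h ^ 5) + 64 * (distinct_gf * h ^ 6)"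
    unfolding f_eq by algebra
  then have "slice 1 (S ^ 6 * distinct_gf) = R ^ 5 * (- e) - 2 * (R ^ 4 * (- T)) + 4 * (R ^ 3 * (2 * e * x)) - 8 * (R ^ 2 * (3 * x * T))
      + 16 * (R * (- e * R ^ 2 * x - 6 * e * x ^ 2)) - 32 * (e * R ^ 3 * x - 9 * x ^ 2 * T) + 64 * slice 1 (distinct_gf * h ^ 6)"
    by (simp only: lin)
  then have "R ^ 7 * slice 1 distinct_gf = e * R ^ 6 - 60 * e * R ^ 4 * x + 144 * e * R ^ 2 * x ^ 2 + 576 * e * x ^ 3
      + 64 * (R * slice 1 (distinct_gf * h ^ 6))"
    unfolding S using cons(1) by algebra
  then show "\<exists>w. R ^ 7 * slice 1 distinct_gf
      = e * R ^ 6 - 60 * e * R ^ 4 * x + 144 * e * R ^ 2 * x ^ 2 + 576 * e * x ^ 3 + 64 * w" by blast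
qed

text \<open>
  Since \<open>R\<^sup>8 \<equiv> 1\<close> modulo 16, multiplying \<open>8 g\<close> by \<open>R\<^sup>8\<close> changes nothing modulo 64, and the powers of \<open>R\<close> in
  \<open>slices_mod_64\<close> can be reduced by \<open>R\<^sup>2 = 1 + 4 v\<close>. What involves only \<open>e\<close>, \<open>R\<close> and \<open>v\<close> is a series in \<open>q\<^sup>5\<close> and goes
  into \<open>K\<close>.
\<close>

lemma dsome_slice_mod_8:
  assumes A: "theta4 = 1 + 2 * A"
  defines "u \<equiv> A + A ^ 2" and "v \<equiv> dilate 5 (A + A ^ 2)" and "e \<equiv> dilate 5 euler"
  obtains K w where "slice 1 dsome_gf = dilate 5 K + 4 * (e * (1 + v - u) * u) + 8 * w"
proof -
  define R B x g where "R = dilate 5 theta4" and "B = dilate 5 A"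
    and "x = fps_X * theta4_1 * theta4_2" and "g = slice 1 dsome_gf"
  have R: "R = 1 + 2 * B" unfolding R_def B_def A by (simp add: dilate_ring)
  have v: "v = B + B ^ 2" unfolding v_def B_def by (simp add: dilate_ring)
  have R2: "R ^ 2 = 1 + 4 * v" unfolding R v by algebra
  have "theta4 ^ 2 = R ^ 2 - 4 * x"
    unfolding R_def x_def using theta4_square_identity by (simp only: mult.assoc)
  then have "(1 + 2 * A) ^ 2 = R ^ 2 - 4 * x" by (simp only: A)
  then have "4 * x = 4 * (v - u)"
    using R2 unfolding u_def by algebra
  then have x: "x = v - u"
    by (rule numeral_mult_cancel)
  obtain w0 where w0: "R ^ 7 * slice 1 distinct_gf
      = e * R ^ 6 - 60 * e * R ^ 4 * x + 144 * e * R ^ 2 * x ^ 2 + 576 * e * x ^ 3 + 64 * w0"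
    using slices_mod_64(1) unfolding R_def e_def x_def by blast
  have V: "R * slice 1 (euler * theta4 ^ 3) = - 7 * e * R ^ 4 + 36 * e * R ^ 2 * x + 48 * e * x ^ 2"
    using slices_mod_64(2) unfolding R_def e_def x_def .
  have "8 * g = slice 1 distinct_gf - slice 1 (euler * theta4 ^ 3)"
    unfolding g_def slice_numeral_mult[symmetric] slice_diff[symmetric] dsome_gf_formula ..
  then have Z: "R ^ 7 * (8 * g) = e * (R ^ 6 + 7 * R ^ 10) - e * x * (60 * R ^ 4 + 36 * R ^ 8)
      + e * x ^ 2 * (144 * R ^ 2 - 48 * R ^ 6) + 576 * e * x ^ 3 + 64 * w0"
    using w0 V by algebra
  \<comment> \<open>\<open>y\<close>, \<open>p1\<close>, \<open>p2\<close> and \<open>w1\<close> collect what is multiplied by 16 or 64; see \<open>R8\<close>, \<open>c1\<close> and \<open>c2\<close> below.\<close>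
  define y where "y = v + 6 * v ^ 2 + 16 * v ^ 3 + 16 * v ^ 4"
  define p1 where "p1 = - 2 - 17 * v - 69 * v ^ 2 - 144 * v ^ 3 - 144 * v ^ 4"
  define p2 where "p2 = 1 - 36 * v ^ 2 - 48 * v ^ 3"
  define M where "M = e * (x * (1 + v) + x ^ 2)"
  define w1 where "w1 = B * M + R * e * (x * p1 + x ^ 2 * p2 + 9 * x ^ 3) + R * w0 - 2 * g * y"
  have R4: "R ^ 4 = 1 + 8 * v + 16 * v ^ 2" using R2 by algebra
  have R8: "R ^ 8 = 1 + 16 * y" unfolding y_def using R2 by algebra
  have c1: "- (60 * R ^ 4 + 36 * R ^ 8) = 32 * (1 + v) + 64 * p1"
    unfolding p1_def using R2 by algebra
  have c2: "144 * R ^ 2 - 48 * R ^ 6 = 32 + 64 * p2"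
    unfolding p2_def using R2 by algebra
  have "8 * g = R * (R ^ 7 * (8 * g)) - 128 * (y * g)"
    using R8 by algebra
  also have "\<dots> = e * R ^ 7 * (1 + 7 * R ^ 4) + R * (e * x * (32 * (1 + v) + 64 * p1) + e * x ^ 2 * (32 + 64 * p2)
      + 576 * e * x ^ 3 + 64 * w0) - 128 * (y * g)"
    unfolding Z c1[symmetric] c2[symmetric] by algebra
  also have "\<dots> = e * R ^ 7 * (1 + 7 * R ^ 4) + 32 * (R * M) + 64 * (R * e * (x * p1 + x ^ 2 * p2 + 9 * x ^ 3)
      + R * w0 - 2 * g * y)"
    unfolding M_def by algebra
  also have "32 * (R * M) = 32 * M + 64 * (B * M)" unfolding R by algebra
  also have "e * R ^ 7 * (1 + 7 * R ^ 4) + (32 * M + 64 * (B * M)) + 64 * (R * e * (x * p1 + x ^ 2 * p2 + 9 * x ^ 3)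
      + R * w0 - 2 * g * y) = 8 * (e * R ^ 7 * (1 + 7 * v + 14 * v ^ 2) + 4 * M + 8 * w1)"
    unfolding R4 w1_def by algebra
  finally have g: "g = e * R ^ 7 * (1 + 7 * v + 14 * v ^ 2) + 4 * M + 8 * w1"
    by (rule numeral_mult_cancel)
  have M: "M = e * v + e * (1 + v - u) * u + 2 * (e * (v ^ 2 - 2 * u * v - u + u ^ 2))"
    unfolding M_def x by algebra
  define K where "K = euler * theta4 ^ 7 * (1 + 7 * u + 14 * u ^ 2) + 4 * (euler * u)"
  have "dilate 5 K = e * R ^ 7 * (1 + 7 * v + 14 * v ^ 2) + 4 * (e * v)"
    unfolding K_def e_def R_def v_def u_def by (simp add: dilate_ring)
  then have "g = dilate 5 K + 4 * (e * (1 + v - u) * u) + 8 * (w1 + e * (v ^ 2 - 2 * u * v - u + u ^ 2))"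
    unfolding g M by algebra
  then show ?thesis using that unfolding g_def by blast
qed

section \<open>Reduction modulo 2\<close>

text \<open>
  Over the field with two elements, squaring is the substitution of \<open>q\<^sup>2\<close> for \<open>q\<close>, and quadratic equations
  \<open>y\<^sup>2 + b y = c\<close> have the two solutions \<open>y\<close> and \<open>y + b\<close>.
\<close>

definition mod2 :: "int fps \<Rightarrow> bit fps" where
  "mod2 f = Abs_fps (\<lambda>n. of_int (fps_nth f n))"

lemma mod2_nth [simp]: "fps_nth (mod2 f) n = of_int (fps_nth f n)"
  by (simp add: mod2_def)

lemma of_int_bit_eq_0_iff: "(of_int k :: bit) = 0 \<longleftrightarrow> even k"
  by (cases "even k") (auto elim!: evenE oddE)

lemma mod2_eqI: "(\<And>n. even (fps_nth f n - fps_nth g n)) \<Longrightarrow> mod2 f = mod2 g"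
  by (rule fps_ext) (simp add: of_int_bit_eq_0_iff[symmetric] del: minus_bit_def even_diff)

lemma mod2_add: "mod2 (f + g) = mod2 f + mod2 g"
  and mod2_diff: "mod2 (f - g) = mod2 f - mod2 g"
  and mod2_1: "mod2 1 = 1"
  and mod2_X: "mod2 fps_X = fps_X"
  and mod2_dilate: "mod2 (dilate m f) = dilate m (mod2 f)"
  by (rule fps_ext, simp)+

lemma mod2_mult: "mod2 (f * g) = mod2 f * mod2 g"
  by (rule fps_ext) (simp add: fps_mult_nth)

lemma mod2_power: "mod2 (f ^ n) = mod2 f ^ n"
  by (induction n) (simp_all add: mod2_1 mod2_mult)

lemma two_eq_0: "(2 :: bit fps) = 0"
  by (simp add: numeral_fps_const)

text \<open>
  In the sum for the coefficient of \<open>q\<^sup>n\<close> the terms for \<open>i\<close> and \<open>n - i\<close> cancel in pairs; only \<open>i = n/2\<close> is left.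
\<close>

lemma bit_fps_square: "f ^ 2 = dilate 2 f" for f :: "bit fps"
proof (rule fps_ext)
  fix n
  define g where "g i = fps_nth f i * fps_nth f (n - i)" for i
  have split: "{0..n} = {i. 2 * i < n} \<union> ({i. 2 * i = n} \<union> {i. i \<le> n \<and> n < 2 * i})" by auto
  have fin: "finite {i. 2 * i < n}" "finite {i. 2 * i = n}" "finite {i. i \<le> n \<and> n < 2 * i}"
    by (rule finite_subset[of _ "{..n}"]; auto)+
  have "sum g {0..n} = sum g {i. 2 * i < n} + sum g ({i. 2 * i = n} \<union> {i. i \<le> n \<and> n < 2 * i})"
    unfolding split by (rule sum.union_disjoint) (use fin in auto)
  also have "sum g ({i. 2 * i = n} \<union> {i. i \<le> n \<and> n < 2 * i}) = sum g {i. 2 * i = n} + sum g {i. i \<le> n \<and> n < 2 * i}"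
    by (rule sum.union_disjoint) (use fin in auto)
  also have "sum g {i. i \<le> n \<and> n < 2 * i} = sum g {i. 2 * i < n}"
    by (rule sum.reindex_bij_witness[where i="\<lambda>i. n - i" and j="\<lambda>i. n - i"]) (auto simp: g_def mult.commute)
  also have "sum g {i. 2 * i < n} + (sum g {i. 2 * i = n} + sum g {i. 2 * i < n}) = sum g {i. 2 * i = n}"
  proof -
    have "x + (y + x) = y" for x y :: bit by (cases x; cases y) simp_all
    then show ?thesis .
  qed
  also have "sum g {i. 2 * i = n} = fps_nth (dilate 2 f) n"
  proof (cases "even n")
    case True
    then have "{i. 2 * i = n} = {n div 2}" by auto
    moreover have "n - n div 2 = n div 2" using True by auto
    moreover have "x * x = x" for x :: bit by (cases x) simp_all
    ultimately show ?thesis using True by (simp add: g_def)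
  next
    case False
    then have "{i. 2 * i = n} = {}" by auto
    then show ?thesis using False by simp
  qed
  finally show "fps_nth (f ^ 2) n = fps_nth (dilate 2 f) n"
    by (simp add: power2_eq_square fps_mult_nth g_def)
qed

lemma bit_fps_power4: "f ^ 4 = dilate 4 f" and bit_fps_power8: "f ^ 8 = dilate 8 f" for f :: "bit fps"
proof -
  have "f ^ 4 = (f ^ 2) ^ 2" by (simp flip: power_mult)
  then show 4: "f ^ 4 = dilate 4 f" by (simp add: bit_fps_square dilate_dilate)
  have "f ^ 8 = (f ^ 4) ^ 2" by (simp flip: power_mult)
  then show "f ^ 8 = dilate 8 f" unfolding 4 by (simp add: bit_fps_square dilate_dilate)
qed

text \<open>
  The two roots \<open>r\<close> and \<open>r + b\<close> of such an equation are told apart by their constant terms.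
\<close>

lemma char_2_quadratic_unique:
  fixes r s b :: "bit fps"
  assumes "r ^ 2 + b * r = s ^ 2 + b * s" and "fps_nth (r + s + b) 0 \<noteq> 0"
  shows "r = s"
proof -
  have "(r - s) * (r + s + b) = (r ^ 2 + b * r) - (s ^ 2 + b * s)" by algebra
  then have "(r - s) * (r + s + b) = 0" using assms(1) by simp
  moreover have "r + s + b \<noteq> 0" using assms(2) by force
  ultimately show ?thesis by simp
qed

text \<open>
  Three series are identified modulo 2 by their quadratic equations. With \<open>f\<close>, \<open>p\<close>, \<open>E\<close>, \<open>U\<close>, \<open>V\<close> the reductions of
  \<open>euler\<close>, \<open>psi\<close>, \<open>euler(5)\<close>, \<open>u\<close>, \<open>u(5)\<close>: first \<open>U\<^sup>2 + U = q p\<^sup>8\<close>; then \<open>G = E (1 + V - U)\<close> and \<open>f\<^sup>5\<close> are roots of the same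
  equation; and so are \<open>p U\<close> and the odd part of \<open>p\<close>. Therefore \<open>G U = f\<^sup>5 U = f\<^sup>2 (p U)\<close> is a series in \<open>q\<^sup>2\<close> times an
  odd one.
\<close>

lemma parity_identity:
  assumes A: "theta4 = 1 + 2 * A"
    and B: "mod2 A = fps_X * mod2 psi ^ 8 + mod2 A ^ 4" "fps_nth A 0 = 0"
  defines "u \<equiv> A + A ^ 2"
  shows "even n \<Longrightarrow> even (fps_nth (dilate 5 euler * (1 + dilate 5 u - u) * u) n)"
proof -
  define f p E U V \<alpha> where "f = mod2 euler" and "p = mod2 psi" and "E = dilate 5 f" and "U = mod2 u" and "V = dilate 5 U" and "\<alpha> = mod2 A"
  note two = two_eq_0
  have p: "p = f ^ 3"
    unfolding p_def f_def mod2_power[symmetric] by (rule mod2_eqI) (rule psi_euler_cube_parity)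
  have U: "U = \<alpha> + \<alpha> ^ 2" unfolding U_def u_def \<alpha>_def by (simp add: mod2_add mod2_power)
  have \<alpha>: "\<alpha> = fps_X * p ^ 8 + \<alpha> ^ 4" using B(1) unfolding \<alpha>_def p_def .
  have f0: "fps_nth f 0 = 1" by (simp add: f_def euler_def qprod_nth_0)
  have E0: "fps_nth E 0 = 1" by (simp add: E_def f0)
  have U0: "fps_nth U 0 = 0" by (simp add: U \<alpha>_def B(2) power2_eq_square)
  have V0: "fps_nth V 0 = 0" by (simp add: V_def U0)
  have UU: "U ^ 2 + U = fps_X * p ^ 8"
  proof -
    have "U ^ 2 + U = (\<alpha> + \<alpha> ^ 4) + 2 * (\<alpha> ^ 3 + \<alpha> ^ 2)" unfolding U by algebra
    also have "\<alpha> + \<alpha> ^ 4 = fps_X * p ^ 8 + 2 * \<alpha> ^ 4" using \<alpha> by algebra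
    finally show ?thesis unfolding two by simp
  qed
  have VV: "V ^ 2 + V = fps_X ^ 5 * E ^ 24"
  proof -
    have "V ^ 2 + V = dilate 5 (fps_X * p ^ 8)"
      unfolding UU[symmetric] V_def by (simp add: dilate_ring)
    also have "p ^ 8 = f ^ 24" unfolding p by (simp flip: power_mult)
    finally show ?thesis by (simp add: E_def dilate_ring)
  qed
  \<comment> \<open>The identity for \<open>\<psi>\<^sup>2\<close> modulo 2, where signs do not matter and \<open>p = f\<^sup>3\<close>.\<close>
  have key: "fps_X * E ^ 6 = f ^ 6 + f * E"
  proof -
    have "mod2 (psi_factor (\<lambda>_. 1) s) = mod2 (psi_factor alt s)" for s
      by (rule mod2_eqI) (rule psi_factor_parity)
    then have "p ^ 2 = fps_X * dilate 5 p ^ 2 + f * E"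
      using arg_cong[OF psi_square_identity, of mod2] arg_cong[OF euler_mult_euler_5, of mod2]
      by (simp add: mod2_add mod2_mult mod2_power mod2_X mod2_dilate p_def f_def E_def)
    moreover have "dilate 5 p = E ^ 3" unfolding p E_def by (simp add: dilate_ring)
    ultimately have "f ^ 6 = fps_X * E ^ 6 + f * E"
      unfolding p by (simp flip: power_mult)
    then have "f ^ 6 + f * E = fps_X * E ^ 6 + 2 * (f * E)" by algebra
    then show ?thesis using two by simp
  qed
  define G where "G = E * (1 + V - U)"
  have G: "G = f ^ 5"
  proof (rule char_2_quadratic_unique)
    have "G ^ 2 + E * G = E ^ 2 * ((U ^ 2 + U) + (V ^ 2 + V)) + 2 * (E ^ 2 * (1 + V - 2 * U - U * V))"
      unfolding G_def by algebra
    also have "\<dots> = E ^ 2 * (fps_X * f ^ 24 + fps_X ^ 5 * E ^ 24)"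
      unfolding UU VV two p by (simp flip: power_mult)
    finally have G1: "G ^ 2 + E * G = E ^ 2 * (fps_X * f ^ 24 + fps_X ^ 5 * E ^ 24)" .
    \<comment> \<open>The factor \<open>E\<^sup>4\<close> serves to express everything by \<open>q E\<^sup>6\<close>, which \<open>key\<close> evaluates.\<close>
    have "E ^ 4 * (G ^ 2 + E * G) = f ^ 24 * (fps_X * E ^ 6) + (fps_X * E ^ 6) ^ 5"
      unfolding G1 by algebra
    also have "\<dots> = E ^ 4 * ((f ^ 5) ^ 2 + E * f ^ 5)
        + 2 * (f ^ 5 * (f ^ 5 + E) * (f ^ 20 + 2 * f ^ 15 * E + 3 * f ^ 10 * E ^ 2 + 2 * f ^ 5 * E ^ 3))"
      unfolding key by algebra
    finally have "E ^ 4 * (G ^ 2 + E * G) = E ^ 4 * ((f ^ 5) ^ 2 + E * f ^ 5)"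
      unfolding two by simp
    moreover have "E ^ 4 \<noteq> 0" using E0 by auto
    ultimately show "G ^ 2 + E * G = (f ^ 5) ^ 2 + E * f ^ 5" using mult_left_cancel by blast
    show "fps_nth (G + f ^ 5 + E) 0 \<noteq> 0"
      by (simp add: G_def f0 E0 U0 V0 fps_power_zeroth)
  qed
  define O' where "O' = fps_X * dilate 2 (mod2 psi_odd)"
  have O': "O' = p * U"
  proof (rule char_2_quadratic_unique)
    have "p = mod2 psi_even ^ 2 + O'"
      unfolding p_def O'_def bit_fps_square using arg_cong[OF psi_parity_split, of mod2]
      by (simp add: mod2_add mod2_mult mod2_X mod2_dilate)
    moreover have "O' = fps_X * mod2 psi_odd ^ 2" unfolding O'_def bit_fps_square ..
    moreover have "mod2 psi_even * mod2 psi_odd = p * p ^ 4"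
      unfolding p_def bit_fps_power4 mod2_mult[symmetric] mod2_dilate[symmetric] psi_even_mult_psi_odd ..
    ultimately have "(p - O') * O' = fps_X * p ^ 10"
      by algebra
    then have "O' ^ 2 + p * O' = fps_X * p ^ 10 + 2 * O' ^ 2" by algebra
    moreover have "(p * U) ^ 2 + p * (p * U) = p ^ 2 * (U ^ 2 + U)" by algebra
    ultimately show "O' ^ 2 + p * O' = (p * U) ^ 2 + p * (p * U)"
      unfolding UU two by algebra
    show "fps_nth (O' + p * U + p) 0 \<noteq> 0"
      unfolding p by (simp add: O'_def U0 f0 fps_power_zeroth)
  qed
  have "mod2 (dilate 5 euler * (1 + dilate 5 u - u) * u) = G * U"
    by (simp add: G_def E_def f_def V_def U_def mod2_mult mod2_add mod2_diff mod2_1 mod2_dilate)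
  also have "\<dots> = f ^ 2 * (p * U)" unfolding G p by algebra
  also have "\<dots> = fps_X * dilate 2 (f * mod2 psi_odd)"
    unfolding O'[symmetric] O'_def bit_fps_square by (simp add: dilate_mult mult_ac)
  finally have *: "mod2 (dilate 5 euler * (1 + dilate 5 u - u) * u) = fps_X * dilate 2 (f * mod2 psi_odd)" .
  assume "even n"
  then have "fps_nth (mod2 (dilate 5 euler * (1 + dilate 5 u - u) * u)) n = 0"
    unfolding * by (cases n) auto
  then show "even (fps_nth (dilate 5 euler * (1 + dilate 5 u - u) * u) n)"
    by (simp only: mod2_nth of_int_bit_eq_0_iff)
qed

section \<open>The congruence\<close>

theorem theorem4p11:
  fixes n t :: nat
  assumes "1 \<le> t" and "t \<le> 4"
  shows "[DSOME (50 * n + 10 * t + 1) = 0] (mod 8)"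
proof -
  obtain A where A: "theta4 = 1 + 2 * A" "\<And>n. even (fps_nth A n - fps_nth squares n)" "fps_nth A 0 = 0"
    using theta4_as_squares by blast
  have "mod2 A = fps_X * mod2 psi ^ 8 + mod2 A ^ 4"
  proof -
    have "mod2 A = mod2 squares" by (rule mod2_eqI) (rule A(2))
    moreover have "mod2 squares = dilate 4 (mod2 squares) + fps_X * dilate 8 (mod2 psi)"
      using arg_cong[OF squares_split, of mod2] by (simp add: mod2_add mod2_mult mod2_X mod2_dilate)
    ultimately show ?thesis by (simp add: bit_fps_power4 bit_fps_power8 add.commute)
  qed
  note par = parity_identity[OF A(1) this A(3)]
  define m where "m = 10 * n + 2 * t"
  define u where "u = A + A ^ 2"
  obtain K w where K: "slice 1 dsome_gf = dilate 5 K + 4 * (dilate 5 euler * (1 + dilate 5 u - u) * u) + 8 * w"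
    using dsome_slice_mod_8[OF A(1)] unfolding u_def by blast
  have "\<not> 5 dvd m" using assms unfolding m_def by presburger
  have "even m" by (simp add: m_def)
  have "50 * n + 10 * t + 1 = 5 * m + 1" by (simp add: m_def)
  then have "DSOME (50 * n + 10 * t + 1) = fps_nth (slice 1 dsome_gf) m"
    by (simp only: slice_nth dsome_gf_nth)
  also have "\<dots> = 4 * fps_nth (dilate 5 euler * (1 + dilate 5 u - u) * u) m + 8 * fps_nth w m"
    unfolding K using \<open>\<not> 5 dvd m\<close> by (simp add: numeral_fps_const)
  also have "8 dvd \<dots>"
    using par[OF \<open>even m\<close>] unfolding u_def[symmetric] by presburger
  finally show ?thesis by (simp add: cong_0_iff)
qed

end
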